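(* Let $g \geq 1$ and $r$ be integers with $g \leq r < 2g+1$, and choose $m, n$ such that $m+n = g$ and $2m+n = r$. Let $$f(x) = x\prod_{k=1}^{m}(x^2-a_k^2)\prod_{\ell=1}^{n}(x^2+b_\ell^2),$$ where $\{a_k\}_{k=0}^{m}$ and $\{b_\ell\}_{\ell=0}^{n}$ are two strictly increasing convex sequences of nonnegative rational numbers with $a_0 = b_0 = 0$. Then the family $\mathcal{X}: y^2 = f(x)T+1$ of hyperelliptic curves satisfies $\operatorname{rank} J_{\mathcal{X}}(\mathbb{Q}(T)) = r$. In particular, one can explicitly construct a basis, consisting of $r$ elements, of the torsion-free subgroup of the Mordell--Weil group $J_{\mathcal{X}}(\mathbb{Q}(T))$.
   Context: A finite sequence $\{a_k\}_{k=0}^m$ is convex if $a_{k+1}-a_k \geq a_k - a_{k-1}$ for all $1 \leq k \leq m-1$. The equation $y^2 = f(x)T+1$ is regarded as a hyperelliptic curve (its smooth projective model) of genus $g$ over the field $\mathbb{Q}(T)$, and $J_{\mathcal{X}}$ denotes its Jacobian variety over $\mathbb{Q}(T)$. If $(B,\tau)$ is the $\mathbb{Q}(T)/\mathbb{Q}$-trace of $J_{\mathcal{X}}$, then $J_{\mathcal{X}}(\mathbb{Q}(T))/\tau(B(\mathbb{Q}))$ is a finitely generated abelian group (Lang--N\'eron); it is assumed throughout that $\tau(B(\mathbb{Q}))$ is trivial, so that this group is the Mordell--Weil group $J_{\mathcal{X}}(\mathbb{Q}(T))$, and $\operatorname{rank} J_{\mathcal{X}}(\mathbb{Q}(T))$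 is its number of free generators. "Torsion-free subgroup" means the free part of the Mordell--Weil group. *)

theory Defs
  imports
    "HOL-Computational_Algebra.Polynomial_Factorial"
    "HOL-Algebra.QuotRing"
    "HOL-Algebra.Embedded_Algebras"
    "HOL-Algebra.Free_Abelian_Groups"
begin

section \<open>The function field of a hyperelliptic curve\<close>

text \<open>
  Let \<open>F\<close> be a squarefree polynomial of odd degree over a field \<open>K\<close> of characteristic \<open>0\<close>
  (\<open>K\<close> is the type \<open>'k\<close>). The function field \<open>K(x)[y]/(y\<^sup>2 - F(x))\<close> of the curve
  \<open>y\<^sup>2 = F(x)\<close> has the \<open>K(x)\<close>-basis \<open>1, y\<close>; the pair \<open>(u, v)\<close> stands for \<open>u + v y\<close>.
\<close>

definition function_field ::
    "'k::field poly \<Rightarrow> ('k poly fract \<times> 'k poly fract) ring" where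
  "function_field F =
     \<lparr>carrier = UNIV,
      monoid.mult = (\<lambda>(u, v) (u', v'). (u * u' + to_fract F * v * v', u * v' + v * u')),
      one = (1, 0),
      ring.zero = (0, 0),
      ring.add = (\<lambda>(u, v) (u', v'). (u + u', v + v'))\<rparr>"

text \<open>\<open>of_x p\<close> is the function \<open>p(x)\<close>; constants are the \<open>of_x [:c:]\<close>.\<close>

definition of_x :: "'k::field poly \<Rightarrow> 'k poly fract \<times> 'k poly fract" where
  "of_x p = (to_fract p, 0)"

definition y_minus :: "'k::field \<Rightarrow> 'k poly fract \<times> 'k poly fract" where
  "y_minus c = (- to_fract [:c:], 1)"

section \<open>Closed points of the smooth projective model\<close>

text \<open>
  The closed points of the smooth projective model of a curve over \<open>K\<close> are the places of its
  function field over \<open>K\<close>, i.e. the normalised discrete valuations that are trivial on \<open>K\<close>.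
  The equation \<open>v \<zero> = 0\<close> only fixes the irrelevant value of the total function \<open>v\<close> at zero,
  so that a place is a unique function.
\<close>

definition places :: "'k::field poly \<Rightarrow> ('k poly fract \<times> 'k poly fract \<Rightarrow> int) set" where
  "places F = {v. let L = function_field F in
     v \<zero>\<^bsub>L\<^esub> = 0 \<and>
     (\<forall>g h. g \<noteq> \<zero>\<^bsub>L\<^esub> \<longrightarrow> h \<noteq> \<zero>\<^bsub>L\<^esub> \<longrightarrow> v (g \<otimes>\<^bsub>L\<^esub> h) = v g + v h) \<and>
     (\<forall>g h. g \<noteq> \<zero>\<^bsub>L\<^esub> \<longrightarrow> h \<noteq> \<zero>\<^bsub>L\<^esub> \<longrightarrow> g \<oplus>\<^bsub>L\<^esub> h \<noteq> \<zero>\<^bsub>L\<^esub> \<longrightarrow> min (v g) (v h) \<le> v (g \<oplus>\<^bsub>L\<^esub> h)) \<and>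
     (\<forall>c. c \<noteq> 0 \<longrightarrow> v (of_x [:c:]) = 0) \<and>
     (\<exists>g. g \<noteq> \<zero>\<^bsub>L\<^esub> \<and> v g = 1)}"

definition local_ring ::
    "'k::field poly \<Rightarrow> ('k poly fract \<times> 'k poly fract \<Rightarrow> int) \<Rightarrow>
     ('k poly fract \<times> 'k poly fract) ring" where
  "local_ring F v =
     (function_field F)\<lparr>carrier := {h. h = \<zero>\<^bsub>function_field F\<^esub> \<or> 0 \<le> v h}\<rparr>"

definition local_ideal ::
    "'k::field poly \<Rightarrow> ('k poly fract \<times> 'k poly fract \<Rightarrow> int) \<Rightarrow>
     ('k poly fract \<times> 'k poly fract) set" where
  "local_ideal F v = {h. h = \<zero>\<^bsub>function_field F\<^esub> \<or> 0 < v h}"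

text \<open>The degree of a closed point is the dimension of its residue field over \<open>K\<close>.\<close>

definition place_degree ::
    "'k::field poly \<Rightarrow> ('k poly fract \<times> 'k poly fract \<Rightarrow> int) \<Rightarrow> nat" where
  "place_degree F v =
     (let k = local_ring F v Quot local_ideal F v
      in ring.dim k (range (\<lambda>c. local_ideal F v +>\<^bsub>local_ring F v\<^esub> of_x [:c:])) (carrier k))"

section \<open>Divisors and the rational points of the Jacobian\<close>

type_synonym 'k divisor = "('k poly fract \<times> 'k poly fract \<Rightarrow> int) \<Rightarrow>\<^sub>0 int"

definition divisor_degree :: "'k::field poly \<Rightarrow> 'k divisor \<Rightarrow> int" where
  "divisor_degree F D =
     (\<Sum>v\<in>Poly_Mapping.keys D. Poly_Mapping.lookup D v * int (place_degree F v))"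

definition degree_zero_divisors :: "'k::field poly \<Rightarrow> 'k divisor monoid" where
  "degree_zero_divisors F =
     (free_Abelian_group (places F))
       \<lparr>carrier := {D \<in> carrier (free_Abelian_group (places F)). divisor_degree F D = 0}\<rparr>"

definition principal_divisors :: "'k::field poly \<Rightarrow> 'k divisor set" where
  "principal_divisors F =
     {D \<in> carrier (free_Abelian_group (places F)).
        \<exists>h. h \<noteq> \<zero>\<^bsub>function_field F\<^esub> \<and> (\<forall>v\<in>places F. Poly_Mapping.lookup D v = v h)}"

text \<open>
  The Jacobian represents the functor of divisor classes of degree zero. As the degree of \<open>F\<close> is
  odd, the curve has a \<open>K\<close>-rational point (the one at infinity), and therefore the group of
  \<open>K\<close>-rational points of its Jacobian is the group of \<open>K\<close>-rational divisors of degree zero modulo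
  divisors of functions in \<open>K(x, y)\<close>. The group is written multiplicatively; its elements are
  cosets.
\<close>

definition jacobian_points :: "'k::field poly \<Rightarrow> 'k divisor set monoid" where
  "jacobian_points F = degree_zero_divisors F Mod principal_divisors F"

text \<open>The point at infinity, the only pole of \<open>x\<close> as the degree of \<open>F\<close> is odd.\<close>

definition place_infinity ::
    "'k::field poly \<Rightarrow> ('k poly fract \<times> 'k poly fract \<Rightarrow> int)" where
  "place_infinity F = (THE v. v \<in> places F \<and> v (of_x [:0, 1:]) < 0)"

text \<open>
  For an irreducible \<open>p\<close> dividing \<open>F - c\<^sup>2\<close>, this is the closed point \<open>p(x) = 0\<close>, \<open>y = c\<close>. It is the
  Galois orbit of the points \<open>(\<alpha>, c)\<close>, where \<open>\<alpha>\<close> runs over the roots of \<open>p\<close>.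
\<close>

definition place_at ::
    "'k::field poly \<Rightarrow> 'k poly \<Rightarrow> 'k \<Rightarrow> ('k poly fract \<times> 'k poly fract \<Rightarrow> int)" where
  "place_at F p c = (THE v. v \<in> places F \<and> 0 < v (of_x p) \<and> 0 < v (y_minus c))"

text \<open>The class of \<open>P - deg(P) \<infinity>\<close>.\<close>

definition place_class ::
    "'k::field poly \<Rightarrow> ('k poly fract \<times> 'k poly fract \<Rightarrow> int) \<Rightarrow> 'k divisor set" where
  "place_class F P =
     principal_divisors F #>\<^bsub>degree_zero_divisors F\<^esub>
       (Poly_Mapping.single P 1 - Poly_Mapping.single (place_infinity F) (int (place_degree F P)))"

section \<open>Rank of an abelian group\<close>

definition torsion :: "('a, 'b) monoid_scheme \<Rightarrow> 'a set" where
  "torsion G = {x \<in> carrier G. \<exists>n::nat. 0 < n \<and> x [^]\<^bsub>G\<^esub> n = \<one>\<^bsub>G\<^esub>}"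

text \<open>
  \<open>B\<close> is a basis of a free subgroup complementary to the torsion subgroup: every element is a
  torsion element times a product of integral powers of the elements of \<open>B\<close>, with unique exponents.
\<close>

definition free_part_basis :: "('a, 'b) monoid_scheme \<Rightarrow> 'a set \<Rightarrow> bool" where
  "free_part_basis G B \<longleftrightarrow>
     B \<subseteq> carrier G \<and> finite B \<and>
     (\<forall>x\<in>carrier G. \<exists>!e. e \<in> B \<rightarrow>\<^sub>E (UNIV :: int set) \<and>
        (\<exists>t\<in>torsion G. x = finprod G (\<lambda>b. b [^]\<^bsub>G\<^esub> e b) B \<otimes>\<^bsub>G\<^esub> t))"

definition free_rank :: "('a, 'b) monoid_scheme \<Rightarrow> nat" where
  "free_rank G = (THE r. \<exists>B. free_part_basis G B \<and> card B = r)"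

section \<open>The family \<open>y\<^sup>2 = f(x) T + 1\<close> over \<open>\<rat>(T)\<close>\<close>

type_synonym ratfun = "rat poly fract"

definition rat_const :: "rat \<Rightarrow> ratfun" where
  "rat_const c = to_fract [:c:]"

definition T_var :: ratfun where
  "T_var = to_fract [:0, 1:]"

definition family :: "rat poly \<Rightarrow> ratfun poly" where
  "family f = [:T_var:] * map_poly rat_const f + 1"

definition f_poly :: "nat \<Rightarrow> nat \<Rightarrow> (nat \<Rightarrow> rat) \<Rightarrow> (nat \<Rightarrow> rat) \<Rightarrow> rat poly" where
  "f_poly m n a b =
     [:0, 1:] * (\<Prod>k=1..m. [:- ((a k)\<^sup>2), 0, 1:]) * (\<Prod>l=1..n. [:(b l)\<^sup>2, 0, 1:])"

text \<open>The sequence is \<open>a 0, \<dots>, a m\<close>; values beyond index \<open>m\<close> are irrelevant.\<close>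

definition convex_seq :: "nat \<Rightarrow> (nat \<Rightarrow> rat) \<Rightarrow> bool" where
  "convex_seq m a \<longleftrightarrow> (\<forall>k. 1 \<le> k \<and> k + 1 \<le> m \<longrightarrow> a k - a (k - 1) \<le> a (k + 1) - a k)"

definition admissible_seq :: "nat \<Rightarrow> (nat \<Rightarrow> rat) \<Rightarrow> bool" where
  "admissible_seq m a \<longleftrightarrow>
     a 0 = 0 \<and> (\<forall>k\<le>m. 0 \<le> a k) \<and> strict_mono_on {0..m} a \<and> convex_seq m a"

text \<open>
  The basis: the classes of \<open>(a\<^sub>k, 1) - \<infinity>\<close> and \<open>(-a\<^sub>k, 1) - \<infinity>\<close> for \<open>1 \<le> k \<le> m\<close>, and of
  \<open>(i b\<^sub>l, 1) + (-i b\<^sub>l, 1) - 2 \<infinity>\<close> for \<open>1 \<le> l \<le> n\<close>.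
\<close>

definition explicit_basis ::
    "nat \<Rightarrow> nat \<Rightarrow> (nat \<Rightarrow> rat) \<Rightarrow> (nat \<Rightarrow> rat) \<Rightarrow> ratfun divisor set set" where
  "explicit_basis m n a b =
     (let F = family (f_poly m n a b);
          cls = (\<lambda>p. place_class F (place_at F (map_poly rat_const p) 1))
      in (\<lambda>k. cls [:- a k, 1:]) ` {1..m} \<union> (\<lambda>k. cls [:a k, 1:]) ` {1..m} \<union>
         (\<lambda>l. cls [:(b l)\<^sup>2, 0, 1:]) ` {1..n})"

end

theory Submission
  imports Defs "HOL-Computational_Algebra.Field_as_Ring"
begin

text \<open>
  The equation \<open>y\<^sup>2 = f(x) T + 1\<close> can be solved for \<open>T\<close>. So the function field of the curve over
  \<open>\<rat>(T)\<close> is the field \<open>\<rat>(x, y)\<close> of rational functions on the plane, in which polynomials factor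
  uniquely, and the places of the curve are the valuations of \<open>\<rat>(x, y)\<close> that are trivial on
  \<open>\<rat>(T)\<close> for \<open>T = (y\<^sup>2 - 1) / f(x)\<close>.

  Besides the place at infinity there are two kinds of places. If \<open>f(x)\<close> is a unit at the
  place, then the place is the order of vanishing along an irreducible plane curve \<open>h = 0\<close>
  (\<open>centre_is_curve\<close>). Otherwise it is one of the two points \<open>P\<^sub>+\<close>, \<open>P\<^sub>-\<close> with \<open>p(x) = 0\<close> and \<open>y = 1\<close> or
  \<open>y = - 1\<close>, for an irreducible factor \<open>p\<close> of \<open>f\<close> (\<open>point_above_f\<close>). The divisor of the polynomial \<open>h\<close>
  consists of the place given by \<open>h\<close>, of such points, and of a multiple of infinity; so the points
  generate the class group. Moreover, \<open>p\<close> has the finite zeros \<open>P\<^sub>+\<close> and \<open>P\<^sub>-\<close>, and the finite zeros of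
  \<open>y - 1\<close> are the points \<open>P\<^sub>+\<close> for all \<open>p\<close>. Hence the classes of the \<open>P\<^sub>+\<close> generate, and one of them, that
  for \<open>p = x\<close>, can be omitted (\<open>generating_points\<close>).

  For the independence of these classes, suppose that the zeros and
  poles of a function are points above \<open>f = 0\<close> or infinity.
  The prime factors of its numerator and denominator are then plane curves on which \<open>T\<close> is constant.
  The fibre of \<open>T\<close> at infinity is \<open>f = 0\<close>, the fibre at \<open>0\<close> consists of \<open>y = 1\<close> and \<open>y = - 1\<close>, and all
  other fibres are irreducible, because \<open>f\<close> has odd degree (\<open>fibre_irreducible\<close>). So the function
  is an element of \<open>\<rat>(T)\<close> times a product of powers of the \<open>p\<close> and of \<open>y - 1\<close> and \<open>y + 1\<close>
  (\<open>U_criterion\<close>), and its orders at the points show that all relations come from the two kinds of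
  divisors above (\<open>independent_points\<close>). The classes of the \<open>P\<^sub>+\<close> for \<open>p \<noteq> x\<close> thus form a basis of the
  whole group of points of the Jacobian, which has no torsion. There are \<open>2 m + n\<close> of them.

  All this concerns orders at finite places only. That principal divisors have degree
  zero, with degrees defined by residue fields, determines the order at infinity. A place plus its
  conjugate under \<open>y \<mapsto> - y\<close> is the divisor of a polynomial in \<open>x\<close> up to a multiple of infinity, and
  the degrees match (\<open>conjugate_sum_principal\<close>, with the split, ramified and inert cases). The norm of a
  function therefore has the same finite zeros and poles as a product of such polynomials, and the
  quotient, having none at all, is constant by the above description of functions
  (\<open>product_formula\<close>).
\<close>

section \<open>Ring morphisms, evaluation of polynomials, and fractions\<close>

locale ring_morphism =
  fixes h :: "'a::comm_ring_1 \<Rightarrow> 'b::comm_ring_1"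
  assumes h_0 [simp]: "h 0 = 0"
    and h_1 [simp]: "h 1 = 1"
    and h_add: "h (a + b) = h a + h b"
    and h_mult: "h (a * b) = h a * h b"
begin

lemma h_uminus: "h (- a) = - h a"
  by (metis add.right_inverse add_eq_0_iff h_0 h_add)

lemma h_diff: "h (a - b) = h a - h b"
  using h_add[of a "- b"] by (simp add: h_uminus)

lemma h_power: "h (a ^ n) = h a ^ n"
  by (induct n) (auto simp: h_mult)

lemma h_prod: "h (prod g A) = (\<Prod>i\<in>A. h (g i))"
  by (induct A rule: infinite_finite_induct) (auto simp: h_mult)

lemmas h_simps = h_add h_mult h_uminus h_diff h_power

end

lemma ring_morphism_comp:
  assumes "ring_morphism g" "ring_morphism h" shows "ring_morphism (\<lambda>x. g (h x))"
proof -
  interpret g: ring_morphism g by fact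
  interpret h: ring_morphism h by fact
  show ?thesis by unfold_locales (auto simp: g.h_simps h.h_simps)
qed

lemma ring_morphism_to_fract: "ring_morphism (to_fract :: 'a::idom \<Rightarrow> _)"
  by unfold_locales auto

definition ev :: "('a::comm_ring_1 \<Rightarrow> 'b::comm_ring_1) \<Rightarrow> 'b \<Rightarrow> 'a poly \<Rightarrow> 'b" where
  "ev h x p = poly (map_poly h p) x"

context ring_morphism
begin

lemma ev_0 [simp]: "ev h x 0 = 0"
  by (simp add: ev_def)

lemma ev_pCons [simp]: "ev h x (pCons a p) = h a + x * ev h x p"
  by (simp add: ev_def map_poly_pCons)

lemma ev_1 [simp]: "ev h x 1 = 1"
  by (simp add: one_pCons)

lemma ev_add: "ev h x (p + q) = ev h x p + ev h x q"
  by (induct p q rule: poly_induct2) (auto simp: h_add algebra_simps)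

lemma ev_smult: "ev h x (Polynomial.smult a p) = h a * ev h x p"
  by (induct p) (auto simp: h_mult algebra_simps)

lemma ev_mult: "ev h x (p * q) = ev h x p * ev h x q"
  by (induct p) (auto simp: ev_add ev_smult algebra_simps)

lemma ring_morphism_ev: "ring_morphism (ev h x)"
  by unfold_locales (auto simp: ev_add ev_mult)

lemma map_poly_eq_ev: "map_poly h p = ev (\<lambda>a. [:h a:]) [:0, 1:] p"
proof -
  interpret c: ring_morphism "\<lambda>a. [:h a:]"
    by unfold_locales (auto simp: h_simps one_pCons)
  show ?thesis
    by (induct p) (auto simp: map_poly_pCons)
qed

lemma ring_morphism_map_poly: "ring_morphism (map_poly h)"
proof -
  interpret c: ring_morphism "\<lambda>a. [:h a:]"
    by unfold_locales (auto simp: h_simps one_pCons)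
  have "map_poly h = ev (\<lambda>a. [:h a:]) [:0, 1:]"
    by (rule ext) (rule map_poly_eq_ev)
  then show ?thesis
    using c.ring_morphism_ev by simp
qed

end

lemma ev_map_poly:
  assumes "ring_morphism g" "ring_morphism h"
  shows "ev g x (map_poly h p) = ev (\<lambda>a. g (h a)) x p"
proof -
  interpret g: ring_morphism g by fact
  interpret h: ring_morphism h by fact
  interpret gh: ring_morphism "\<lambda>a. g (h a)" using assms by (rule ring_morphism_comp)
  show ?thesis by (induct p) (auto simp: map_poly_pCons)
qed

text \<open>The value at a fraction \<open>p / d\<close> does not depend on the representation that \<open>SOME\<close> picks.\<close>

definition fract_lift :: "('a::idom \<Rightarrow> 'b::field) \<Rightarrow> 'a fract \<Rightarrow> 'b" where
  "fract_lift h z = (case SOME (p, d). d \<noteq> 0 \<and> z = Fract p d of (p, d) \<Rightarrow> h p / h d)"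

locale injective_morphism = ring_morphism h for h :: "'a::idom \<Rightarrow> 'b::field" +
  assumes nonzero: "h a = 0 \<Longrightarrow> a = 0"
begin

lemma h_eq_0_iff [simp]: "h a = 0 \<longleftrightarrow> a = 0"
  using nonzero by auto

lemma h_eq_iff [simp]: "h a = h b \<longleftrightarrow> a = b"
  using h_eq_0_iff[of "a - b"] by (simp add: h_diff del: h_eq_0_iff)

lemma fract_lift_Fract:
  assumes "d \<noteq> 0" shows "fract_lift h (Fract p d) = h p / h d"
proof -
  let ?P = "\<lambda>(p', d'). d' \<noteq> 0 \<and> Fract p d = Fract p' d'"
  have "?P (SOME x. ?P x)"
    by (rule someI[of ?P "(p, d)"]) (use assms in auto)
  moreover obtain p' d' where pd: "(SOME x. ?P x) = (p', d')"
    by fastforce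
  ultimately have d': "d' \<noteq> 0" and "Fract p d = Fract p' d'"
    by auto
  then have "p * d' = p' * d"
    using assms by (simp add: eq_fract)
  then have "h p * h d' = h p' * h d"
    by (metis h_mult)
  then have "h p / h d = h p' / h d'"
    using assms d' by (simp add: frac_eq_eq)
  then show ?thesis
    unfolding fract_lift_def pd by simp
qed

lemma fract_lift_to_fract [simp]: "fract_lift h (to_fract a) = h a"
  using fract_lift_Fract[of 1 a] by (simp add: Fract_conv_to_fract)

lemma injective_morphism_fract_lift: "injective_morphism (fract_lift h)"
proof unfold_locales
  show "fract_lift h 0 = 0" "fract_lift h 1 = 1"
    using fract_lift_to_fract[of 0] fract_lift_to_fract[of 1] by simp_all
next
  fix a b :: "'a fract"
  obtain p d q e where ab: "a = Fract p d" "d \<noteq> 0" "b = Fract q e" "e \<noteq> 0"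
    by (metis Fract_cases)
  then show "fract_lift h (a + b) = fract_lift h a + fract_lift h b"
    by (simp add: fract_lift_Fract h_simps add_frac_eq algebra_simps)
  show "fract_lift h (a * b) = fract_lift h a * fract_lift h b"
    using ab by (simp add: fract_lift_Fract h_simps)
next
  fix a :: "'a fract" assume "fract_lift h a = 0"
  moreover obtain p d where "a = Fract p d" "d \<noteq> 0"
    by (metis Fract_cases)
  ultimately show "a = 0"
    by (auto simp: fract_lift_Fract fract_collapse)
qed

lemma fract_lift_divide:
  "fract_lift h (to_fract p / to_fract d) = h p / h d"
proof (cases "d = 0")
  case True
  have "fract_lift h 0 = 0"
    using fract_lift_to_fract[of 0] by simp
  with True show ?thesis by simp
next
  case False
  then show ?thesis
    by (metis Fract_conv_to_fract fract_lift_Fract)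
qed

end

section \<open>Discrete valuations of a field\<close>

text \<open>The constants have a type of their own, which \<open>c\<close> embeds into the field.\<close>

locale discrete_valuation =
  fixes c :: "'k::field \<Rightarrow> 'l::field" and v :: "'l \<Rightarrow> int"
  assumes v_0 [simp]: "v 0 = 0"
    and v_mult: "g \<noteq> 0 \<Longrightarrow> h \<noteq> 0 \<Longrightarrow> v (g * h) = v g + v h"
    and v_add: "g \<noteq> 0 \<Longrightarrow> h \<noteq> 0 \<Longrightarrow> g + h \<noteq> 0 \<Longrightarrow> min (v g) (v h) \<le> v (g + h)"
    and v_const: "a \<noteq> 0 \<Longrightarrow> v (c a) = 0"
    and v_normalised: "\<exists>g. g \<noteq> 0 \<and> v g = 1"

text \<open>\<open>vge v n\<close> is the fractional ideal of elements of valuation at least \<open>n\<close>; the valuation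
  of \<open>0\<close> counts as infinite, although \<open>v 0\<close> has the default value \<open>0\<close>.\<close>

definition vge :: "('l::field \<Rightarrow> int) \<Rightarrow> int \<Rightarrow> 'l set" where
  "vge v n = {g. g = 0 \<or> n \<le> v g}"

lemma zero_in_vge [simp]: "0 \<in> vge v n"
  by (simp add: vge_def)

lemma vge_mono: "g \<in> vge v n \<Longrightarrow> k \<le> n \<Longrightarrow> g \<in> vge v k"
  by (auto simp: vge_def)

context discrete_valuation
begin

lemma v_1 [simp]: "v 1 = 0"
  using v_mult[of 1 1] by simp

lemma v_minus_1: "v (- 1) = 0"
  using v_mult[of "- 1" "- 1"] by simp

lemma v_uminus [simp]: "v (- g) = v g"
  using v_mult[of "- 1" g] v_minus_1 by (cases "g = 0") simp_all

lemma v_inverse: "v (inverse g) = - v g"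
  using v_mult[of g "inverse g"] by (cases "g = 0") simp_all

lemma v_divide: "g \<noteq> 0 \<Longrightarrow> h \<noteq> 0 \<Longrightarrow> v (g / h) = v g - v h"
  by (simp add: divide_inverse v_mult v_inverse)

lemma v_power: "v (g ^ n) = int n * v g"
proof (cases "g = 0")
  case True
  then show ?thesis by (cases n) auto
next
  case False
  then show ?thesis by (induct n) (auto simp: v_mult algebra_simps)
qed

lemma v_power_int: "v (g powi n) = n * v g"
  by (simp add: power_int_def v_power v_inverse power_inverse)

lemma v_prod: "(\<And>i. i \<in> A \<Longrightarrow> g i \<noteq> 0) \<Longrightarrow> v (prod g A) = (\<Sum>i\<in>A. v (g i))"
  by (induct A rule: infinite_finite_induct) (auto simp: v_mult)

lemma vge_add: "g \<in> vge v n \<Longrightarrow> h \<in> vge v n \<Longrightarrow> g + h \<in> vge v n"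
  using v_add[of g h] by (fastforce simp: vge_def)

lemma vge_uminus_iff [simp]: "- g \<in> vge v n \<longleftrightarrow> g \<in> vge v n"
  by (simp add: vge_def)

lemma vge_diff: "g \<in> vge v n \<Longrightarrow> h \<in> vge v n \<Longrightarrow> g - h \<in> vge v n"
  using vge_add[of g n "- h"] by simp

lemma vge_mult: "g \<in> vge v n \<Longrightarrow> h \<in> vge v k \<Longrightarrow> g * h \<in> vge v (n + k)"
  by (cases "g = 0"; cases "h = 0") (auto simp: vge_def v_mult)

lemma vge_mult_left: "g \<in> vge v 0 \<Longrightarrow> h \<in> vge v k \<Longrightarrow> g * h \<in> vge v k"
  using vge_mult[of g 0 h k] by simp

lemma vge_mult_right: "g \<in> vge v k \<Longrightarrow> h \<in> vge v 0 \<Longrightarrow> g * h \<in> vge v k"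
  using vge_mult[of g k h 0] by simp

lemma vge_const: "c 0 = 0 \<Longrightarrow> c a \<in> vge v 0"
  by (cases "a = 0") (auto simp: vge_def v_const)

lemma one_in_vge [simp]: "1 \<in> vge v 0"
  by (simp add: vge_def)

lemma vge_1_mult_iff:
  assumes "g \<in> vge v 0" "h \<in> vge v 0"
  shows "g * h \<in> vge v 1 \<longleftrightarrow> g \<in> vge v 1 \<or> h \<in> vge v 1"
  using assms by (cases "g = 0"; cases "h = 0") (auto simp: vge_def v_mult)

lemma vge_1_add_iff: "h \<in> vge v 1 \<Longrightarrow> g + h \<in> vge v 1 \<longleftrightarrow> g \<in> vge v 1"
  using vge_add[of g 1 h] vge_diff[of "g + h" 1 h] by auto

lemma v_unit_iff: "g \<in> vge v 0 \<Longrightarrow> g \<notin> vge v 1 \<longleftrightarrow> g \<noteq> 0 \<and> v g = 0"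
  by (auto simp: vge_def)

lemma v_add_less:
  assumes "g \<noteq> 0" "h = 0 \<or> v g < v h"
  shows "g + h \<noteq> 0 \<and> v (g + h) = v g"
proof (cases "h = 0")
  case False
  with assms have lt: "v g < v h" by auto
  have nz: "g + h \<noteq> 0"
  proof
    assume "g + h = 0"
    then have "g = - h" by (simp add: eq_neg_iff_add_eq_0)
    with lt show False by simp
  qed
  have "v g \<le> v (g + h)"
    using v_add[of g h] nz assms False lt by auto
  moreover have "v (g + h) \<le> v g"
    using v_add[of "g + h" "- h"] nz assms False lt by auto
  ultimately show ?thesis using nz by simp
qed (use assms in auto)

lemma power_in_vge:
  assumes "x \<in> vge v 0" shows "x ^ n \<in> vge v 0"
  using assms by (induct n) (auto intro: vge_mult_left)

lemma ev_in_vge: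
  assumes "ring_morphism h" "x \<in> vge v 0" "\<And>a. h a \<in> vge v 0"
  shows "ev h x p \<in> vge v 0"
proof -
  interpret ring_morphism h by fact
  show ?thesis
    by (induct p) (auto intro!: vge_add vge_mult_left assms)
qed

end

lemma discrete_valuation_eqI:
  assumes v: "discrete_valuation c v" and w: "discrete_valuation c w"
    and scale: "\<And>g. g \<noteq> 0 \<Longrightarrow> w g = e * v g" and e: "0 \<le> e"
  shows "w = v"
proof -
  interpret v: discrete_valuation c v by fact
  interpret w: discrete_valuation c w by fact
  obtain g where "g \<noteq> 0" "w g = 1"
    using w.v_normalised by blast
  with scale e have "e = 1"
    by (metis int_one_le_iff_zero_less less_le mult_eq_0_iff pos_zmult_eq_1_iff zero_neq_one)
  with scale show ?thesis
    by (metis ext mult_1 v.v_0 w.v_0)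
qed

section \<open>Models of hyperelliptic function fields\<close>

text \<open>
  The field \<open>K(x, y)\<close>, for \<open>y\<^sup>2 = F(x)\<close> squarefree of odd degree, is taken to be a whole type \<open>'l\<close>; its
  generators are \<open>X\<close> and \<open>Y\<close>, and \<open>c\<close> embeds \<open>K\<close>. Any realisation may thus be chosen for a given
  curve, and valuations of \<open>'l\<close> can be studied with the arithmetic of the class of fields.
\<close>

locale hyperelliptic = ring_morphism c for c :: "'k::field \<Rightarrow> 'l::field" +
  fixes X Y :: 'l and F :: "'k poly"
  assumes two_nonzero: "(2::'k) \<noteq> 0"
    and X_transcendental: "ev c X p = 0 \<Longrightarrow> p = 0"
    and Y_square: "Y * Y = ev c X F"
    and odd_degree: "odd (degree F)"
    and squarefree: "q * q dvd F \<Longrightarrow> is_unit q"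
    and generated: "\<exists>u w d. d \<noteq> 0 \<and> g = (ev c X u + ev c X w * Y) / ev c X d"
begin

abbreviation e :: "'k poly \<Rightarrow> 'l" where "e \<equiv> ev c X"

sublocale e: injective_morphism e
  using X_transcendental ring_morphism_ev
  by (simp add: injective_morphism_def injective_morphism_axioms_def)

definition elt :: "'k poly \<Rightarrow> 'k poly \<Rightarrow> 'l" where
  "elt u w = e u + e w * Y"

definition nrm :: "'k poly \<Rightarrow> 'k poly \<Rightarrow> 'k poly" where
  "nrm u w = u * u - w * w * F"

lemma F_nonzero: "F \<noteq> 0"
  using odd_degree by auto

lemma Y_nonzero: "Y \<noteq> 0"
  using Y_square F_nonzero by auto

lemma elt_generated: obtains u w d where "d \<noteq> 0" "g = elt u w / e d"
  using generated[of g] unfolding elt_def by blast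

lemma elt_mult: "elt u w * elt u' w' = elt (u * u' + w * w' * F) (u * w' + w * u')"
  by (simp add: elt_def e.h_simps Y_square[symmetric] algebra_simps)

lemma elt_add: "elt u w + elt u' w' = elt (u + u') (w + w')"
  by (simp add: elt_def e.h_simps algebra_simps)

lemma e_elt: "e b * elt u w = elt (b * u) (b * w)"
  by (simp add: elt_def e.h_simps algebra_simps)

lemma elt_0_right [simp]: "elt u 0 = e u"
  by (simp add: elt_def)

lemma elt_0_left: "elt 0 w = e w * Y"
  by (simp add: elt_def)

lemma elt_conj: "elt u w * elt u (- w) = e (nrm u w)"
  by (simp add: elt_mult nrm_def)

lemma nrm_uminus [simp]: "nrm u (- w) = nrm u w"
  by (simp add: nrm_def)

lemma nrm_mult: "nrm (u * u' + w * w' * F) (u * w' + w * u') = nrm u w * nrm u' w'"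
  by (simp add: nrm_def algebra_simps)

lemma nrm_scale: "nrm (b * u) (b * w) = b * b * nrm u w"
  by (simp add: nrm_def algebra_simps)

text \<open>The two terms of the norm have degrees of different parity, so nothing cancels.\<close>

lemma degree_nrm_le_iff:
  "degree (nrm u w) \<le> n \<longleftrightarrow> 2 * degree u \<le> n \<and> (w \<noteq> 0 \<longrightarrow> 2 * degree w + degree F \<le> n)"
proof -
  have du: "degree (u * u) = 2 * degree u"
    by (cases "u = 0") (auto simp: degree_mult_eq)
  show ?thesis
  proof (cases "w = 0")
    case True
    then show ?thesis by (simp add: nrm_def du)
  next
    case False
    have dw: "degree (- (w * w * F)) = 2 * degree w + degree F"
      using False F_nonzero by (simp add: degree_mult_eq)
    have ne: "degree (u * u) \<noteq> degree (- (w * w * F))"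
      unfolding du dw using odd_degree by presburger
    have "degree (u * u + - (w * w * F)) = max (degree (u * u)) (degree (- (w * w * F)))"
      using ne by (metis degree_add_eq_left degree_add_eq_right linorder_neqE_nat max.strict_order_iff
          max.commute)
    then show ?thesis
      using False du dw by (simp add: nrm_def)
  qed
qed

lemma nrm_eq_0_iff [simp]: "nrm u w = 0 \<longleftrightarrow> u = 0 \<and> w = 0"
proof
  assume z: "nrm u w = 0"
  then have "degree (nrm u w) \<le> 0" by simp
  then have "w = 0"
    using odd_degree unfolding degree_nrm_le_iff by (metis add_eq_0_iff_both_eq_0 even_zero le_zero_eq)
  with z show "u = 0 \<and> w = 0" by (simp add: nrm_def)
qed (simp add: nrm_def)

lemma elt_eq_0_iff [simp]: "elt u w = 0 \<longleftrightarrow> u = 0 \<and> w = 0"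
proof
  assume "elt u w = 0"
  then have "e (nrm u w) = 0"
    unfolding elt_conj[symmetric] by simp
  then show "u = 0 \<and> w = 0" by simp
qed (simp add: elt_def)

lemma elt_eq_iff: "elt u w = elt u' w' \<longleftrightarrow> u = u' \<and> w = w'"
proof -
  have "elt u w = elt u' w' \<longleftrightarrow> elt (u - u') (w - w') = 0"
    by (simp add: elt_def e.h_simps algebra_simps del: elt_eq_0_iff)
  then show ?thesis by simp
qed

lemma elt_divide_eq_iff:
  assumes "d \<noteq> 0" "d' \<noteq> 0"
  shows "elt u w / e d = elt u' w' / e d' \<longleftrightarrow> d' * u = d * u' \<and> d' * w = d * w'"
proof -
  have "elt u w / e d = elt u' w' / e d' \<longleftrightarrow> e d' * elt u w = e d * elt u' w'"
    using assms by (simp add: frac_eq_eq mult.commute)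
  then show ?thesis by (simp add: e_elt elt_eq_iff)
qed

subsection \<open>The place at infinity\<close>

text \<open>
  At infinity \<open>x\<close> has a double pole. An element \<open>u + w Y\<close> and its conjugate have the same order
  there, so the order of either is minus the degree of the norm.
\<close>

definition v_inf :: "'l \<Rightarrow> int" where
  "v_inf g = (if g = 0 then 0 else
     (SOME n. \<exists>u w d. d \<noteq> 0 \<and> g = elt u w / e d \<and> n = 2 * int (degree d) - int (degree (nrm u w))))"

lemma v_inf_eq:
  assumes "d \<noteq> 0" "elt u w \<noteq> 0"
  shows "v_inf (elt u w / e d) = 2 * int (degree d) - int (degree (nrm u w))"
proof -
  let ?g = "elt u w / e d"
  have g: "?g \<noteq> 0" using assms by simp
  have unique: "n = 2 * int (degree d) - int (degree (nrm u w))"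
    if "d' \<noteq> 0" "?g = elt u' w' / e d'" "n = 2 * int (degree d') - int (degree (nrm u' w'))"
    for n u' w' d'
  proof -
    have "d' * u = d * u'" "d' * w = d * w'"
      using that assms by (simp_all add: elt_divide_eq_iff)
    then have "d' * d' * nrm u w = d * d * nrm u' w'"
      by (metis nrm_scale)
    moreover have "nrm u w \<noteq> 0" "nrm u' w' \<noteq> 0"
      using assms(2) g that(2) by auto
    ultimately have "2 * degree d' + degree (nrm u w) = 2 * degree d + degree (nrm u' w')"
      using assms that(1)
      by (metis degree_mult_eq mult_2 no_zero_divisors)
    with that(3) show ?thesis by simp
  qed
  have "(SOME n. \<exists>u w d. d \<noteq> 0 \<and> ?g = elt u w / e d \<and> n = 2 * int (degree d) - int (degree (nrm u w)))
      = 2 * int (degree d) - int (degree (nrm u w))"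
    by (rule some_equality) (use assms unique in blast)+
  with g show ?thesis unfolding v_inf_def by (simp only: if_False)
qed

lemma v_inf_e: "u \<noteq> 0 \<Longrightarrow> v_inf (e u) = - 2 * int (degree u)"
  using v_inf_eq[of 1 u 0] by (simp add: nrm_def degree_mult_eq)

lemma discrete_valuation_v_inf: "discrete_valuation c v_inf"
proof
  show "v_inf 0 = 0" by (simp add: v_inf_def)
next
  fix g h :: 'l assume gh: "g \<noteq> 0" "h \<noteq> 0"
  obtain u w d where g: "d \<noteq> 0" "g = elt u w / e d" by (rule elt_generated)
  obtain u' w' d' where h: "d' \<noteq> 0" "h = elt u' w' / e d'" by (rule elt_generated)
  have nz: "elt u w \<noteq> 0" "elt u' w' \<noteq> 0" using gh g h by auto
  define a b where "a = u * u' + w * w' * F" and "b = u * w' + w * u'"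
  have "g * h = elt a b / e (d * d')"
    using g h by (simp add: a_def b_def elt_mult[symmetric] e.h_simps)
  moreover have "elt a b \<noteq> 0"
    unfolding a_def b_def elt_mult[symmetric] using nz by simp
  moreover have "degree (nrm a b) = degree (nrm u w) + degree (nrm u' w')"
    unfolding a_def b_def nrm_mult using nz by (subst degree_mult_eq) auto
  ultimately show "v_inf (g * h) = v_inf g + v_inf h"
    using g h nz by (simp add: v_inf_eq degree_mult_eq del: elt_eq_0_iff)
  assume "g + h \<noteq> 0"
  define a b where "a = d' * u + d * u'" and "b = d' * w + d * w'"
  have gh': "g + h = elt a b / e (d * d')"
    using g h by (simp add: a_def b_def elt_add[symmetric] e_elt[symmetric] e.h_simps add_frac_eq algebra_simps)
  moreover have ab: "elt a b \<noteq> 0" using gh' \<open>g + h \<noteq> 0\<close> by auto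
  moreover
  define n where "n = max (2 * degree d' + degree (nrm u w)) (2 * degree d + degree (nrm u' w'))"
  have "degree (nrm (d' * u) (d' * w)) \<le> n" "degree (nrm (d * u') (d * w')) \<le> n"
    unfolding nrm_scale n_def using nz g h by (auto simp: degree_mult_eq)
  then have "degree (nrm a b) \<le> n"
    unfolding degree_nrm_le_iff a_def b_def
    by (smt (verit, ccfv_threshold) add.right_neutral add_0 add_le_cancel_right degree_add_le dual_order.trans
        mult_le_mono2 nat_le_linear nonzero_mult_div_cancel_left div_le_mono zero_neq_numeral
        degree_add_le_max max.bounded_iff max_def)
  ultimately show "min (v_inf g) (v_inf h) \<le> v_inf (g + h)"
    using g h nz by (auto simp: v_inf_eq degree_mult_eq n_def simp del: elt_eq_0_iff)
next
  fix a :: 'k assume "a \<noteq> 0"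
  then show "v_inf (c a) = 0"
    using v_inf_e[of "[:a:]"] by simp
next
  define k where "k = degree F div 2"
  have k: "degree F = 2 * k + 1" using odd_degree by (simp add: k_def)
  let ?w = "Polynomial.monom 1 k :: 'k poly"
  have w: "?w \<noteq> 0" "degree ?w = k" by (simp_all add: degree_monom_eq)
  have "degree (nrm 0 ?w) = 2 * k + degree F"
    using w F_nonzero by (simp add: nrm_def degree_mult_eq)
  then have "v_inf (elt 0 ?w / e F) = 1"
    using k w F_nonzero by (subst v_inf_eq) auto
  moreover have "elt 0 ?w / e F \<noteq> 0" using w F_nonzero by simp
  ultimately show "\<exists>g. g \<noteq> 0 \<and> v_inf g = 1" by blast
qed

lemma v_inf_X: "v_inf X < 0"
  using v_inf_e[of "[:0, 1:]"] by simp

text \<open>If \<open>X\<close> has a pole, then the valuations of \<open>u\<close> and \<open>w Y\<close> are governed by their degrees and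
  differ by parity.\<close>

lemma v_inf_unique:
  assumes "discrete_valuation c v" "v X < 0" shows "v = v_inf"
proof -
  interpret discrete_valuation c v by fact
  have X: "X \<noteq> 0" using assms(2) by auto
  have v_e: "v (e u) = int (degree u) * v X" if "u \<noteq> 0" for u
    using that
  proof (induct u)
    case (pCons a p)
    show ?case
    proof (cases "p = 0")
      case True
      with pCons show ?thesis by (simp add: v_const)
    next
      case False
      then have "v (X * e p) = v X + int (degree p) * v X"
        using pCons X by (simp add: v_mult)
      then have lt: "v (X * e p) < 0" "v (X * e p) = int (degree (pCons a p)) * v X"
        using assms(2) False by (auto simp: algebra_simps mult_nonpos_nonneg
            intro!: add_neg_nonpos)
      have "X * e p \<noteq> 0" using X False by simp
      moreover have "c a = 0 \<or> v (X * e p) < v (c a)"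
        using lt v_const[of a] by (cases "a = 0") auto
      ultimately have "v (X * e p + c a) = v (X * e p)"
        using v_add_less by blast
      then show ?thesis using lt by (simp add: add.commute)
    qed
  qed simp
  have vY: "2 * v Y = int (degree F) * v X"
    using v_e[OF F_nonzero] Y_square Y_nonzero v_mult[of Y Y] by simp
  have v_elt: "2 * v (elt u w) = int (degree (nrm u w)) * v X" if nz: "elt u w \<noteq> 0" for u w
  proof (cases "u = 0 \<or> w = 0")
    case True
    then show ?thesis
      using nz vY F_nonzero Y_nonzero
      by (auto simp: v_e nrm_def degree_mult_eq elt_0_left v_mult algebra_simps)
  next
    case False
    define a b where "a = 2 * degree u" and "b = 2 * degree w + degree F"
    have ab: "a \<noteq> b" unfolding a_def b_def using odd_degree by presburger
    have "degree (nrm u w) \<le> n \<longleftrightarrow> max a b \<le> n" for n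
      unfolding degree_nrm_le_iff a_def b_def using False by auto
    then have deg: "degree (nrm u w) = max a b"
      by (metis order_antisym order_refl)
    have 1: "2 * v (e u) = int a * v X" "2 * v (e w * Y) = int b * v X"
      using False vY Y_nonzero by (simp_all add: v_e a_def b_def v_mult algebra_simps)
    have nz: "e u \<noteq> 0" "e w * Y \<noteq> 0" using False Y_nonzero by auto
    show ?thesis
    proof (cases "a < b")
      case True
      then have "int b * v X < int a * v X"
        using assms(2) by (simp add: mult_less_cancel_right_disj)
      then have "v (e w * Y) < v (e u)" using 1 by linarith
      then have "v (e w * Y + e u) = v (e w * Y)"
        using v_add_less nz by blast
      then show ?thesis using 1 deg True by (simp add: elt_def add.commute)
    next
      case False
      with ab have "int a * v X < int b * v X"
        using assms(2) by (simp add: mult_less_cancel_right_disj)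
      then have "v (e u) < v (e w * Y)" using 1 by linarith
      then have "v (e u + e w * Y) = v (e u)"
        using v_add_less nz by blast
      then show ?thesis using 1 deg False by (simp add: elt_def add.commute)
    qed
  qed
  have "even (v X)"
    using vY odd_degree by (metis dvd_triv_left even_mult_iff even_of_nat)
  then obtain b where b: "v X = 2 * b" by (rule evenE)
  show ?thesis
  proof (rule discrete_valuation_eqI[OF discrete_valuation_v_inf assms(1)])
    fix g :: 'l assume g: "g \<noteq> 0"
    obtain u w d where d: "d \<noteq> 0" "g = elt u w / e d" by (rule elt_generated)
    with g have nz: "elt u w \<noteq> 0" by auto
    have "2 * v g = int (degree (nrm u w)) * v X - 2 * (int (degree d) * v X)"
      using d nz by (simp add: v_divide v_elt v_e right_diff_distrib del: elt_eq_0_iff)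
    also have "\<dots> = - v X * v_inf g"
      using d nz by (simp add: v_inf_eq algebra_simps del: elt_eq_0_iff)
    finally show "v g = (- b) * v_inf g"
      using b by simp
  qed (use assms(2) b in auto)
qed

subsection \<open>The hyperelliptic involution\<close>

definition cj :: "'l \<Rightarrow> 'l" where
  "cj g = (THE z. \<exists>u w d. d \<noteq> 0 \<and> g = elt u w / e d \<and> z = elt u (- w) / e d)"

lemma cj_eq: "d \<noteq> 0 \<Longrightarrow> cj (elt u w / e d) = elt u (- w) / e d"
  unfolding cj_def
  by (rule the_equality) (auto simp: elt_divide_eq_iff)

lemma cj_elt [simp]: "cj (elt u w) = elt u (- w)"
  using cj_eq[of 1 u w] by simp

lemma cj_e [simp]: "cj (e u) = e u"
  using cj_elt[of u 0] by simp

lemma cj_const [simp]: "cj (c a) = c a"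
  using cj_e[of "[:a:]"] by simp

lemma ring_morphism_cj: "ring_morphism cj"
proof
  show "cj 0 = 0" "cj 1 = 1" using cj_e[of 0] cj_e[of 1] by simp_all
next
  fix g h
  obtain u w d where g: "d \<noteq> 0" "g = elt u w / e d" by (rule elt_generated)
  obtain u' w' d' where h: "d' \<noteq> 0" "h = elt u' w' / e d'" by (rule elt_generated)
  have "g * h = elt (u * u' + w * w' * F) (u * w' + w * u') / e (d * d')"
    using g h by (simp add: elt_mult[symmetric] e.h_simps)
  then have "cj (g * h) = elt (u * u' + w * w' * F) (- (u * w' + w * u')) / e (d * d')"
    using g h cj_eq by simp
  also have "\<dots> = elt u (- w) / e d * (elt u' (- w') / e d')"
    by (simp add: elt_mult e.h_simps)
  finally show "cj (g * h) = cj g * cj h"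
    using g h cj_eq by simp
  have "g + h = elt (d' * u + d * u') (d' * w + d * w') / e (d * d')"
    using g h by (simp add: elt_add[symmetric] e_elt[symmetric] e.h_simps add_frac_eq algebra_simps)
  then have "cj (g + h) = elt (d' * u + d * u') (- (d' * w + d * w')) / e (d * d')"
    using g h cj_eq by simp
  also have "- (d' * w + d * w') = d' * (- w) + d * (- w')"
    by simp
  also have "elt (d' * u + d * u') (d' * (- w) + d * (- w')) / e (d * d')
      = elt u (- w) / e d + elt u' (- w') / e d'"
    using g h by (simp add: elt_add[symmetric] e_elt[symmetric] e.h_simps add_frac_eq algebra_simps
        del: mult_minus_right)
  finally show "cj (g + h) = cj g + cj h"
    using g h cj_eq by simp
qed

sublocale cj: ring_morphism cj by (rule ring_morphism_cj)

lemma cj_cj [simp]: "cj (cj g) = g"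
  by (metis cj_eq elt_generated minus_minus)

lemma cj_eq_0_iff [simp]: "cj g = 0 \<longleftrightarrow> g = 0"
  by (metis cj.h_0 cj_cj)

lemma cj_Y [simp]: "cj Y = - Y"
  using cj_elt[of 0 1] by (simp add: elt_def e.h_uminus)

lemma cj_X [simp]: "cj X = X"
  using cj_e[of "[:0, 1:]"] by simp

lemma v_inf_cj: "v_inf (cj g) = v_inf g"
proof (cases "g = 0")
  case False
  obtain u w d where g: "d \<noteq> 0" "g = elt u w / e d" by (rule elt_generated)
  with False have "elt u w \<noteq> 0" "elt u (- w) \<noteq> 0" by auto
  with g show ?thesis by (simp add: v_inf_eq cj_eq del: elt_eq_0_iff)
qed simp

lemma discrete_valuation_cj:
  assumes "discrete_valuation c v" shows "discrete_valuation c (\<lambda>g. v (cj g))"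
proof -
  interpret discrete_valuation c v by fact
  show ?thesis
  proof
    show "\<exists>g. g \<noteq> 0 \<and> v (cj g) = 1"
      using v_normalised by (metis cj_cj cj_eq_0_iff)
    show "min (v (cj g)) (v (cj h)) \<le> v (cj (g + h))" if "g \<noteq> 0" "h \<noteq> 0" "g + h \<noteq> 0" for g h
      using that v_add[of "cj g" "cj h"] by (metis cj.h_add cj_eq_0_iff)
  qed (auto simp: cj.h_mult v_mult v_const)
qed

lemma vge_cj: "g \<in> vge (\<lambda>g. v (cj g)) n \<longleftrightarrow> cj g \<in> vge v n"
  by (simp add: vge_def)

end

section \<open>Finite places\<close>

locale finite_place = hyperelliptic + discrete_valuation c v for v +
  assumes X_integral: "X \<in> vge v 0"
begin

lemma e_integral: "e b \<in> vge v 0"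
  by (rule ev_in_vge[OF ring_morphism_axioms X_integral]) (simp add: vge_const)

lemma Y_integral: "Y \<in> vge v 0"
  using e_integral[of F] Y_nonzero v_mult[of Y Y] by (auto simp: vge_def Y_square[symmetric])

lemma elt_integral: "elt u w \<in> vge v 0"
  by (simp add: elt_def vge_add vge_mult_left e_integral Y_integral)

text \<open>Otherwise \<open>v\<close> would be trivial on \<open>K(X)\<close>, hence, by taking norms, everywhere.\<close>

lemma exists_positive: "\<exists>b. b \<noteq> 0 \<and> e b \<in> vge v 1"
proof (rule ccontr)
  assume "\<not> ?thesis"
  then have 0: "v (e b) = 0" if "b \<noteq> 0" for b
    using that e_integral[of b] by (auto simp: vge_def)
  obtain g where g: "g \<noteq> 0" "v g = 1" using v_normalised by blast
  obtain u w d where d: "d \<noteq> 0" "g = elt u w / e d" by (rule elt_generated)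
  with g have nz: "elt u w \<noteq> 0" by auto
  then have "v (elt u w) + v (elt u (- w)) = 0"
    using v_mult[of "elt u w" "elt u (- w)"] 0[of "nrm u w"] by (auto simp: elt_conj)
  moreover have "0 \<le> v (elt u w)" "0 \<le> v (elt u (- w))"
    using elt_integral[of u w] elt_integral[of u "- w"] nz by (auto simp: vge_def)
  ultimately have "v (elt u w) = 0" by simp
  with g d nz 0[of d] show False by (simp add: v_divide)
qed

text \<open>A polynomial of least degree that vanishes at the place generates the ideal of all
  polynomials with this property.\<close>

definition q :: "'a poly" where
  "q = arg_min degree (\<lambda>b. b \<noteq> 0 \<and> e b \<in> vge v 1)"

lemma q: "q \<noteq> 0" "e q \<in> vge v 1"
  using arg_min_natI[of "\<lambda>b. b \<noteq> 0 \<and> e b \<in> vge v 1" _ degree] exists_positive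
  unfolding q_def by blast+

lemma q_minimal: "b \<noteq> 0 \<Longrightarrow> e b \<in> vge v 1 \<Longrightarrow> degree q \<le> degree b"
  unfolding q_def by (rule arg_min_nat_le) auto

lemma vge_1_iff_q_dvd: "e b \<in> vge v 1 \<longleftrightarrow> q dvd b"
proof
  assume "q dvd b"
  then show "e b \<in> vge v 1"
    using q e_integral by (auto simp: e.h_mult elim!: dvdE intro!: vge_mult_right)
next
  assume b: "e b \<in> vge v 1"
  have "e (b mod q) = e b - e (b div q) * e q"
    by (simp add: e.h_simps[symmetric] minus_div_mult_eq_mod)
  also have "\<dots> \<in> vge v 1"
    by (intro vge_diff vge_mult_left b q e_integral)
  finally have "b mod q = 0"
    using q_minimal degree_mod_less[OF q(1)] by (metis linorder_not_less)
  then show "q dvd b" by auto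
qed

lemma not_unit_q: "\<not> is_unit q"
  using vge_1_iff_q_dvd[of 1] by (auto simp: vge_def)

lemma degree_q: "0 < degree q"
  using not_unit_q q(1) by (metis is_unit_iff_degree neq0_conv)

lemma q_dvd_mult_iff: "q dvd a * b \<longleftrightarrow> q dvd a \<or> q dvd b"
  using vge_1_mult_iff[OF e_integral e_integral, of a b]
  by (simp add: vge_1_iff_q_dvd e.h_mult[symmetric])

lemma q_divisor:
  assumes "a dvd q" "\<not> is_unit a" shows "q dvd a"
proof -
  obtain b where b: "q = a * b" using assms by auto
  have "\<not> q dvd b"
  proof
    assume "q dvd b"
    then obtain k where "b = q * k" by auto
    with b have "q * 1 = q * (a * k)" by (simp add: ac_simps)
    then have "1 = a * k" using q(1) by (metis mult_left_cancel)
    with assms show False by (metis dvdI)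
  qed
  with b show ?thesis by (metis dvd_refl q_dvd_mult_iff)
qed

text \<open>
  Euclid's algorithm for \<open>q\<close> and \<open>b\<close> never meets a zero remainder before it reaches a constant, as
  every divisor of \<open>q\<close> of smaller degree is a unit.
\<close>

lemma inverse_mod_q:
  assumes "\<not> q dvd b" shows "\<exists>b'. q dvd b * b' - 1"
proof -
  have small: "\<exists>b'. q dvd b * b' - 1" if "b \<noteq> 0" "degree b < degree q" for b
    using that
  proof (induct "degree b" arbitrary: b rule: less_induct)
    case (less b)
    show ?case
    proof (cases "degree b = 0")
      case True
      then obtain a where a: "b = [:a:]" by (rule degree_eq_zeroE)
      with less.prems have "a \<noteq> 0" by auto
      then have "b * [:inverse a:] - 1 = 0" by (simp add: a one_pCons)
      then show ?thesis by (metis dvd_0_right)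
    next
      case False
      have "\<not> is_unit b" using False less.prems by (simp add: is_unit_iff_degree)
      then have "\<not> b dvd q"
        using q_divisor less.prems by (metis dvd_imp_degree_le linorder_not_less)
      then have "q mod b \<noteq> 0" by auto
      moreover from this have lt: "degree (q mod b) < degree b"
        using degree_mod_less[OF less.prems(1)] by blast
      ultimately obtain r' where r': "q dvd (q mod b) * r' - 1"
        using less.hyps less.prems by (meson less_trans)
      have "b * (- (q div b) * r') - 1 = (q mod b) * r' - 1 - q * r'"
        by (simp add: minus_div_mult_eq_mod[symmetric] algebra_simps)
      with r' show ?thesis by (metis dvd_diff dvd_triv_left)
    qed
  qed
  have "b mod q \<noteq> 0" using assms by auto
  moreover from this have "degree (b mod q) < degree q"
    using degree_mod_less[OF q(1)] by blast
  ultimately obtain b' where b': "q dvd (b mod q) * b' - 1" using small by blast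
  have "b * b' - 1 = ((b mod q) * b' - 1) + q * ((b div q) * b')"
    by (simp add: minus_div_mult_eq_mod[symmetric] algebra_simps)
  with b' show ?thesis by (metis dvd_add dvd_triv_left)
qed

subsection \<open>Units and a uniformiser generate the multiplicative group\<close>

definition unit_fractions :: "'b set" where
  "unit_fractions = {elt u w / elt u' w' | u w u' w'. elt u w \<notin> vge v 1 \<and> elt u' w' \<notin> vge v 1}"

lemma elt_unit_fraction: "elt u w \<notin> vge v 1 \<Longrightarrow> elt u w \<in> unit_fractions"
proof -
  assume "elt u w \<notin> vge v 1"
  moreover have "elt 1 0 \<notin> vge v 1" "elt u w = elt u w / elt 1 0" by (simp_all add: vge_def)
  ultimately show ?thesis unfolding unit_fractions_def by blast
qed

lemma unit_fractions_inverse: "g \<in> unit_fractions \<Longrightarrow> inverse g \<in> unit_fractions"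
  unfolding unit_fractions_def by (clarsimp simp del: elt_eq_0_iff) blast

lemma unit_fractions_mult:
  assumes "g \<in> unit_fractions" "h \<in> unit_fractions" shows "g * h \<in> unit_fractions"
proof -
  from assms(1) obtain u1 w1 u2 w2 where g: "elt u1 w1 \<notin> vge v 1" "elt u2 w2 \<notin> vge v 1"
    "g = elt u1 w1 / elt u2 w2" unfolding unit_fractions_def by blast
  from assms(2) obtain u3 w3 u4 w4 where h: "elt u3 w3 \<notin> vge v 1" "elt u4 w4 \<notin> vge v 1"
    "h = elt u3 w3 / elt u4 w4" unfolding unit_fractions_def by blast
  have "g * h = (elt u1 w1 * elt u3 w3) / (elt u2 w2 * elt u4 w4)"
    using g h by simp
  moreover have "elt u1 w1 * elt u3 w3 \<notin> vge v 1" "elt u2 w2 * elt u4 w4 \<notin> vge v 1"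
    using g h by (simp_all add: vge_1_mult_iff elt_integral)
  ultimately show ?thesis
    unfolding unit_fractions_def elt_mult by blast
qed

lemma unit_fractions_valuation: "g \<in> unit_fractions \<Longrightarrow> g \<noteq> 0 \<and> v g = 0"
  unfolding unit_fractions_def
  using v_unit_iff[OF elt_integral] by (auto simp: v_divide simp del: elt_eq_0_iff)

text \<open>
  For \<open>t\<close> vanishing at the place, this says that the local ring of the place is the localisation of
  the coordinate ring \<open>K[X] + K[X] Y\<close> at the ideal of functions vanishing there, and that \<open>t\<close>
  generates its maximal ideal.
\<close>

definition uniformises :: "'b \<Rightarrow> bool" where
  "uniformises t \<longleftrightarrow> t \<noteq> 0 \<and> (\<forall>g. g \<noteq> 0 \<longrightarrow> (\<exists>k b. b \<in> unit_fractions \<and> g = t powi k * b))"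

text \<open>
  Every function is a quotient of regular ones, and a regular function is a power of \<open>q\<close> times one
  whose two coordinates are not both divisible by \<open>q\<close>.
\<close>

lemma uniformisesI:
  assumes t: "t \<noteq> 0"
    and q_case: "\<exists>k b. b \<in> unit_fractions \<and> e q = t powi k * b"
    and primitive: "\<And>u w. \<not> (q dvd u \<and> q dvd w) \<Longrightarrow>
      \<exists>k b. b \<in> unit_fractions \<and> elt u w = t powi k * b"
  shows "uniformises t"
proof -
  let ?P = "\<lambda>g. \<exists>k b. b \<in> unit_fractions \<and> g = t powi k * b"
  have mult: "?P (g * h)" if gh: "?P g" "?P h" for g h
  proof -
    from gh obtain k b l b' where "b \<in> unit_fractions" "g = t powi k * b"
      "b' \<in> unit_fractions" "h = t powi l * b'" by blast
    then have "b * b' \<in> unit_fractions" "g * h = t powi (k + l) * (b * b')"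
      using t by (simp_all add: unit_fractions_mult power_int_add)
    then show ?thesis by blast
  qed
  have inv: "?P (inverse g)" if "?P g" for g
  proof -
    from that obtain k b where "b \<in> unit_fractions" "g = t powi k * b" by blast
    then have "inverse b \<in> unit_fractions" "inverse g = t powi (- k) * inverse b"
      by (simp_all add: unit_fractions_inverse power_int_minus)
    then show ?thesis by blast
  qed
  have elt: "?P (elt u w)" if "elt u w \<noteq> 0" for u w
    using that
  proof (induct "degree u + degree w" arbitrary: u w rule: less_induct)
    case (less u w)
    show ?case
    proof (cases "q dvd u \<and> q dvd w")
      case True
      then obtain u' w' where uw: "u = q * u'" "w = q * w'" by (auto elim!: dvdE)
      with less.prems have "u' \<noteq> 0 \<or> w' \<noteq> 0" by auto
      then have "degree u' + degree w' < degree u + degree w"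
        using uw q(1) degree_q by (cases "u' = 0"; cases "w' = 0") (auto simp: degree_mult_eq)
      then have "?P (elt u' w')"
        using less.hyps less.prems uw by auto
      then show ?thesis
        using mult[OF q_case] by (simp add: uw e_elt[symmetric])
    qed (use primitive in blast)
  qed
  have "?P g" if "g \<noteq> 0" for g
  proof -
    obtain u w d where g: "d \<noteq> 0" "g = elt u w / e d" by (rule elt_generated)
    have "?P (elt u w)" "?P (inverse (e d))"
      using g that elt[of u w] elt[of d 0] inv by auto
    then show ?thesis using mult g by (simp add: divide_inverse)
  qed
  with t show ?thesis by (simp add: uniformises_def)
qed

lemma uniformises_valuation:
  assumes "uniformises t" "t \<in> vge v 0" shows "v t = 1"
proof -
  obtain g where g: "g \<noteq> 0" "v g = 1" using v_normalised by blast
  with assms obtain k b where b: "b \<in> unit_fractions" "g = t powi k * b"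
    unfolding uniformises_def by blast
  then have "1 = k * v t"
    using g assms(1) unit_fractions_valuation[of b]
    by (simp add: v_mult v_power_int uniformises_def)
  moreover have "0 \<le> v t" using assms by (auto simp: vge_def uniformises_def)
  ultimately show ?thesis
    by (metis mult.commute pos_zmult_eq_1_iff zero_less_mult_iff zero_less_one less_le mult_zero_left)
qed

text \<open>
  The regular functions that are units at \<open>v\<close> are then units at \<open>v'\<close>, and both valuations are
  determined by the value at \<open>t\<close>.
\<close>

lemma place_unique:
  assumes t: "uniformises t" and v': "finite_place c X Y F v'"
    and le: "\<And>u w. elt u w \<in> vge v' 1 \<Longrightarrow> elt u w \<in> vge v 1"
    and t_int: "t \<in> vge v 0" "t \<in> vge v' 0"
  shows "v' = v"
proof -
  interpret v': finite_place c X Y F v' by fact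
  have unit: "v' b = 0" if b: "b \<in> unit_fractions" for b
  proof -
    from b obtain u w u' w' where uw: "elt u w \<notin> vge v 1" "elt u' w' \<notin> vge v 1" "b = elt u w / elt u' w'"
      unfolding unit_fractions_def by blast
    then have "elt u w \<notin> vge v' 1" "elt u' w' \<notin> vge v' 1" using le by auto
    then show ?thesis
      using uw(3) v'.v_unit_iff[OF v'.elt_integral] by (auto simp: v'.v_divide simp del: elt_eq_0_iff)
  qed
  show ?thesis
  proof (rule discrete_valuation_eqI[OF discrete_valuation_axioms v'.discrete_valuation_axioms])
    fix g :: 'b assume "g \<noteq> 0"
    with t obtain k b where b: "b \<in> unit_fractions" "g = t powi k * b"
      unfolding uniformises_def by blast
    have b0: "b \<noteq> 0" "v b = 0" using unit_fractions_valuation[OF b(1)] by auto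
    have "v t = 1" using uniformises_valuation t t_int by blast
    with b b0 t show "v' g = v' t * v g"
      by (simp add: uniformises_def v_mult v'.v_mult v_power_int v'.v_power_int unit)
  qed (use t t_int in \<open>auto simp: uniformises_def vge_def\<close>)
qed

text \<open>At both places, the ideal of vanishing polynomials is generated by the irreducible \<open>q\<close>.\<close>

lemma same_polynomial_ideal:
  assumes "finite_place c X Y F v'" "e q \<in> vge v' 1"
  shows "e b \<in> vge v' 1 \<longleftrightarrow> q dvd b"
proof -
  interpret v': finite_place c X Y F v' by fact
  have "v'.q dvd q" using assms(2) by (simp add: v'.vge_1_iff_q_dvd)
  moreover have "q dvd v'.q"
    using q_divisor calculation v'.not_unit_q by blast
  ultimately show ?thesis
    using v'.vge_1_iff_q_dvd by (meson dvd_trans)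
qed

end

section \<open>Residue degrees and conjugate places\<close>

definition lin :: "('k \<Rightarrow> 'l::comm_ring_1) \<Rightarrow> 'k list \<Rightarrow> 'l list \<Rightarrow> 'l" where
  "lin c cs bs = sum_list (map2 (\<lambda>a b. c a * b) cs bs)"

text \<open>
  The list \<open>bs\<close> represents a basis of the residue field over the constants.
\<close>

definition residue_degree_is :: "('k::field \<Rightarrow> 'l::field) \<Rightarrow> ('l \<Rightarrow> int) \<Rightarrow> nat \<Rightarrow> bool" where
  "residue_degree_is c v n \<longleftrightarrow> (\<exists>bs. length bs = n \<and> set bs \<subseteq> vge v 0 \<and>
     (\<forall>g\<in>vge v 0. \<exists>cs. length cs = n \<and> g - lin c cs bs \<in> vge v 1) \<and>
     (\<forall>cs. length cs = n \<longrightarrow> lin c cs bs \<in> vge v 1 \<longrightarrow> set cs \<subseteq> {0}))"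

lemma lin_append:
  "length cs = length bs \<Longrightarrow> lin c (cs @ cs') (bs @ bs') = lin c cs bs + lin c cs' bs'"
  by (simp add: lin_def)

lemma Poly_coeffs_upto:
  assumes "degree p < n" shows "Poly (map (poly.coeff p) [0..<n]) = p"
  using assms by (intro poly_eqI) (auto simp: nth_default_def coeff_eq_0)

context hyperelliptic
begin

lemma lin_powers:
  "length cs = n \<Longrightarrow> lin c cs (map (\<lambda>i. z * X ^ i) [0..<n]) = z * e (Poly cs)"
proof (induct cs arbitrary: n z)
  case (Cons a cs)
  then obtain k where k: "n = Suc k" "length cs = k" by auto
  have "map (\<lambda>i. z * X ^ i) [0..<Suc k] = z # map (\<lambda>i. z * X * X ^ i) [0..<k]"
    by (subst upt_conv_Cons) (simp_all add: map_Suc_upt[symmetric] algebra_simps del: upt_Suc)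
  with Cons(1)[OF k(2), of "z * X"] k show ?case
    by (simp add: lin_def algebra_simps del: upt_Suc)
qed (simp add: lin_def)

lemma degree_Poly_less: "length cs = n \<Longrightarrow> 0 < n \<Longrightarrow> degree (Poly cs) < n"
  using degree_Poly[of cs]
  by (metis Poly_eq_0 coeff_Poly_eq degree_0 leading_coeff_0_iff linorder_not_less nth_default_beyond)

lemma Poly_eq_0_set: "Poly cs = (0::'x::zero poly) \<Longrightarrow> set cs \<subseteq> {0}"
  by (metis Poly_eq_0 insert_iff set_replicate_conv_if singletonD subsetI empty_iff)

text \<open>
  A function \<open>(u + w Y) / d\<close> without pole at infinity is there congruent to a constant, the coefficient
  of \<open>u\<close> at the degree of \<open>d\<close> over the leading coefficient of \<open>d\<close>.
\<close>

lemma residue_degree_v_inf: "residue_degree_is c v_inf 1"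
proof -
  interpret discrete_valuation c v_inf by (rule discrete_valuation_v_inf)
  have "\<exists>cs. length cs = 1 \<and> g - lin c cs [1] \<in> vge v_inf 1" if g: "g \<in> vge v_inf 0" for g
  proof -
    obtain u w d where d: "d \<noteq> 0" "g = elt u w / e d" by (rule elt_generated)
    define a where "a = poly.coeff u (degree d) / lead_coeff d"
    have le: "degree (nrm u w) \<le> 2 * degree d"
      using g d by (cases "elt u w = 0") (auto simp: vge_def v_inf_eq simp del: elt_eq_0_iff,
          simp add: nrm_def)
    then have du: "degree u \<le> degree d" and dw: "w \<noteq> 0 \<Longrightarrow> 2 * degree w + degree F \<le> 2 * degree d"
      by (auto simp: degree_nrm_le_iff)
    have "elt (u - [:a:] * d) w = elt u w - c a * e d"
      by (simp add: elt_def e.h_simps ev_smult)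
    then have gc: "g - c a = elt (u - [:a:] * d) w / e d"
      using d by (simp add: diff_divide_distrib)
    have "g - c a \<in> vge v_inf 1"
    proof (cases "elt (u - [:a:] * d) w = 0")
      case True
      with gc show ?thesis by simp
    next
      case False
      have deg0: "0 < degree d" if "w \<noteq> 0" using dw[OF that] odd_degree
        by (cases "degree d") auto
      have c0: "poly.coeff (u - [:a:] * d) (degree d) = 0"
        using d by (simp add: a_def)
      have "degree (u - [:a:] * d) \<le> degree d"
        using du d by (intro degree_diff_le) auto
      then have lt: "degree (u - [:a:] * d) < degree d \<or> u - [:a:] * d = 0"
        using c0 by (metis le_neq_implies_less leading_coeff_0_iff)
      have "degree (nrm (u - [:a:] * d) w) < 2 * degree d"
      proof -
        have "1 \<le> degree d" 
          using lt deg0 False by fastforce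
        moreover have "w \<noteq> 0 \<Longrightarrow> 2 * degree w + degree F \<le> 2 * degree d - 1"
          using dw odd_degree by presburger
        ultimately have "degree (nrm (u - [:a:] * d) w) \<le> 2 * degree d - 1"
          using lt unfolding degree_nrm_le_iff by auto
        with \<open>1 \<le> degree d\<close> show ?thesis by linarith
      qed
      then show ?thesis
        using d False unfolding gc vge_def by (simp add: v_inf_eq del: elt_eq_0_iff)
    qed
    then show ?thesis by (intro exI[of _ "[a]"]) (simp add: lin_def)
  qed
  moreover have "set cs \<subseteq> {0}" if cs: "length cs = 1" "lin c cs [1] \<in> vge v_inf 1" for cs
  proof -
    obtain a where a: "cs = [a]" using cs(1) by (cases cs) auto
    have "v_inf (c a) = 0" using v_const[of a] by (cases "a = 0") auto
    then have "e [:a:] = 0" using cs a by (auto simp: vge_def lin_def)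
    then have "a = 0" unfolding e.h_eq_0_iff by simp
    with a show ?thesis by simp
  qed
  ultimately show ?thesis
    unfolding residue_degree_is_def by (intro exI[of _ "[1]"]) auto
qed

end

context finite_place
begin

lemma finite_place_cj: "finite_place c X Y F (\<lambda>g. v (cj g))"
proof -
  interpret cjv: discrete_valuation c "\<lambda>g. v (cj g)"
    by (rule discrete_valuation_cj) (rule discrete_valuation_axioms)
  show ?thesis
    by unfold_locales (simp add: vge_cj X_integral)
qed

lemma e_cj_iff: "e b \<in> vge (\<lambda>g. v (cj g)) n \<longleftrightarrow> e b \<in> vge v n"
  by (simp add: vge_cj)

lemma one_unit_fraction: "1 \<in> unit_fractions"
  using elt_unit_fraction[of 1 0] by (simp add: vge_def)

lemma e_factorization:
  assumes "b \<noteq> 0" shows "\<exists>k b'. b = q ^ k * b' \<and> \<not> q dvd b'"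
  using assms
proof (induct "degree b" arbitrary: b rule: less_induct)
  case (less b)
  show ?case
  proof (cases "q dvd b")
    case True
    then obtain b' where b': "b = q * b'" by auto
    with less.prems have "degree b' < degree b" "b' \<noteq> 0"
      using degree_q q(1) by (auto simp: degree_mult_eq)
    then obtain k b'' where "b' = q ^ k * b''" "\<not> q dvd b''" using less.hyps by blast
    then show ?thesis using b' by (intro exI[of _ "Suc k"] exI[of _ b'']) simp
  next
    case False
    then show ?thesis by (intro exI[of _ 0] exI[of _ b]) simp
  qed
qed

text \<open>
  A polynomial \<open>s\<close> congruent to \<open>Y\<close> at the place reduces every regular function to a polynomial in \<open>X\<close>.
  Such an \<open>s\<close> exists exactly when the residue field is \<open>K[X] / q\<close>.
\<close>

lemma elt_vge_iff_section:
  assumes "finite_place c X Y F v'" "e q \<in> vge v' 1" "Y - e s \<in> vge v' 1"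
  shows "elt u w \<in> vge v' 1 \<longleftrightarrow> q dvd u + w * s"
proof -
  interpret v': finite_place c X Y F v' by fact
  have "elt u w = e (u + w * s) + e w * (Y - e s)"
    by (simp add: elt_def e.h_simps algebra_simps)
  moreover have "e w * (Y - e s) \<in> vge v' 1"
    using assms(3) v'.e_integral by (rule v'.vge_mult_left[rotated])
  ultimately show ?thesis
    using same_polynomial_ideal[OF assms(1,2)] v'.vge_1_add_iff by simp
qed

lemma section_alternative:
  assumes "finite_place c X Y F v'" "e q \<in> vge v' 1" "q dvd F - s * s"
  shows "Y - e s \<in> vge v' 1 \<or> Y - e (- s) \<in> vge v' 1"
proof -
  interpret v': finite_place c X Y F v' by fact
  have "(Y - e s) * (Y - e (- s)) = e (F - s * s)"
    by (simp add: e.h_simps Y_square[symmetric] algebra_simps)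
  then have "(Y - e s) * (Y - e (- s)) \<in> vge v' 1"
    using same_polynomial_ideal[OF assms(1,2)] assms(3) by simp
  then show ?thesis
    using v'.vge_1_mult_iff v'.vge_diff v'.Y_integral v'.e_integral by metis
qed

lemma section_q_dvd:
  assumes "Y - e s \<in> vge v 1" shows "q dvd F - s * s"
proof -
  have "e (F - s * s) = (Y - e s) * (Y + e s)"
    by (simp add: e.h_simps Y_square[symmetric] algebra_simps)
  also have "\<dots> \<in> vge v 1"
    by (intro vge_mult_right assms vge_add Y_integral e_integral)
  finally show ?thesis by (simp add: vge_1_iff_q_dvd)
qed

lemma q_dvd_double: "q dvd b + b \<longleftrightarrow> q dvd b"
proof -
  have "b + b = Polynomial.smult 2 b"
    by (metis one_add_one smult_1_left smult_add_left)
  then show ?thesis using two_nonzero by (simp add: dvd_smult_iff)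
qed

text \<open>Split case: \<open>Y\<close> is congruent to \<open>s\<close> but not to \<open>- s\<close>, so of an element and its conjugate
  at least one is a unit unless \<open>q\<close> divides both.\<close>

lemma uniformises_split:
  assumes s: "Y - e s \<in> vge v 1" and "\<not> q dvd s"
  shows "uniformises (e q)"
proof (rule uniformisesI)
  show "e q \<noteq> 0" using q by simp
  show "\<exists>k b. b \<in> unit_fractions \<and> e q = e q powi k * b"
    by (intro exI[of _ 1] exI[of _ 1]) (simp add: one_unit_fraction)
  fix u w assume prim: "\<not> (q dvd u \<and> q dvd w)"
  note iff = elt_vge_iff_section[OF finite_place_axioms q(2) s]
  show "\<exists>k b. b \<in> unit_fractions \<and> elt u w = e q powi k * b"
  proof (cases "elt u w \<in> vge v 1")
    case False
    then show ?thesis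
      by (intro exI[of _ 0] exI[of _ "elt u w"]) (simp add: elt_unit_fraction)
  next
    case True
    have conj: "elt u (- w) \<notin> vge v 1"
    proof
      assume "elt u (- w) \<in> vge v 1"
      with True have 1: "q dvd u + w * s" "q dvd u - w * s" by (simp_all add: iff)
      then have "q dvd (u + w * s) + (u - w * s)" by (rule dvd_add)
      moreover have "(u + w * s) + (u - w * s) = u + u" by simp
      ultimately have "q dvd u" using q_dvd_double by metis
      with 1 have "q dvd w * s" by (simp add: dvd_add_right_iff)
      with assms prim \<open>q dvd u\<close> show False by (simp add: q_dvd_mult_iff)
    qed
    have "nrm u w \<noteq> 0" using prim by auto
    then obtain k b where kb: "nrm u w = q ^ k * b" "\<not> q dvd b" using e_factorization by blast
    have "elt b 0 \<notin> vge v 1" using kb by (simp add: vge_1_iff_q_dvd)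
    then have "elt b 0 / elt u (- w) \<in> unit_fractions"
      using conj unfolding unit_fractions_def by blast
    moreover have "elt u w = e q powi int k * (elt b 0 / elt u (- w))"
    proof -
      have "elt u (- w) \<noteq> 0" using conj by (metis zero_in_vge)
      moreover have "elt u w * elt u (- w) = e q ^ k * elt b 0"
        by (simp add: elt_conj kb e.h_simps)
      ultimately show ?thesis by (simp add: eq_divide_eq del: elt_eq_0_iff elt_0_right)
    qed
    ultimately show ?thesis by blast
  qed
qed

text \<open>Ramified case: as \<open>F\<close> is squarefree, \<open>q\<close> is \<open>Y\<^sup>2\<close> up to a unit.\<close>

lemma ramified_cofactor:
  assumes "Y \<in> vge v 1" obtains F' where "F = q * F'" "\<not> q dvd F'"
proof -
  have "e F \<in> vge v 1"
    unfolding Y_square[symmetric] using assms Y_integral by (rule vge_mult_right)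
  then obtain F' where F': "F = q * F'" by (auto simp: vge_1_iff_q_dvd)
  moreover have "\<not> q dvd F'"
  proof
    assume "q dvd F'"
    then have "q * q dvd F" using F' by auto
    with squarefree not_unit_q show False by blast
  qed
  ultimately show ?thesis by (rule that)
qed

lemma uniformises_ramified:
  assumes Y: "Y \<in> vge v 1"
  shows "uniformises Y"
proof (rule uniformisesI)
  obtain F' where F': "F = q * F'" "\<not> q dvd F'" using ramified_cofactor[OF Y] .
  have F'_unit: "elt F' 0 \<notin> vge v 1" using F' by (simp add: vge_1_iff_q_dvd)
  have F'0: "e F' \<noteq> 0" using F' by auto
  have s: "Y - e 0 \<in> vge v 1" using Y by simp
  note iff = elt_vge_iff_section[OF finite_place_axioms q(2) s]
  show "Y \<noteq> 0" by (rule Y_nonzero)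
  have "elt 1 0 / elt F' 0 \<in> unit_fractions"
    unfolding unit_fractions_def using F'_unit
    by (intro CollectI exI[of _ 1] exI[of _ 0] exI[of _ F']) (auto simp: vge_def)
  moreover have "e q = Y powi 2 * (elt 1 0 / elt F' 0)"
    using Y_square F'0 by (simp add: F' e.h_simps power2_eq_square)
  ultimately show "\<exists>k b. b \<in> unit_fractions \<and> e q = Y powi k * b" by blast
  fix u w assume prim: "\<not> (q dvd u \<and> q dvd w)"
  show "\<exists>k b. b \<in> unit_fractions \<and> elt u w = Y powi k * b"
  proof (cases "q dvd u")
    case False
    then show ?thesis
      by (intro exI[of _ 0] exI[of _ "elt u w"]) (simp add: elt_unit_fraction iff)
  next
    case True
    then obtain u' where u': "u = q * u'" by auto
    have "elt (w * F') u' \<notin> vge v 1"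
      using prim True F' by (simp add: iff q_dvd_mult_iff)
    then have "elt (w * F') u' / elt F' 0 \<in> unit_fractions"
      using F'_unit unfolding unit_fractions_def by blast
    moreover have "elt u w = Y powi 1 * (elt (w * F') u' / elt F' 0)"
    proof -
      \<comment> \<open>\<open>q\<close> divides \<open>u\<close>, so \<open>Y\<close> can be factored out after multiplication by the unit \<open>F'\<close>, as \<open>Y\<^sup>2 = q F'\<close>.\<close>
      have "elt u w * e F' = e u' * e F + e w * e F' * Y"
        by (simp add: elt_def u' F' e.h_simps algebra_simps)
      also have "\<dots> = Y * elt (w * F') u'"
        by (simp add: Y_square[symmetric] elt_def e.h_simps algebra_simps)
      finally show ?thesis using F'0 by (simp add: field_simps)
    qed
    ultimately show ?thesis by blast
  qed
qed

text \<open>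
  Inert case: if \<open>u + w Y\<close> vanished at the place with \<open>w\<close> invertible modulo \<open>q\<close>, then \<open>u / w\<close> would be
  a square root of \<open>F\<close> modulo \<open>q\<close>, so \<open>Y\<close> would be congruent to a polynomial.
\<close>

lemma elt_vge_iff_inert:
  assumes inert: "\<And>s. Y - e s \<notin> vge v 1" and v': "finite_place c X Y F v'" "e q \<in> vge v' 1"
  shows "elt u w \<in> vge v' 1 \<longleftrightarrow> q dvd u \<and> q dvd w"
proof
  interpret v': finite_place c X Y F v' by fact
  note iff = same_polynomial_ideal[OF v']
  show "elt u w \<in> vge v' 1" if "q dvd u \<and> q dvd w"
    unfolding elt_def using that v'.Y_integral
    by (intro v'.vge_add v'.vge_mult_right) (auto simp: iff)
  assume elt: "elt u w \<in> vge v' 1"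
  have w: "q dvd w"
  proof (rule ccontr)
    assume "\<not> q dvd w"
    then obtain w' where w': "q dvd w * w' - 1" using inverse_mod_q by blast
    have "e (nrm u w) \<in> vge v' 1"
      unfolding elt_conj[symmetric] using elt v'.elt_integral by (rule v'.vge_mult_right)
    then have n: "q dvd nrm u w" by (simp add: iff)
    \<comment> \<open>\<open>u w'\<close> is \<open>u / w\<close> modulo \<open>q\<close>.\<close>
    have "F - (u * w') * (u * w') = - (w' * w' * nrm u w) - (w * w' - 1) * ((w * w' + 1) * F)"
      by (simp add: nrm_def algebra_simps)
    also have "q dvd \<dots>"
      using n w' by (intro dvd_diff) auto
    finally show False
      using section_alternative[OF finite_place_axioms q(2)] inert by blast
  qed
  then have "e w * Y \<in> vge v' 1"
    using v'.Y_integral by (auto intro: v'.vge_mult_right simp: iff)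
  then have "e u \<in> vge v' 1" using elt v'.vge_1_add_iff by (simp add: elt_def)
  with w show "q dvd u \<and> q dvd w" by (simp add: iff)
qed

lemma uniformises_inert:
  assumes inert: "\<And>s. Y - e s \<notin> vge v 1"
  shows "uniformises (e q)"
proof (rule uniformisesI)
  show "e q \<noteq> 0" using q by simp
  show "\<exists>k b. b \<in> unit_fractions \<and> e q = e q powi k * b"
    by (intro exI[of _ 1] exI[of _ 1]) (simp add: one_unit_fraction)
  fix u w assume "\<not> (q dvd u \<and> q dvd w)"
  then show "\<exists>k b. b \<in> unit_fractions \<and> elt u w = e q powi k * b"
    using elt_vge_iff_inert[OF inert finite_place_axioms q(2)]
    by (intro exI[of _ 0] exI[of _ "elt u w"]) (simp add: elt_unit_fraction)
qed

subsection \<open>The residue field\<close>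

text \<open>
  The local ring is a localisation of the coordinate ring at a maximal ideal, so the residue field
  consists of residues of regular functions.
\<close>

lemma residue_by_elt:
  assumes t: "uniformises t" "t \<in> vge v 1"
    and inv: "\<And>u w. elt u w \<notin> vge v 1 \<Longrightarrow> \<exists>a b. elt u w * elt a b - 1 \<in> vge v 1"
    and g: "g \<in> vge v 0"
  shows "\<exists>u w. g - elt u w \<in> vge v 1"
proof (cases "g \<in> vge v 1")
  case True
  then show ?thesis by (intro exI[of _ 0]) simp
next
  case False
  then have g0: "g \<noteq> 0" "v g = 0" using v_unit_iff[OF g] by auto
  obtain k b where kb: "b \<in> unit_fractions" "g = t powi k * b"
    using t(1) g0 unfolding uniformises_def by blast
  have "v t = 1" using uniformises_valuation t vge_mono by fastforce
  then have "k = 0"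
    using g0 kb t(1) unit_fractions_valuation[OF kb(1)]
    by (simp add: v_mult v_power_int uniformises_def)
  with kb have "g \<in> unit_fractions" by simp
  then obtain u w u' w' where uw: "g = elt u w / elt u' w'" "elt u' w' \<notin> vge v 1"
    unfolding unit_fractions_def by blast
  then obtain a b where ab: "elt u' w' * elt a b - 1 \<in> vge v 1" using inv by blast
  have "elt u' w' \<noteq> 0" using uw(2) by (auto simp del: elt_eq_0_iff)
  then have "g - elt u w * elt a b = - (g * (elt u' w' * elt a b - 1))"
    by (simp add: uw(1) field_simps del: elt_eq_0_iff)
  also have "\<dots> \<in> vge v 1" using g ab by (simp add: vge_mult_left)
  finally show ?thesis unfolding elt_mult by blast
qed

lemma e_inverse_residue:
  assumes "e b \<notin> vge v 1" shows "\<exists>b'. e b * e b' - 1 \<in> vge v 1"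
proof -
  from assms obtain b' where "q dvd b * b' - 1"
    using inverse_mod_q vge_1_iff_q_dvd by blast
  then have "e (b * b' - 1) \<in> vge v 1" by (simp add: vge_1_iff_q_dvd)
  then show ?thesis by (auto simp: e.h_simps)
qed

text \<open>The powers \<open>1, X, X\<^sup>2, \<dots>\<close> below the degree of \<open>q\<close> form a basis of the residue field.\<close>

lemma residue_degree_section:
  assumes s: "Y - e s \<in> vge v 1" and t: "uniformises t" "t \<in> vge v 1"
  shows "residue_degree_is c v (degree q)"
proof -
  note iff = elt_vge_iff_section[OF finite_place_axioms q(2) s]
  have red: "elt u w - e (u + w * s) \<in> vge v 1" for u w
  proof -
    have "elt u w - e (u + w * s) = e w * (Y - e s)"
      by (simp add: elt_def e.h_simps algebra_simps)
    with s show ?thesis using e_integral vge_mult_left by simp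
  qed
  have inv: "\<exists>a b. elt u w * elt a b - 1 \<in> vge v 1" if "elt u w \<notin> vge v 1" for u w
  proof -
    let ?b = "u + w * s"
    from that obtain b' where b': "e ?b * e b' - 1 \<in> vge v 1"
      using e_inverse_residue[of ?b] by (auto simp: iff vge_1_iff_q_dvd)
    have "elt u w * elt b' 0 - 1 = (elt u w - e ?b) * e b' + (e ?b * e b' - 1)"
      by (simp add: algebra_simps)
    also have "\<dots> \<in> vge v 1" by (intro vge_add vge_mult_right red e_integral b')
    finally show ?thesis by blast
  qed
  let ?bs = "map (\<lambda>i. 1 * X ^ i) [0..<degree q]"
  show ?thesis
    unfolding residue_degree_is_def
  proof (intro exI[of _ ?bs] conjI ballI allI impI)
    show "set ?bs \<subseteq> vge v 0" using X_integral by (auto intro: power_in_vge)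
    fix g assume "g \<in> vge v 0"
    then obtain u w where uw: "g - elt u w \<in> vge v 1"
      using residue_by_elt[OF t inv] by blast
    define b where "b = (u + w * s) mod q"
    have "degree b < degree q"
      unfolding b_def using degree_mod_less[OF q(1)] degree_q by (metis degree_0)
    then have "lin c (map (poly.coeff b) [0..<degree q]) ?bs = e b"
      by (subst lin_powers) (simp_all add: Poly_coeffs_upto)
    moreover have "g - e b \<in> vge v 1"
    proof -
      have "g - e b = (g - elt u w) + (elt u w - e (u + w * s)) + e (u + w * s - b)"
        by (simp add: e.h_simps)
      moreover have "e (u + w * s - b) \<in> vge v 1"
        unfolding b_def vge_1_iff_q_dvd by (simp add: dvd_minus_mod)
      ultimately show ?thesis using uw red by (metis vge_add)
    qed
    ultimately show "\<exists>cs. length cs = degree q \<and> g - lin c cs ?bs \<in> vge v 1"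
      by (intro exI[of _ "map (poly.coeff b) [0..<degree q]"]) simp
  next
    fix cs :: "'a list" assume cs: "length cs = degree q" "lin c cs ?bs \<in> vge v 1"
    then have "q dvd Poly cs"
      by (simp only: lin_powers) (simp add: vge_1_iff_q_dvd)
    moreover have "degree (Poly cs) < degree q" using cs degree_q degree_Poly_less by blast
    ultimately have "Poly cs = 0" by (metis dvd_imp_degree_le linorder_not_less)
    then show "set cs \<subseteq> {0}" by (rule Poly_eq_0_set)
  qed simp
qed

text \<open>The powers of \<open>X\<close> below the degree of \<open>q\<close> and their products with \<open>Y\<close> form a basis.\<close>

lemma residue_degree_inert:
  assumes inert: "\<And>s. Y - e s \<notin> vge v 1"
  shows "residue_degree_is c v (2 * degree q)"
proof -
  note iff = elt_vge_iff_inert[OF inert finite_place_axioms q(2)]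
  have inv: "\<exists>a b. elt u w * elt a b - 1 \<in> vge v 1" if "elt u w \<notin> vge v 1" for u w
  proof -
    have "elt u (- w) \<notin> vge v 1" using that by (simp add: iff)
    then have "e (nrm u w) \<notin> vge v 1"
      using that unfolding elt_conj[symmetric] by (simp add: vge_1_mult_iff elt_integral)
    then obtain b' where b': "e (nrm u w) * e b' - 1 \<in> vge v 1"
      using e_inverse_residue by blast
    have "elt u w * elt (b' * u) (b' * - w) - 1 = e (nrm u w) * e b' - 1"
      unfolding e_elt[symmetric] elt_conj[symmetric] by (simp add: ac_simps)
    then have "elt u w * elt (b' * u) (b' * - w) - 1 \<in> vge v 1" using b' by simp
    then show ?thesis by blast
  qed
  have t: "uniformises (e q)" "e q \<in> vge v 1"
    using uniformises_inert[OF inert] q by auto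
  let ?n = "degree q"
  let ?b1 = "map (\<lambda>i. 1 * X ^ i) [0..<?n]" and ?b2 = "map (\<lambda>i. Y * X ^ i) [0..<?n]"
  have lin: "lin c (cs1 @ cs2) (?b1 @ ?b2) = elt (Poly cs1) (Poly cs2)"
    if "length cs1 = ?n" "length cs2 = ?n" for cs1 cs2
    using that by (subst lin_append) (simp_all only: lin_powers length_map length_upt, simp_all add: elt_def)
  show ?thesis
    unfolding residue_degree_is_def
  proof (intro exI[of _ "?b1 @ ?b2"] conjI ballI allI impI)
    show "set (?b1 @ ?b2) \<subseteq> vge v 0"
      using X_integral Y_integral by (auto intro!: power_in_vge vge_mult_left)
    fix g assume "g \<in> vge v 0"
    then obtain u w where uw: "g - elt u w \<in> vge v 1"
      using residue_by_elt[OF t inv] by blast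
    let ?cs = "\<lambda>b. map (poly.coeff (b mod q)) [0..<?n]"
    have deg: "degree (b mod q) < degree q" for b
      using degree_mod_less[OF q(1)] degree_q by (metis degree_0)
    have "g - elt (u mod q) (w mod q) = (g - elt u w) + elt (u - u mod q) (w - w mod q)"
      by (simp add: elt_def e.h_simps algebra_simps)
    also have "\<dots> \<in> vge v 1"
      using uw by (intro vge_add) (simp_all add: iff dvd_minus_mod)
    finally have "g - lin c (?cs u @ ?cs w) (?b1 @ ?b2) \<in> vge v 1"
      by (subst lin) (simp_all add: Poly_coeffs_upto deg)
    then show "\<exists>cs. length cs = 2 * ?n \<and> g - lin c cs (?b1 @ ?b2) \<in> vge v 1"
      by (intro exI[of _ "?cs u @ ?cs w"]) simp
  next
    fix cs :: "'a list" assume cs: "length cs = 2 * ?n" "lin c cs (?b1 @ ?b2) \<in> vge v 1"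
    define cs1 cs2 where "cs1 = take ?n cs" and "cs2 = drop ?n cs"
    have l: "length cs1 = ?n" "length cs2 = ?n" "cs = cs1 @ cs2"
      using cs(1) by (simp_all add: cs1_def cs2_def)
    then have "q dvd Poly cs1" "q dvd Poly cs2" using cs lin by (simp_all add: iff)
    moreover have "degree (Poly cs1) < ?n" "degree (Poly cs2) < ?n"
      using l degree_q degree_Poly_less by blast+
    ultimately have "Poly cs1 = 0" "Poly cs2 = 0" by (metis dvd_imp_degree_le linorder_not_less)+
    then show "set cs \<subseteq> {0}" using l Poly_eq_0_set by fastforce
  qed simp
qed

subsection \<open>A place plus its conjugate is the divisor of a polynomial\<close>

lemma section_place_unique:
  assumes s: "Y - e s \<in> vge v 1" and t: "uniformises t" "t \<in> vge v 0" "t \<in> vge v' 0"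
    and v': "finite_place c X Y F v'" "e q \<in> vge v' 1" "Y - e s \<in> vge v' 1"
  shows "v' = v"
  using elt_vge_iff_section[OF finite_place_axioms q(2) s] elt_vge_iff_section[OF v']
  by (intro place_unique[OF t(1) v'(1) _ t(2,3)]) simp

lemma section_cj: "Y - e s \<in> vge (\<lambda>g. v (cj g)) 1 \<longleftrightarrow> Y - e (- s) \<in> vge v 1"
proof -
  have "cj (Y - e s) = - (Y - e (- s))" by (simp add: cj.h_simps e.h_simps)
  then show ?thesis by (simp only: vge_cj vge_uminus_iff)
qed

text \<open>
  The function is the norm of the place: \<open>q\<^sup>2\<close> in the inert case, where the residue degree is twice
  the degree of \<open>q\<close> and the place is its own conjugate, and \<open>q\<close> otherwise, where the residue degree is
  the degree of \<open>q\<close>. In the split case \<open>q\<close> has a simple zero at each of two conjugate places; in the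
  ramified case it has a double zero at one.
\<close>

theorem conjugate_sum_principal:
  "\<exists>n h. residue_degree_is c v n \<and> h \<noteq> 0 \<and> v_inf h = - 2 * int n \<and>
     (\<forall>v'. finite_place c X Y F v' \<longrightarrow> v' h = of_bool (v' = v) + of_bool (v' = (\<lambda>g. v (cj g))))"
proof (cases "\<exists>s. Y - e s \<in> vge v 1")
  case False
  then have inert: "Y - e s \<notin> vge v 1" for s by blast
  note t = uniformises_inert[OF inert]
  have eq: "v' = v" if v': "finite_place c X Y F v'" "e q \<in> vge v' 1" for v'
    using that elt_vge_iff_inert[OF inert v'] elt_vge_iff_inert[OF inert finite_place_axioms q(2)] q
    by (intro place_unique[OF t]) (auto intro: vge_mono)
  have cj: "(\<lambda>g. v (cj g)) = v" using eq finite_place_cj q by (simp add: e_cj_iff)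
  have vq: "v (e q) = 1" using uniformises_valuation[OF t] e_integral by blast
  have "v' (e q ^ 2) = of_bool (v' = v) + of_bool (v' = (\<lambda>g. v (cj g)))"
    if v': "finite_place c X Y F v'" for v'
  proof -
    interpret v': finite_place c X Y F v' by fact
    show ?thesis
    proof (cases "v' = v")
      case True
      then show ?thesis using vq by (simp add: v_power cj)
    next
      case False
      then have "e q \<notin> vge v' 1" using eq v' by blast
      then have "v' (e q) = 0" using v'.v_unit_iff[OF v'.e_integral] by blast
      with False show ?thesis by (simp add: v'.v_power cj)
    qed
  qed
  moreover have "v_inf (e q ^ 2) = - 2 * int (2 * degree q)"
  proof -
    have "v_inf (e q ^ 2) = v_inf (e (q ^ 2))" by (simp add: e.h_power)
    then show ?thesis using q by (simp add: v_inf_e degree_power_eq)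
  qed
  moreover have "e q ^ 2 \<noteq> 0" using q by simp
  ultimately show ?thesis using residue_degree_inert[OF inert] by blast
next
  case True
  then obtain s where s: "Y - e s \<in> vge v 1" by blast
  let ?cv = "\<lambda>g. v (cj g)"
  interpret cv: finite_place c X Y F ?cv by (rule finite_place_cj)
  have q_cv: "e q \<in> vge ?cv 1" using q by (simp add: e_cj_iff)
  have inf: "v_inf (e q) = - 2 * int (degree q)" using q by (simp add: v_inf_e)
  show ?thesis
  proof (cases "q dvd s")
    case False
    note t = uniformises_split[OF s False]
    have vq: "v (e q) = 1" using uniformises_valuation[OF t] e_integral by blast
    have scv: "Y - e (- s) \<in> vge ?cv 1" using s by (simp add: section_cj)
    have ne: "?cv \<noteq> v"
    proof
      assume "?cv = v"
      with scv s have "(Y - e (- s)) - (Y - e s) \<in> vge v 1" by (metis vge_diff)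
      moreover have "(Y - e (- s)) - (Y - e s) = e (s + s)"
        by (simp only: e.h_add e.h_uminus) simp
      ultimately have "q dvd s + s" by (simp only: vge_1_iff_q_dvd)
      with False show False by (simp only: q_dvd_double)
    qed
    have eq: "v' = v \<or> v' = ?cv" if v': "finite_place c X Y F v'" "e q \<in> vge v' 1" for v'
    proof -
      interpret v': finite_place c X Y F v' by fact
      consider "Y - e s \<in> vge v' 1" | "Y - e (- s) \<in> vge v' 1"
        using section_alternative[OF v' section_q_dvd[OF s]] by blast
      then show ?thesis
      proof cases
        case 1
        then show ?thesis
          using section_place_unique[OF s t e_integral v'.e_integral v'] by blast
      next
        case 2
        have "v' (cj g) = v g" for g
        proof -
          have "Y - e s \<in> vge (\<lambda>g. v' (cj g)) 1" using 2 by (simp add: v'.section_cj)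
          then have "(\<lambda>g. v' (cj g)) = v"
            using section_place_unique[OF s t e_integral _ v'.finite_place_cj] v'(2) v'.e_integral
            by (simp add: v'.e_cj_iff)
          then show ?thesis by metis
        qed
        then show ?thesis by (metis cj_cj ext)
      qed
    qed
    have "v' (e q) = of_bool (v' = v) + of_bool (v' = ?cv)" if v': "finite_place c X Y F v'" for v'
    proof -
      interpret v': finite_place c X Y F v' by fact
      show ?thesis
      proof (cases "e q \<in> vge v' 1")
        case True
        then have "v' = v \<or> v' = ?cv" using eq v' by blast
        then show ?thesis using vq ne by auto
      next
        case False
        then have "v' (e q) = 0" using v'.v_unit_iff[OF v'.e_integral] by blast
        moreover have "v' \<noteq> v" "v' \<noteq> ?cv" using False q q_cv by blast+
        ultimately show ?thesis by simp
      qed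
    qed
    with inf q show ?thesis using residue_degree_section[OF s t q(2)] e.h_eq_0_iff by blast
  next
    case True
    have "Y = (Y - e s) + e s" by simp
    also have "\<dots> \<in> vge v 1" using s True by (intro vge_add) (simp_all add: vge_1_iff_q_dvd)
    finally have Y1: "Y \<in> vge v 1" .
    note t = uniformises_ramified[OF Y1]
    have s0: "Y - e 0 \<in> vge v 1" using Y1 by simp
    have vY: "v Y = 1" using uniformises_valuation[OF t Y_integral] .
    obtain F' where F': "F = q * F'" "\<not> q dvd F'" using ramified_cofactor[OF Y1] .
    then have "v (e F') = 0" using v_unit_iff[OF e_integral, of F'] by (simp add: vge_1_iff_q_dvd)
    moreover have "v (e F) = 2" using vY Y_nonzero by (simp add: Y_square[symmetric] v_mult)
    moreover have "e q \<noteq> 0" "e F' \<noteq> 0" using F' q by auto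
    ultimately have vq: "v (e q) = 2" by (simp add: F' e.h_mult v_mult del: e.h_eq_0_iff)
    have eq: "v' = v" if v': "finite_place c X Y F v'" "e q \<in> vge v' 1" for v'
    proof -
      interpret v': finite_place c X Y F v' by fact
      have "Y - e 0 \<in> vge v' 1"
        using section_alternative[OF v' section_q_dvd[OF s0]] by simp
      then show ?thesis
        using section_place_unique[OF s0 t Y_integral v'.Y_integral v'] by blast
    qed
    have cj: "?cv = v" using eq finite_place_cj q_cv by blast
    have "v' (e q) = of_bool (v' = v) + of_bool (v' = ?cv)" if v': "finite_place c X Y F v'" for v'
    proof -
      interpret v': finite_place c X Y F v' by fact
      show ?thesis
      proof (cases "v' = v")
        case True
        then show ?thesis using vq by (simp add: cj)
      next
        case False
        then have "e q \<notin> vge v' 1" using eq v' by blast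
        then have "v' (e q) = 0" using v'.v_unit_iff[OF v'.e_integral] by blast
        with False show ?thesis by (simp add: cj)
      qed
    qed
    with inf q show ?thesis using residue_degree_section[OF s t Y1] e.h_eq_0_iff by blast
  qed
qed

end

section \<open>The abstract function field and its places\<close>

context hyperelliptic
begin

interpretation fl: injective_morphism "fract_lift e"
  by (rule e.injective_morphism_fract_lift)

text \<open>The isomorphism from the field of pairs \<open>(u, w)\<close>, standing for \<open>u + w y\<close>, onto the model.\<close>

definition iota :: "'k poly fract \<times> 'k poly fract \<Rightarrow> 'l" where
  "iota z = fract_lift e (fst z) + fract_lift e (snd z) * Y"

abbreviation "L \<equiv> function_field F"

lemma iota_zero [simp]: "iota \<zero>\<^bsub>L\<^esub> = 0"
  by (simp add: iota_def function_field_def)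

lemma iota_one [simp]: "iota \<one>\<^bsub>L\<^esub> = 1"
  by (simp add: iota_def function_field_def)

lemma iota_add [simp]: "iota (g \<oplus>\<^bsub>L\<^esub> h) = iota g + iota h"
  by (cases g; cases h) (simp add: iota_def function_field_def fl.h_simps algebra_simps)

lemma iota_mult [simp]: "iota (g \<otimes>\<^bsub>L\<^esub> h) = iota g * iota h"
proof (cases g; cases h)
  fix u w u' w' assume "g = (u, w)" "h = (u', w')"
  moreover have "fract_lift e (to_fract F) = Y * Y" by (simp add: Y_square)
  ultimately show ?thesis
    by (simp add: iota_def function_field_def fl.h_simps algebra_simps)
qed

lemma iota_of_x [simp]: "iota (of_x p) = e p"
  by (simp add: iota_def of_x_def)

lemma iota_y_minus: "iota (y_minus a) = Y - e [:a:]"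
  by (simp add: iota_def y_minus_def fl.h_uminus)

lemma iota_fractions:
  "iota (to_fract u / to_fract d, to_fract w / to_fract d') = e u / e d + e w / e d' * Y"
  by (simp add: iota_def e.fract_lift_divide)

lemma iota_inj [simp]: "iota g = iota h \<longleftrightarrow> g = h"
proof -
  have zero: "a = 0 \<and> b = 0" if ab: "fract_lift e a + fract_lift e b * Y = 0" for a b
  proof -
    obtain u d w d' where frac: "a = to_fract u / to_fract d" "d \<noteq> 0" "b = to_fract w / to_fract d'" "d' \<noteq> 0"
      by (metis Fract_cases Fract_conv_to_fract)
    then have "e u / e d + e w / e d' * Y = 0" using ab by (simp add: e.fract_lift_divide)
    then have "e d' * e u + e d * e w * Y = 0"
      using frac by (simp add: field_simps)
    then have "elt (d' * u) (d * w) = 0" by (simp add: elt_def e.h_simps)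
    with frac show ?thesis by simp
  qed
  show ?thesis
  proof
    assume "iota g = iota h"
    then have "fract_lift e (fst g - fst h) + fract_lift e (snd g - snd h) * Y = 0"
      by (simp add: iota_def fl.h_simps algebra_simps)
    from zero[OF this] show "g = h" by (simp add: prod_eq_iff)
  qed simp
qed

lemma iota_eq_0_iff [simp]: "iota g = 0 \<longleftrightarrow> g = \<zero>\<^bsub>L\<^esub>"
  using iota_inj[of g "\<zero>\<^bsub>L\<^esub>"] by (simp del: iota_inj)

lemma bij_iota: "bij iota"
proof (rule bijI)
  show "inj iota" by (auto intro: injI)
  have "g \<in> range iota" for g
  proof -
    obtain u w d where "d \<noteq> 0" "g = elt u w / e d" by (rule elt_generated)
    then have "g = iota (to_fract u / to_fract d, to_fract w / to_fract d)"
      by (simp add: iota_fractions elt_def add_divide_distrib)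
    then show ?thesis by blast
  qed
  then show "surj iota" by blast
qed

definition iota_inv :: "'l \<Rightarrow> 'k poly fract \<times> 'k poly fract" where
  "iota_inv = inv_into UNIV iota"

lemma iota_iota_inv [simp]: "iota (iota_inv g) = g"
  unfolding iota_inv_def using bij_iota by (simp add: bij_is_surj surj_f_inv_f)

lemma iota_inv_iota [simp]: "iota_inv (iota g) = g"
  unfolding iota_inv_def using bij_iota by (simp add: bij_is_inj)

lemma ex_iota: "(\<exists>g. P g) \<longleftrightarrow> (\<exists>z. P (iota z))"
  by (metis iota_iota_inv)

lemma place_iff: "v \<circ> iota \<in> places F \<longleftrightarrow> discrete_valuation c v"
proof -
  have all: "(\<forall>g h. P g h) \<longleftrightarrow> (\<forall>y z. P (iota y) (iota z))" for P :: "'l \<Rightarrow> 'l \<Rightarrow> bool"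
    by (metis iota_iota_inv)
  have conv: "discrete_valuation c v \<longleftrightarrow> v 0 = 0 \<and>
     (\<forall>g h. g \<noteq> 0 \<longrightarrow> h \<noteq> 0 \<longrightarrow> v (g * h) = v g + v h) \<and>
     (\<forall>g h. g \<noteq> 0 \<longrightarrow> h \<noteq> 0 \<longrightarrow> g + h \<noteq> 0 \<longrightarrow> min (v g) (v h) \<le> v (g + h)) \<and>
     (\<forall>a. a \<noteq> 0 \<longrightarrow> v (c a) = 0) \<and> (\<exists>g. g \<noteq> 0 \<and> v g = 1)"
    unfolding discrete_valuation_def by blast
  have nz: "iota y + iota z \<noteq> 0 \<longleftrightarrow> y \<oplus>\<^bsub>L\<^esub> z \<noteq> \<zero>\<^bsub>L\<^esub>" for y z
    by (metis iota_add iota_eq_0_iff)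
  show ?thesis
    unfolding conv places_def Let_def mem_Collect_eq
    by (subst (1 2) all, subst ex_iota) (simp add: nz)
qed

lemma places_eq: "places F = (\<lambda>v. v \<circ> iota) ` {v. discrete_valuation c v}"
proof (intro equalityI subsetI)
  fix w assume w: "w \<in> places F"
  have eq: "(w \<circ> iota_inv) \<circ> iota = w" by (auto simp: fun_eq_iff)
  then have "discrete_valuation c (w \<circ> iota_inv)" using w place_iff by metis
  with eq show "w \<in> (\<lambda>v. v \<circ> iota) ` {v. discrete_valuation c v}"
    by (metis (mono_tags, lifting) image_eqI mem_Collect_eq)
qed (use place_iff in auto)

lemma comp_iota_inj [simp]: "v \<circ> iota = w \<circ> iota \<longleftrightarrow> v = w"
  by (metis bij_iota bij_is_surj surj_fun_eq)

lemma finite_or_inf: "discrete_valuation c v \<longleftrightarrow> v = v_inf \<or> finite_place c X Y F v"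
proof
  assume v: "discrete_valuation c v"
  show "v = v_inf \<or> finite_place c X Y F v"
  proof (cases "X \<in> vge v 0")
    case True
    then show ?thesis
      using v hyperelliptic_axioms by (simp add: finite_place_def finite_place_axioms_def)
  next
    case False
    then have "v X < 0" by (auto simp: vge_def)
    then show ?thesis using v_inf_unique[OF v] by blast
  qed
qed (auto simp: discrete_valuation_v_inf finite_place_def)

lemma v_inf_not_finite: "\<not> finite_place c X Y F v_inf"
proof
  assume "finite_place c X Y F v_inf"
  then interpret finite_place c X Y F v_inf .
  have "X \<noteq> 0" using v_inf_X v_0 by (metis less_irrefl)
  then show False using X_integral v_inf_X by (simp add: vge_def)
qed

lemma place_infinity_eq: "place_infinity F = v_inf \<circ> iota"
  unfolding place_infinity_def
proof (rule the_equality)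
  show "v_inf \<circ> iota \<in> places F \<and> (v_inf \<circ> iota) (of_x [:0, 1:]) < 0"
    using discrete_valuation_v_inf v_inf_X by (simp add: place_iff)
  fix w assume w: "w \<in> places F \<and> w (of_x [:0, 1:]) < 0"
  then obtain v where v: "discrete_valuation c v" "w = v \<circ> iota" unfolding places_eq by blast
  with w show "w = v_inf \<circ> iota" using v_inf_unique by simp
qed

subsection \<open>Residue fields\<close>

text \<open>
  The residue classes of \<open>bs\<close> form a basis in the quotient ring. To see this, cosets are written as
  sets of elements that differ from a given one by an element of positive valuation.
\<close>

lemma place_degree_eq:
  assumes v: "discrete_valuation c v" and deg: "residue_degree_is c v n"
  shows "place_degree F (v \<circ> iota) = n"
proof -
  interpret v: discrete_valuation c v by fact
  define R where "R = local_ring F (v \<circ> iota)"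
  define I where "I = local_ideal F (v \<circ> iota)"
  have carR: "carrier R = {z. iota z \<in> vge v 0}"
    by (auto simp: R_def local_ring_def vge_def)
  have I: "I = {z. iota z \<in> vge v 1}"
    by (auto simp: I_def local_ideal_def vge_def)
  have opR: "iota (a \<oplus>\<^bsub>R\<^esub> b) = iota a + iota b" "iota (a \<otimes>\<^bsub>R\<^esub> b) = iota a * iota b"
    "iota \<zero>\<^bsub>R\<^esub> = 0" "iota \<one>\<^bsub>R\<^esub> = 1" for a b
    by (simp_all add: R_def local_ring_def)
  have eqR: "a = b \<longleftrightarrow> iota a = iota b" for a b by simp
  have "cring R"
  proof (rule cringI)
    show "abelian_group R"
    proof (rule abelian_groupI)
      show "\<exists>y\<in>carrier R. y \<oplus>\<^bsub>R\<^esub> x = \<zero>\<^bsub>R\<^esub>" if "x \<in> carrier R" for x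
        using that by (intro bexI[of _ "iota_inv (- iota x)"])
          (simp_all add: carR eqR opR del: iota_inj)
    qed (auto simp: carR eqR opR v.vge_add algebra_simps simp del: iota_inj)
    show "Group.comm_monoid R"
      by (rule comm_monoidI)
         (auto simp: carR eqR opR v.vge_mult_left algebra_simps simp del: iota_inj)
  qed (auto simp: eqR opR algebra_simps simp del: iota_inj)
  then interpret R: cring R .
  have minus: "iota (\<ominus>\<^bsub>R\<^esub> a) = - iota a" if "a \<in> carrier R" for a
  proof -
    have "iota (a \<oplus>\<^bsub>R\<^esub> \<ominus>\<^bsub>R\<^esub> a) = 0" using R.r_neg[OF that] by (simp only: opR)
    then show ?thesis by (simp add: opR eq_neg_iff_add_eq_0 add.commute)
  qed
  have "ideal I R"
  proof (rule idealI)
    show "subgroup I (add_monoid R)"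
    proof (rule group.subgroupI)
      show "group (add_monoid R)" by (rule R.a_group)
      show "I \<subseteq> carrier (add_monoid R)" by (auto simp: I carR intro: vge_mono)
      show "I \<noteq> {}" using opR(3) unfolding I by (metis (mono_tags) empty_iff mem_Collect_eq zero_in_vge)
      show "inv\<^bsub>add_monoid R\<^esub> a \<in> I" if "a \<in> I" for a
        using that minus[of a] vge_mono[of "iota a" v 1 0] by (simp add: I carR a_inv_def)
    qed (simp add: I opR v.vge_add)
  qed (auto simp: I carR opR R.ring_axioms intro: v.vge_mult_left v.vge_mult_right)
  then interpret I: ideal I R .
  define Q where "Q = R Quot I"
  define pr where "pr g = I +>\<^bsub>R\<^esub> iota_inv g" for g
  have pr: "pr g = {z. iota z - g \<in> vge v 1}" for g
  proof (intro equalityI subsetI)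
    fix z assume "z \<in> pr g"
    then obtain h where "h \<in> I" "z = h \<oplus>\<^bsub>R\<^esub> iota_inv g"
      unfolding pr_def a_r_coset_def' by blast
    then show "z \<in> {z. iota z - g \<in> vge v 1}" by (simp add: I opR)
  next
    fix z assume "z \<in> {z. iota z - g \<in> vge v 1}"
    then have "iota_inv (iota z - g) \<in> I" "z = iota_inv (iota z - g) \<oplus>\<^bsub>R\<^esub> iota_inv g"
      by (simp_all add: I eqR opR del: iota_inj)
    then show "z \<in> pr g" unfolding pr_def a_r_coset_def' by blast
  qed
  have pr_eq: "pr g = pr h \<longleftrightarrow> g - h \<in> vge v 1" for g h
  proof
    assume "pr g = pr h"
    moreover have "iota_inv g \<in> pr g" by (simp add: pr)
    ultimately show "g - h \<in> vge v 1" by (auto simp: pr)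
  next
    assume gh: "g - h \<in> vge v 1"
    have "iota z - g \<in> vge v 1 \<longleftrightarrow> iota z - h \<in> vge v 1" for z
      using v.vge_1_add_iff[OF gh, of "iota z - g"] by simp
    then show "pr g = pr h" by (simp add: pr)
  qed
  have inv_carrier: "iota_inv g \<in> carrier R \<longleftrightarrow> g \<in> vge v 0" for g by (simp add: carR)
  interpret Q: ring Q unfolding Q_def by (rule I.quotient_is_ring)
  have carQ: "carrier Q = pr ` vge v 0"
  proof -
    have "carrier Q = (\<lambda>z. I +>\<^bsub>R\<^esub> z) ` carrier R"
      by (auto simp: Q_def FactRing_def A_RCOSETS_def')
    also have "\<dots> = (\<lambda>z. pr (iota z)) ` {z. iota z \<in> vge v 0}"
      by (simp add: pr_def carR)
    also have "\<dots> = pr ` (iota ` {z. iota z \<in> vge v 0})"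
      by (simp add: image_image)
    also have "iota ` {z. iota z \<in> vge v 0} = vge v 0"
    proof (intro equalityI subsetI)
      fix x assume "x \<in> vge v 0"
      then have "iota (iota_inv x) \<in> iota ` {z. iota z \<in> vge v 0}" by (intro imageI) simp
      then show "x \<in> iota ` {z. iota z \<in> vge v 0}" by simp
    qed auto
    finally show ?thesis .
  qed
  have hom: "(+>\<^bsub>R\<^esub>) I \<in> ring_hom R Q" unfolding Q_def by (rule I.rcos_ring_hom)
  have iota_inv_op: "iota_inv (g + h) = iota_inv g \<oplus>\<^bsub>R\<^esub> iota_inv h"
    "iota_inv (g * h) = iota_inv g \<otimes>\<^bsub>R\<^esub> iota_inv h" "iota_inv 0 = \<zero>\<^bsub>R\<^esub>" "iota_inv 1 = \<one>\<^bsub>R\<^esub>" for g h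
    by (simp_all add: eqR opR del: iota_inj)
  have pr_add: "pr (g + h) = pr g \<oplus>\<^bsub>Q\<^esub> pr h" and pr_mult: "pr (g * h) = pr g \<otimes>\<^bsub>Q\<^esub> pr h"
    if "g \<in> vge v 0" "h \<in> vge v 0" for g h
    using that ring_hom_add[OF hom] ring_hom_mult[OF hom]
    by (simp_all add: pr_def iota_inv_op inv_carrier)
  have pr_one: "pr 1 = \<one>\<^bsub>Q\<^esub>"
    using ring_hom_one[OF hom] by (simp add: pr_def iota_inv_op)
  have pr_zero: "pr 0 = \<zero>\<^bsub>Q\<^esub>"
  proof -
    have "pr 0 = I" by (simp add: pr I)
    then show ?thesis by (simp add: Q_def FactRing_def)
  qed
  have const: "c a \<in> vge v 0" for a by (rule v.vge_const) simp
  define K where "K = range (\<lambda>a. pr (c a))"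
  have "subfield K Q"
  proof -
    define kr :: "'k ring" where
      "kr = \<lparr>carrier = UNIV, monoid.mult = (*), one = 1, ring.zero = 0, ring.add = (+)\<rparr>"
    have "field kr"
    proof (rule cring.cring_fieldI2)
      show "cring kr"
      proof (rule cringI)
        show "abelian_group kr"
        proof (rule abelian_groupI)
          show "\<exists>y\<in>carrier kr. y \<oplus>\<^bsub>kr\<^esub> x = \<zero>\<^bsub>kr\<^esub>" if "x \<in> carrier kr" for x
            by (rule bexI[of _ "- x"]) (auto simp: kr_def)
        qed (auto simp: kr_def)
        show "Group.comm_monoid kr" by (rule comm_monoidI) (auto simp: kr_def)
      qed (auto simp: kr_def algebra_simps)
      show "\<zero>\<^bsub>kr\<^esub> \<noteq> \<one>\<^bsub>kr\<^esub>" by (simp add: kr_def)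
      show "\<exists>b\<in>carrier kr. a \<otimes>\<^bsub>kr\<^esub> b = \<one>\<^bsub>kr\<^esub>" if "a \<in> carrier kr" "a \<noteq> \<zero>\<^bsub>kr\<^esub>" for a
        using that by (intro bexI[of _ "inverse a"]) (auto simp: kr_def)
    qed
    then interpret kr: field kr .
    have "(\<lambda>a. pr (c a)) \<in> ring_hom kr Q"
      by (rule ring_hom_memI)
         (auto simp: kr_def carQ h_simps pr_add pr_mult pr_one const)
    then interpret h: ring_hom_ring kr Q "\<lambda>a. pr (c a)"
      by (simp add: ring_hom_ring_def ring_hom_ring_axioms_def kr.ring_axioms Q.ring_axioms)
    have "\<one>\<^bsub>Q\<^esub> \<noteq> \<zero>\<^bsub>Q\<^esub>"
      unfolding pr_one[symmetric] pr_zero[symmetric] pr_eq by (simp add: vge_def)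
    from h.img_is_subfield(2)[OF kr.carrier_is_subfield this]
    show ?thesis by (simp add: K_def kr_def)
  qed
  have K_eq: "K = range (\<lambda>a. I +>\<^bsub>R\<^esub> of_x [:a:])"
  proof -
    have "iota_inv (c a) = of_x [:a:]" for a by (simp add: eqR del: iota_inj)
    then show ?thesis by (simp add: K_def pr_def)
  qed
  from deg obtain bs where bs: "length bs = n" "set bs \<subseteq> vge v 0"
    and span: "\<And>g. g \<in> vge v 0 \<Longrightarrow> \<exists>cs. length cs = n \<and> g - lin c cs bs \<in> vge v 1"
    and indep: "\<And>cs. length cs = n \<Longrightarrow> lin c cs bs \<in> vge v 1 \<Longrightarrow> set cs \<subseteq> {0}"
    unfolding residue_degree_is_def by blast
  have lin_int: "set bs' \<subseteq> vge v 0 \<Longrightarrow> lin c cs bs' \<in> vge v 0" for cs bs'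
  proof (induct cs arbitrary: bs')
    case (Cons a cs)
    then show ?case
      by (cases bs') (auto simp: lin_def intro!: v.vge_add v.vge_mult_left const)
  qed (simp add: lin_def)
  have combine: "set bs' \<subseteq> vge v 0 \<Longrightarrow>
      Q.combine (map (\<lambda>a. pr (c a)) cs) (map pr bs') = pr (lin c cs bs')" for cs bs'
  proof (induct cs arbitrary: bs')
    case Nil
    then show ?case by (simp add: lin_def pr_zero)
  next
    case (Cons a cs)
    show ?case
    proof (cases bs')
      case (Cons b bs'')
      have "pr (lin c (a # cs) bs') = pr (c a * b + lin c cs bs'')"
        by (simp add: Cons lin_def)
      also have "\<dots> = pr (c a) \<otimes>\<^bsub>Q\<^esub> pr b \<oplus>\<^bsub>Q\<^esub> pr (lin c cs bs'')"
        using Cons.prems Cons const lin_int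
        by (subst pr_add) (auto simp: pr_mult v.vge_mult_left)
      finally show ?thesis using Cons.hyps[of bs''] Cons.prems Cons by simp
    qed (simp add: lin_def pr_zero)
  qed
  have Us: "set (map pr bs) \<subseteq> carrier Q" using bs by (auto simp: carQ)
  have K_list: "\<exists>cs. Ks = map (\<lambda>a. pr (c a)) cs" if "set Ks \<subseteq> K" for Ks
    using that
  proof (induct Ks)
    case (Cons k Ks)
    then obtain a cs where "k = pr (c a)" "Ks = map (\<lambda>a. pr (c a)) cs" by (auto simp: K_def)
    then show ?case by (intro exI[of _ "a # cs"]) simp
  qed simp
  have "Q.independent K (map pr bs)"
  proof (rule ccontr)
    assume "\<not> Q.independent K (map pr bs)"
    then obtain Ks where Ks: "length Ks = length (map pr bs)" "Q.combine Ks (map pr bs) = \<zero>\<^bsub>Q\<^esub>"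
      "set Ks \<subseteq> K" "set Ks \<noteq> {\<zero>\<^bsub>Q\<^esub>}"
      using Q.dependent_imp_non_trivial_combine[OF \<open>subfield K Q\<close> Us] by metis
    then obtain cs where cs: "Ks = map (\<lambda>a. pr (c a)) cs" using K_list by blast
    have "pr (lin c cs bs) = pr 0" using Ks(2) bs combine cs pr_zero by simp
    then have "set cs \<subseteq> {0}" using indep[of cs] Ks(1) cs bs(1) by (simp add: pr_eq)
    then have "set Ks \<subseteq> {\<zero>\<^bsub>Q\<^esub>}" using cs by (auto simp: pr_zero)
    moreover have "set Ks \<noteq> {}"
    proof
      assume "set Ks = {}"
      then have "n = 0" using Ks(1) bs(1) by simp
      then have "1 - lin c [] bs \<in> vge v 1" using span[of 1] by simp
      then show False by (simp add: lin_def vge_def)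
    qed
    ultimately show False using Ks(4) by (metis subset_singletonD)
  qed
  moreover have "Q.Span K (map pr bs) = carrier Q"
  proof (rule equalityI)
    show "Q.Span K (map pr bs) \<subseteq> carrier Q"
      using Q.Span_in_carrier subfieldE(3)[OF \<open>subfield K Q\<close>] Us by blast
    show "carrier Q \<subseteq> Q.Span K (map pr bs)"
    proof
      fix x assume "x \<in> carrier Q"
      then obtain g where g: "g \<in> vge v 0" "x = pr g" by (auto simp: carQ)
      then obtain cs where "length cs = n" "g - lin c cs bs \<in> vge v 1" using span by blast
      then have "x = Q.combine (map (\<lambda>a. pr (c a)) cs) (map pr bs)" "set (map (\<lambda>a. pr (c a)) cs) \<subseteq> K"
        using g combine bs by (auto simp: pr_eq K_def)
      then show "x \<in> Q.Span K (map pr bs)"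
        unfolding Q.Span_eq_combine_set[OF \<open>subfield K Q\<close> Us] by blast
    qed
  qed
  ultimately have "Q.dimension n K (carrier Q)"
    using Q.dimensionI[OF \<open>subfield K Q\<close>] bs(1) by fastforce
  then have "Q.dim K (carrier Q) = n"
    using Q.dimI[OF \<open>subfield K Q\<close>] by (simp add: over_def)
  then show ?thesis
    by (simp add: place_degree_def Let_def K_eq Q_def R_def I_def)
qed

lemma place_degree_infinity: "place_degree F (v_inf \<circ> iota) = 1"
  using place_degree_eq discrete_valuation_v_inf residue_degree_v_inf by blast

end

section \<open>Bases of abelian groups\<close>

definition int_comb :: "('a, 'b) monoid_scheme \<Rightarrow> ('s \<Rightarrow> 'a) \<Rightarrow> 's set \<Rightarrow> ('s \<Rightarrow> int) \<Rightarrow> 'a" where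
  "int_comb G f S k = finprod G (\<lambda>s. f s [^]\<^bsub>G\<^esub> k s) S"

text \<open>
  A finite family that generates an abelian group without any relation. Its members are then
  distinct, and the group has no torsion.
\<close>

locale basis_family = Group.comm_group G for G :: "('a, 'b) monoid_scheme" (structure) +
  fixes S :: "'s set" and f :: "'s \<Rightarrow> 'a"
  assumes finite_S: "finite S"
    and f_carrier: "s \<in> S \<Longrightarrow> f s \<in> carrier G"
    and generating: "x \<in> carrier G \<Longrightarrow> \<exists>k. x = int_comb G f S k"
    and independent: "int_comb G f S k = \<one> \<Longrightarrow> s \<in> S \<Longrightarrow> k s = 0"
begin

abbreviation "comb \<equiv> int_comb G f S"

lemma comb_closed: "comb k \<in> carrier G"
  unfolding int_comb_def by (rule finprod_closed) (simp add: f_carrier)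

lemma comb_add: "comb (\<lambda>s. k s + l s) = comb k \<otimes> comb l"
proof -
  have "comb (\<lambda>s. k s + l s) = finprod G (\<lambda>s. f s [^] k s \<otimes> f s [^] l s) S"
    unfolding int_comb_def by (rule finprod_cong') (auto simp: f_carrier int_pow_mult)
  also have "\<dots> = comb k \<otimes> comb l"
    unfolding int_comb_def by (rule finprod_multf) (auto simp: f_carrier)
  finally show ?thesis .
qed

lemma comb_zero: "comb (\<lambda>s. 0) = \<one>"
  unfolding int_comb_def by (simp add: finprod_one_eqI)

lemma comb_uminus: "comb (\<lambda>s. - k s) = inv (comb k)"
proof -
  have "comb (\<lambda>s. - k s) \<otimes> comb k = \<one>"
    unfolding comb_add[symmetric] by (simp add: comb_zero)
  then show ?thesis using inv_equality comb_closed by metis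
qed

lemma comb_power: "comb (\<lambda>s. int n * k s) = comb k [^] n"
proof (induct n)
  case 0
  show ?case by (simp add: comb_zero)
next
  case (Suc n)
  have "comb (\<lambda>s. int (Suc n) * k s) = comb (\<lambda>s. int n * k s + k s)"
    by (simp add: algebra_simps)
  then show ?case by (simp add: comb_add Suc)
qed

lemma comb_eq_iff: "comb k = comb l \<longleftrightarrow> (\<forall>s\<in>S. k s = l s)"
proof
  assume "comb k = comb l"
  then have "comb (\<lambda>s. k s + (- l s)) = \<one>"
    by (simp only: comb_add comb_uminus) (simp add: comb_closed)
  from independent[OF this] show "\<forall>s\<in>S. k s = l s" by force
next
  assume "\<forall>s\<in>S. k s = l s"
  then show "comb k = comb l"
    unfolding int_comb_def by (intro finprod_cong') (auto simp: f_carrier)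
qed

lemma comb_unit: "s \<in> S \<Longrightarrow> comb (\<lambda>t. of_bool (s = t)) = f s"
proof -
  assume s: "s \<in> S"
  have "comb (\<lambda>t. of_bool (s = t)) = finprod G (\<lambda>t. if s = t then f t else \<one>) S"
    unfolding int_comb_def by (rule finprod_cong') (auto simp: f_carrier)
  also have "\<dots> = f s"
    using s finite_S f_carrier by (intro finprod_singleton) auto
  finally show ?thesis .
qed

lemma inj_on_f: "inj_on f S"
proof (rule inj_onI)
  fix s t assume st: "s \<in> S" "t \<in> S" "f s = f t"
  then have "comb (\<lambda>u. of_bool (s = u)) = comb (\<lambda>u. of_bool (t = u))" by (simp add: comb_unit)
  with st show "s = t" unfolding comb_eq_iff by (metis of_bool_eq_iff)
qed

lemma torsion_trivial: "torsion G = {\<one>}"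
proof (intro equalityI subsetI)
  fix x assume "x \<in> torsion G"
  then obtain n :: nat where x: "x \<in> carrier G" "0 < n" "x [^] n = \<one>"
    unfolding torsion_def by blast
  then obtain k where k: "x = comb k" using generating by blast
  have "comb (\<lambda>s. int n * k s) = comb (\<lambda>s. 0)" using x k by (simp add: comb_power comb_zero)
  then have "\<forall>s\<in>S. k s = 0" using x(2) by (simp add: comb_eq_iff)
  then show "x \<in> {\<one>}" using k comb_eq_iff[of k "\<lambda>s. 0"] by (simp add: comb_zero)
next
  fix x assume "x \<in> {\<one>}"
  then show "x \<in> torsion G" unfolding torsion_def by (auto intro: exI[of _ 1])
qed

lemma basis_family_cong:
  assumes "\<And>s. s \<in> S \<Longrightarrow> f' s = f s" shows "basis_family G S f'"
proof -
  have "int_comb G f' S k = int_comb G f S k" for k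
    unfolding int_comb_def by (rule finprod_cong') (auto simp: assms f_carrier)
  then show ?thesis
    by unfold_locales (use finite_S f_carrier generating independent assms in auto)
qed

text \<open>Modulo squares, the combinations with exponents \<open>0\<close> and \<open>1\<close> form a set of
  representatives, so the number of elements of a basis is determined by the group.\<close>

lemma card_le:
  assumes "basis_family G S' f'" shows "card S \<le> card S'"
proof -
  interpret B: basis_family G S' f' by fact
  have "\<forall>U. \<exists>k. comb (\<lambda>s. of_bool (s \<in> U)) = B.comb k"
    using B.generating comb_closed by blast
  then obtain m where m: "\<And>U. comb (\<lambda>s. of_bool (s \<in> U)) = B.comb (m U)" by metis
  \<comment> \<open>The parities of the coordinates in the second basis determine a class modulo squares.\<close>
  define par where "par U = {s \<in> S'. odd (m U s)}" for U
  have "inj_on par (Pow S)"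
  proof (rule inj_onI)
    fix U V assume UV: "U \<in> Pow S" "V \<in> Pow S" "par U = par V"
    define d where "d s = (m U s - m V s) div 2" for s
    have d: "m U s = m V s + int 2 * d s" if "s \<in> S'" for s
    proof -
      have "odd (m U s) \<longleftrightarrow> odd (m V s)" using UV(3) that unfolding par_def by blast
      then show ?thesis by (simp add: d_def)
    qed
    have "B.comb (m U) = B.comb (\<lambda>s. m V s + int 2 * d s)"
      using d by (simp add: B.comb_eq_iff)
    also have "\<dots> = B.comb (m V) \<otimes> B.comb d [^] (2::nat)"
      by (simp only: B.comb_add B.comb_power)
    finally have eq: "comb (\<lambda>s. of_bool (s \<in> U)) = comb (\<lambda>s. of_bool (s \<in> V)) \<otimes> B.comb d [^] (2::nat)"
      by (simp add: m)
    obtain k where "B.comb d = comb k" using generating B.comb_closed by blast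
    then have "comb (\<lambda>s. of_bool (s \<in> U)) = comb (\<lambda>s. of_bool (s \<in> V) + int 2 * k s)"
      using eq by (simp only: comb_add comb_power)
    then have *: "of_bool (s \<in> U) = of_bool (s \<in> V) + 2 * k s" if "s \<in> S" for s
      using that by (simp add: comb_eq_iff)
    have "s \<in> U \<longleftrightarrow> s \<in> V" if "s \<in> S" for s
      using *[OF that] by (cases "s \<in> U"; cases "s \<in> V") (simp_all, presburger+)
    with UV show "U = V" by blast
  qed
  moreover have "par ` Pow S \<subseteq> Pow S'" by (auto simp: par_def)
  ultimately have "card (Pow S) \<le> card (Pow S')"
    using B.finite_S by (meson card_inj_on_le finite_Pow_iff)
  then show ?thesis using finite_S B.finite_S by (simp add: card_Pow)
qed

lemma free_part_basis_image: "free_part_basis G (f ` S)"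
  unfolding free_part_basis_def
proof (intro conjI ballI)
  show "f ` S \<subseteq> carrier G" "finite (f ` S)" using f_carrier finite_S by auto
  have prod: "finprod G (\<lambda>b. b [^] l b) (f ` S) = comb (\<lambda>s. l (f s))" for l :: "'a \<Rightarrow> int"
    unfolding int_comb_def using inj_on_f f_carrier
    by (subst finprod_reindex) auto
  fix x assume "x \<in> carrier G"
  then obtain k where k: "x = comb k" using generating by blast
  define l where "l = restrict (\<lambda>b. k (inv_into S f b)) (f ` S)"
  have l: "l (f s) = k s" if "s \<in> S" for s using that inj_on_f by (simp add: l_def)
  show "\<exists>!e. e \<in> f ` S \<rightarrow>\<^sub>E (UNIV :: int set) \<and>
        (\<exists>t\<in>torsion G. x = finprod G (\<lambda>b. b [^] e b) (f ` S) \<otimes> t)"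
  proof (rule ex1I)
    show "l \<in> f ` S \<rightarrow>\<^sub>E UNIV \<and> (\<exists>t\<in>torsion G. x = finprod G (\<lambda>b. b [^] l b) (f ` S) \<otimes> t)"
    proof
      show "l \<in> f ` S \<rightarrow>\<^sub>E UNIV" unfolding l_def by auto
      have "comb k = comb (\<lambda>s. l (f s))" using l by (simp add: comb_eq_iff)
      then show "\<exists>t\<in>torsion G. x = finprod G (\<lambda>b. b [^] l b) (f ` S) \<otimes> t"
        unfolding prod torsion_trivial k using comb_closed[of "\<lambda>s. l (f s)"]
        by (simp only: bex_simps ball_simps r_one) blast
    qed
    fix e assume e: "e \<in> f ` S \<rightarrow>\<^sub>E (UNIV :: int set) \<and>
        (\<exists>t\<in>torsion G. x = finprod G (\<lambda>b. b [^] e b) (f ` S) \<otimes> t)"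
    then have "comb k = comb (\<lambda>s. e (f s))"
      using comb_closed by (simp add: prod torsion_trivial k)
    then have "\<forall>b\<in>f ` S. e b = l b" using l by (auto simp: comb_eq_iff)
    moreover have "l \<in> f ` S \<rightarrow>\<^sub>E UNIV" unfolding l_def by auto
    ultimately show "e = l" using e by (meson PiE_ext)
  qed
qed

lemma basis_family_of_free_part_basis:
  assumes B: "free_part_basis G B" shows "basis_family G B (\<lambda>b. b)"
proof unfold_locales
  show "finite B" and carr: "\<And>s. s \<in> B \<Longrightarrow> s \<in> carrier G"
    using B unfolding free_part_basis_def by auto
  have closed: "int_comb G (\<lambda>b. b) B k \<in> carrier G" for k
    unfolding int_comb_def using carr by (intro finprod_closed) auto
  show "\<exists>k. x = int_comb G (\<lambda>b. b) B k" if x: "x \<in> carrier G" for x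
  proof -
    obtain e where "x = finprod G (\<lambda>b. b [^] (e b::int)) B \<otimes> \<one>"
      using B x unfolding free_part_basis_def torsion_trivial by blast
    then show ?thesis using closed[of e] by (auto simp: int_comb_def)
  qed
  fix k s assume k: "int_comb G (\<lambda>b. b) B k = \<one>" and s: "s \<in> B"
  have "\<exists>!e. e \<in> B \<rightarrow>\<^sub>E (UNIV :: int set) \<and> \<one> = int_comb G (\<lambda>b. b) B e \<otimes> \<one>"
    using B one_closed unfolding free_part_basis_def torsion_trivial int_comb_def by simp
  moreover have "int_comb G (\<lambda>b. b) B (restrict k B) = int_comb G (\<lambda>b. b) B k"
    unfolding int_comb_def using carr by (intro finprod_cong') auto
  moreover have "int_comb G (\<lambda>b. b) B (restrict (\<lambda>b. 0) B) = \<one>"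
    unfolding int_comb_def by (rule finprod_one_eqI) simp
  ultimately have "restrict k B = restrict (\<lambda>b. 0) B" using k by fastforce
  with s show "k s = 0" by (metis restrict_apply')
qed

theorem free_rank_eq: "free_rank G = card S"
  unfolding free_rank_def
proof (rule the_equality)
  show "\<exists>B. free_part_basis G B \<and> card B = card S"
    using free_part_basis_image inj_on_f by (metis card_image)
  fix r assume "\<exists>B. free_part_basis G B \<and> card B = r"
  then obtain B where B: "free_part_basis G B" "card B = r" by blast
  interpret B: basis_family G B "\<lambda>b. b" using B(1) by (rule basis_family_of_free_part_basis)
  show "r = card S"
    using card_le[OF B.basis_family_axioms] B.card_le[OF basis_family_axioms] B(2) by simp
qed

end

section \<open>The divisor class group of a hyperelliptic model\<close>

lemma sum_of_bool:
  fixes g :: "'x \<Rightarrow> int"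
  assumes "finite A" shows "(\<Sum>u\<in>A. of_bool (a = u) * g u) = (if a \<in> A then g a else 0)"
proof -
  have "(\<Sum>u\<in>A. of_bool (a = u) * g u) = (\<Sum>u\<in>A. if a = u then g u else 0)"
    by (rule sum.cong) auto
  then show ?thesis using assms by simp
qed

text \<open>The hypothesis is the product formula for functions without finite zeros and poles.\<close>

locale hyperelliptic_constants = hyperelliptic c X Y F
  for c :: "'k::field \<Rightarrow> 'l::field" and X Y F +
  assumes no_finite_zeros: "g \<noteq> 0 \<Longrightarrow> (\<And>v. finite_place c X Y F v \<Longrightarrow> v g = 0) \<Longrightarrow> v_inf g = 0"
begin

abbreviation "fin v \<equiv> finite_place c X Y F v"

abbreviation dg :: "('l \<Rightarrow> int) \<Rightarrow> int" where "dg v \<equiv> int (place_degree F (v \<circ> iota))"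

lemma fin_valuation: "fin v \<Longrightarrow> discrete_valuation c v"
  by (simp add: finite_or_inf)

lemma conjugate_sum:
  assumes "fin v"
  shows "\<exists>h. h \<noteq> 0 \<and> v_inf h = - 2 * dg v \<and>
     (\<forall>v'. fin v' \<longrightarrow> v' h = of_bool (v' = v) + of_bool (v' = (\<lambda>g. v (cj g))))"
proof -
  interpret finite_place c X Y F v by fact
  from conjugate_sum_principal obtain n h where "residue_degree_is c v n" "h \<noteq> 0"
    "v_inf h = - 2 * int n"
    "\<forall>v'. fin v' \<longrightarrow> v' h = of_bool (v' = v) + of_bool (v' = (\<lambda>g. v (cj g)))" by blast
  then show ?thesis using place_degree_eq[OF discrete_valuation_axioms] by metis
qed

text \<open>The norm of \<open>h\<close> has the divisor \<open>\<Sum> v(h) (v + conjugate of v)\<close> on the finite places, and so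
  does a product of functions of known order at infinity. The quotient of the two has order \<open>0\<close> at
  infinity, as it has no finite zeros and poles.\<close>

theorem product_formula:
  assumes h: "h \<noteq> 0" and S: "finite S" "\<And>v. v \<in> S \<Longrightarrow> fin v"
    and outside: "\<And>v. fin v \<Longrightarrow> v \<notin> S \<Longrightarrow> v h = 0"
  shows "v_inf h = - (\<Sum>v\<in>S. v h * dg v)"
proof -
  interpret inf: discrete_valuation c v_inf by (rule discrete_valuation_v_inf)
  have "\<forall>v\<in>S. \<exists>w. w \<noteq> 0 \<and> v_inf w = - 2 * dg v \<and>
     (\<forall>v'. fin v' \<longrightarrow> v' w = of_bool (v' = v) + of_bool (v' = (\<lambda>g. v (cj g))))"
    using conjugate_sum S(2) by blast
  from bchoice[OF this] obtain w where w': "\<forall>v\<in>S. w v \<noteq> 0 \<and> v_inf (w v) = - 2 * dg v \<and>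
     (\<forall>v'. fin v' \<longrightarrow> v' (w v) = of_bool (v' = v) + of_bool (v' = (\<lambda>g. v (cj g))))"
    by blast
  then have w: "\<And>v. v \<in> S \<Longrightarrow> w v \<noteq> 0" "\<And>v. v \<in> S \<Longrightarrow> v_inf (w v) = - 2 * dg v"
    by simp_all
  have w3: "v' (w v) = of_bool (v' = v) + of_bool (v' = (\<lambda>g. v (cj g)))" if "v \<in> S" "fin v'" for v v'
    using w' that by blast
  \<comment> \<open>\<open>P\<close> has the same orders at the finite places as the norm of \<open>h\<close>.\<close>
  define P where "P = (\<Prod>v\<in>S. w v powi v h)"
  have P0: "P \<noteq> 0"
  proof -
    have "w v powi v h \<noteq> 0" if "v \<in> S" for v using w(1)[OF that] by simp
    then show ?thesis unfolding P_def by (simp only: prod_zero_iff[OF S(1)]) blast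
  qed
  have val_P: "u P = (\<Sum>v\<in>S. v h * u (w v))" if "discrete_valuation c u" for u
  proof -
    interpret u: discrete_valuation c u by fact
    have "w v powi v h \<noteq> 0" if "v \<in> S" for v using w(1)[OF that] by simp
    then have "u P = (\<Sum>v\<in>S. u (w v powi v h))" unfolding P_def by (rule u.v_prod)
    then show ?thesis by (simp only: u.v_power_int)
  qed
  have cjh: "cj h \<noteq> 0" using h by simp
  define R where "R = h * cj h / P"
  have R0: "R \<noteq> 0" using h P0 by (simp add: R_def)
  have val_R: "u R = u h + u (cj h) - u P" if "discrete_valuation c u" for u
  proof -
    interpret u: discrete_valuation c u by fact
    show ?thesis unfolding R_def using h cjh P0 by (simp add: u.v_divide u.v_mult)
  qed
  have "u R = 0" if u: "fin u" for u
  proof -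
    interpret u: finite_place c X Y F u by fact
    have single: "(\<Sum>v\<in>S. v h * of_bool (u' = v)) = u' h" if "fin u'" for u'
      using sum_of_bool[OF S(1), of u' "\<lambda>v. v h"] outside[OF that] by (simp add: mult.commute)
    have swap: "u = (\<lambda>g. v (cj g)) \<longleftrightarrow> (\<lambda>g. u (cj g)) = v" for v
      by (metis cj_cj ext)
    have "u P = (\<Sum>v\<in>S. v h * of_bool (u = v)) + (\<Sum>v\<in>S. v h * of_bool ((\<lambda>g. u (cj g)) = v))"
      unfolding val_P[OF fin_valuation[OF u]] sum.distrib[symmetric]
      by (rule sum.cong) (simp_all add: w3 u swap algebra_simps)
    also have "\<dots> = u h + u (cj h)"
      using single[OF u] single[OF u.finite_place_cj] by simp
    finally show ?thesis using val_R[OF fin_valuation[OF u]] by simp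
  qed
  then have "v_inf R = 0" using no_finite_zeros R0 by blast
  then have "2 * v_inf h = v_inf P"
    using val_R[OF discrete_valuation_v_inf] by (simp add: v_inf_cj)
  also have "\<dots> = - 2 * (\<Sum>v\<in>S. v h * dg v)"
    unfolding val_P[OF discrete_valuation_v_inf] sum_distrib_left
    by (rule sum.cong) (simp_all add: w(2))
  finally show ?thesis by simp
qed

subsection \<open>Divisors of degree zero\<close>

abbreviation "D0 \<equiv> degree_zero_divisors F"
abbreviation "H \<equiv> principal_divisors F"
abbreviation "J \<equiv> jacobian_points F"

lemma degree_superset:
  assumes "finite A" "Poly_Mapping.keys D \<subseteq> A"
  shows "divisor_degree F D = (\<Sum>v\<in>A. Poly_Mapping.lookup D v * int (place_degree F v))"
  unfolding divisor_degree_def using assms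
  by (intro sum.mono_neutral_left) (auto simp: in_keys_iff)

lemma degree_add: "divisor_degree F (D + E) = divisor_degree F D + divisor_degree F E"
proof -
  let ?A = "Poly_Mapping.keys D \<union> Poly_Mapping.keys E"
  have "Poly_Mapping.keys (D + E) \<subseteq> ?A" by (rule keys_add)
  then show ?thesis
    using degree_superset[of ?A] by (simp add: lookup_add algebra_simps sum.distrib)
qed

lemma degree_cmul: "divisor_degree F (frag_cmul k D) = k * divisor_degree F D"
proof -
  have "Poly_Mapping.keys (frag_cmul k D) \<subseteq> Poly_Mapping.keys D" by auto
  then show ?thesis
    using degree_superset[of "Poly_Mapping.keys D"]
    by (simp add: sum_distrib_left algebra_simps)
qed

lemma degree_minus: "divisor_degree F (- D) = - divisor_degree F D"
  using degree_cmul[of "-1" D] by simp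

lemma degree_diff: "divisor_degree F (D - E) = divisor_degree F D - divisor_degree F E"
  using degree_add[of D "- E"] by (simp add: degree_minus)

lemma degree_single: "divisor_degree F (Poly_Mapping.single v k) = k * int (place_degree F v)"
  by (cases "k = 0") (auto simp: divisor_degree_def)

lemma carrier_D0: "D \<in> carrier D0 \<longleftrightarrow> Poly_Mapping.keys D \<subseteq> places F \<and> divisor_degree F D = 0"
  by (simp add: degree_zero_divisors_def)

lemma D0_ops [simp]: "D \<otimes>\<^bsub>D0\<^esub> E = D + E" "\<one>\<^bsub>D0\<^esub> = 0"
  by (simp_all add: degree_zero_divisors_def free_Abelian_group_def)

lemma D0_uminus: "D \<in> carrier D0 \<Longrightarrow> - D \<in> carrier D0"
  by (simp add: carrier_D0 degree_minus)

sublocale D0: Group.comm_group D0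
proof (rule comm_groupI)
  show "D \<otimes>\<^bsub>D0\<^esub> E \<in> carrier D0" if "D \<in> carrier D0" "E \<in> carrier D0" for D E
    using that keys_add[of D E] by (auto simp: carrier_D0 degree_add)
  show "\<exists>E\<in>carrier D0. E \<otimes>\<^bsub>D0\<^esub> D = \<one>\<^bsub>D0\<^esub>" if "D \<in> carrier D0" for D
    using that by (intro bexI[of _ "- D"]) (simp_all add: D0_uminus)
  show "\<one>\<^bsub>D0\<^esub> \<in> carrier D0" by (simp add: carrier_D0 divisor_degree_def)
qed (simp_all add: algebra_simps)

lemma D0_inv: "D \<in> carrier D0 \<Longrightarrow> inv\<^bsub>D0\<^esub> D = - D"
  by (rule D0.inv_equality) (simp_all add: D0_uminus)

lemma all_places: "(\<forall>w\<in>places F. P w) \<longleftrightarrow> P (v_inf \<circ> iota) \<and> (\<forall>v. fin v \<longrightarrow> P (v \<circ> iota))"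
  unfolding places_eq finite_or_inf by auto

lemma principal_iff:
  "D \<in> H \<longleftrightarrow> Poly_Mapping.keys D \<subseteq> places F \<and>
     (\<exists>h. h \<noteq> 0 \<and> Poly_Mapping.lookup D (v_inf \<circ> iota) = v_inf h \<and>
        (\<forall>v. fin v \<longrightarrow> Poly_Mapping.lookup D (v \<circ> iota) = v h))"
  unfolding principal_divisors_def all_places ex_iota by simp

lemma principal_degree_zero:
  assumes "D \<in> H" shows "divisor_degree F D = 0"
proof -
  from assms obtain h where D: "Poly_Mapping.keys D \<subseteq> places F" and h: "h \<noteq> 0"
    "Poly_Mapping.lookup D (v_inf \<circ> iota) = v_inf h"
    "\<And>v. fin v \<Longrightarrow> Poly_Mapping.lookup D (v \<circ> iota) = v h"
    unfolding principal_iff by blast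
  define S where "S = {v. fin v \<and> v \<circ> iota \<in> Poly_Mapping.keys D}"
  have inj: "inj_on (\<lambda>v. v \<circ> iota) A" for A by (auto intro: inj_onI)
  have "(\<lambda>v. v \<circ> iota) ` S \<subseteq> Poly_Mapping.keys D" by (auto simp: S_def)
  then have "finite ((\<lambda>v. v \<circ> iota) ` S)" by (rule finite_subset) simp
  then have finS: "finite S" using inj by (rule finite_imageD)
  let ?A = "insert (v_inf \<circ> iota) ((\<lambda>v. v \<circ> iota) ` S)"
  have sub: "Poly_Mapping.keys D \<subseteq> ?A"
    using D unfolding places_eq finite_or_inf S_def by auto
  have notin: "v_inf \<circ> iota \<notin> (\<lambda>v. v \<circ> iota) ` S"
    using v_inf_not_finite by (auto simp: S_def)
  have "divisor_degree F D = v_inf h + (\<Sum>v\<in>S. v h * dg v)"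
    using finS notin
    by (simp add: degree_superset[OF _ sub] h place_degree_infinity sum.reindex[OF inj] S_def)
  moreover have "v_inf h = - (\<Sum>v\<in>S. v h * dg v)"
  proof (rule product_formula[OF h(1) finS])
    fix v assume "fin v" "v \<notin> S"
    then show "v h = 0" using h(3) by (auto simp: S_def in_keys_iff)
  qed (simp add: S_def)
  ultimately show ?thesis by simp
qed

lemma subgroup_H: "subgroup H D0"
proof (rule D0.subgroupI)
  show "H \<subseteq> carrier D0"
    using principal_degree_zero by (auto simp: carrier_D0 principal_iff)
  have "0 \<in> H"
  proof -
    interpret inf: discrete_valuation c v_inf by (rule discrete_valuation_v_inf)
    have "v 1 = 0" if "fin v" for v
    proof -
      interpret finite_place c X Y F v by fact
      show ?thesis by simp
    qed
    then show ?thesis unfolding principal_iff by (auto intro!: exI[of _ 1])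
  qed
  then show "H \<noteq> {}" by blast
  show "inv\<^bsub>D0\<^esub> D \<in> H" if D: "D \<in> H" for D
  proof -
    have "D \<in> carrier D0" using D principal_degree_zero by (auto simp: carrier_D0 principal_iff)
    moreover from D obtain h where h: "Poly_Mapping.keys D \<subseteq> places F" "h \<noteq> 0"
      "Poly_Mapping.lookup D (v_inf \<circ> iota) = v_inf h"
      "\<And>v. fin v \<Longrightarrow> Poly_Mapping.lookup D (v \<circ> iota) = v h"
      unfolding principal_iff by blast
    have "v (inverse h) = - v h" if "discrete_valuation c v" for v
      using that by (rule discrete_valuation.v_inverse)
    then have "- D \<in> H"
      unfolding principal_iff using h discrete_valuation_v_inf fin_valuation
      by (auto intro!: exI[of _ "inverse h"])
    ultimately show ?thesis by (simp add: D0_inv)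
  qed
  show "D \<otimes>\<^bsub>D0\<^esub> E \<in> H" if DE: "D \<in> H" "E \<in> H" for D E
  proof -
    from DE obtain h g where h: "Poly_Mapping.keys D \<subseteq> places F" "h \<noteq> 0"
      "Poly_Mapping.lookup D (v_inf \<circ> iota) = v_inf h"
      "\<And>v. fin v \<Longrightarrow> Poly_Mapping.lookup D (v \<circ> iota) = v h"
      and g: "Poly_Mapping.keys E \<subseteq> places F" "g \<noteq> 0"
      "Poly_Mapping.lookup E (v_inf \<circ> iota) = v_inf g"
      "\<And>v. fin v \<Longrightarrow> Poly_Mapping.lookup E (v \<circ> iota) = v g"
      unfolding principal_iff by blast
    have "v (h * g) = v h + v g" if "discrete_valuation c v" for v
      using that h(2) g(2) by (rule discrete_valuation.v_mult)
    moreover have "Poly_Mapping.keys (D + E) \<subseteq> places F" using keys_add[of D E] h(1) g(1) by blast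
    ultimately show ?thesis
      unfolding principal_iff D0_ops using h g discrete_valuation_v_inf fin_valuation
      by (auto intro!: exI[of _ "h * g"] simp: lookup_add)
  qed
qed

sublocale J: Group.comm_group J
  unfolding jacobian_points_def using D0.abelian_FactGroup[OF subgroup_H] .

definition cls :: "'k divisor \<Rightarrow> 'k divisor set" where
  "cls D = H #>\<^bsub>D0\<^esub> D"

lemma group_hom_cls: "group_hom D0 J cls"
proof -
  interpret normal H D0 by (rule D0.subgroup_imp_normal[OF subgroup_H])
  have "cls \<in> hom D0 J"
    using r_coset_hom_Mod by (simp add: cls_def[abs_def] jacobian_points_def)
  then show ?thesis
    by (simp add: group_hom_def group_hom_axioms_def D0.is_group J.is_group)
qed

sublocale cls: group_hom D0 J cls by (rule group_hom_cls)

lemma cls_surj: "x \<in> carrier J \<Longrightarrow> \<exists>D\<in>carrier D0. x = cls D"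
  by (auto simp: jacobian_points_def FactGroup_def RCOSETS_def cls_def)

lemma cls_eq_one_iff: "D \<in> carrier D0 \<Longrightarrow> cls D = \<one>\<^bsub>J\<^esub> \<longleftrightarrow> D \<in> H"
proof -
  assume D: "D \<in> carrier D0"
  have one: "\<one>\<^bsub>J\<^esub> = H" by (simp add: jacobian_points_def FactGroup_def)
  show ?thesis
    unfolding one cls_def using D subgroup_H
    by (metis D0.coset_join1 D0.coset_join2 D0.subgroup_self subgroup.subset)
qed

lemma cls_cmul:
  assumes "D \<in> carrier D0" shows "cls (frag_cmul k D) = cls D [^]\<^bsub>J\<^esub> k"
proof -
  have "D [^]\<^bsub>D0\<^esub> k = frag_cmul k D"
  proof -
    have nat: "D [^]\<^bsub>D0\<^esub> n = frag_cmul (int n) D" for n :: nat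
      by (induct n) (auto simp: frag_cmul_distrib)
    show ?thesis
    proof (cases k rule: int_cases2)
      case (nonneg n)
      then show ?thesis by (simp only: int_pow_int nat)
    next
      case (nonpos n)
      have "frag_cmul (int n) D \<in> carrier D0"
        using assms by (auto simp: carrier_D0 degree_cmul)
      then have "inv\<^bsub>D0\<^esub> (frag_cmul (int n) D) = - frag_cmul (int n) D" by (rule D0_inv)
      then show ?thesis
        using D0.int_pow_neg_int[OF assms, of n] by (simp only: nonpos nat minus_frag_cmul)
    qed
  qed
  then show ?thesis using cls.hom_int_pow[OF assms, of k] by metis
qed

lemma cmul_D0: "D \<in> carrier D0 \<Longrightarrow> frag_cmul k D \<in> carrier D0"
  by (auto simp: carrier_D0 degree_cmul)

lemma sum_D0:
  assumes "finite A" "\<And>s. s \<in> A \<Longrightarrow> D s \<in> carrier D0"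
  shows "(\<Sum>s\<in>A. frag_cmul (k s) (D s)) \<in> carrier D0"
  using assms
proof (induct A)
  case (insert s A)
  then show ?case using D0.m_closed[of "frag_cmul (k s) (D s)"] cmul_D0 by simp
qed (simp add: carrier_D0 divisor_degree_def)

lemma cls_sum:
  assumes "finite A" "\<And>s. s \<in> A \<Longrightarrow> D s \<in> carrier D0"
  shows "cls (\<Sum>s\<in>A. frag_cmul (k s) (D s)) = int_comb J (\<lambda>s. cls (D s)) A k"
  using assms
proof (induct A)
  case empty
  then show ?case using cls.hom_one by (simp add: int_comb_def)
next
  case (insert s A)
  have "cls (frag_cmul (k s) (D s) + (\<Sum>s\<in>A. frag_cmul (k s) (D s)))
      = cls (frag_cmul (k s) (D s)) \<otimes>\<^bsub>J\<^esub> cls (\<Sum>s\<in>A. frag_cmul (k s) (D s))"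
  proof -
    have "frag_cmul (k s) (D s) \<in> carrier D0" using insert by (intro cmul_D0) simp
    moreover have "(\<Sum>s\<in>A. frag_cmul (k s) (D s)) \<in> carrier D0"
      using insert by (intro sum_D0) simp_all
    ultimately show ?thesis using cls.hom_mult by (simp only: D0_ops)
  qed
  then show ?case
    using insert unfolding int_comb_def
    by (subst J.finprod_insert) (auto simp: cls_cmul)
qed

text \<open>Every divisor of degree zero is an integral combination of these.\<close>

definition point_divisor :: "('l \<Rightarrow> int) \<Rightarrow> 'k divisor" where
  "point_divisor v = Poly_Mapping.single (v \<circ> iota) 1 - Poly_Mapping.single (v_inf \<circ> iota) (dg v)"

lemma point_divisor_D0:
  assumes "discrete_valuation c v" shows "point_divisor v \<in> carrier D0"
proof -
  have "Poly_Mapping.keys (point_divisor v) \<subseteq> {v \<circ> iota, v_inf \<circ> iota}"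
    unfolding point_divisor_def
    using keys_diff[of "Poly_Mapping.single (v \<circ> iota) 1" "Poly_Mapping.single (v_inf \<circ> iota) (dg v)"]
    by (auto split: if_splits)
  moreover have "v \<circ> iota \<in> places F" "v_inf \<circ> iota \<in> places F"
    using assms discrete_valuation_v_inf by (simp_all add: place_iff)
  ultimately show ?thesis
    by (auto simp: carrier_D0 point_divisor_def degree_diff degree_single place_degree_infinity)
qed

lemma place_class_eq: "place_class F (v \<circ> iota) = cls (point_divisor v)"
  by (simp add: place_class_def cls_def point_divisor_def place_infinity_eq)

lemma lookup_point_divisor:
  "Poly_Mapping.lookup (point_divisor v) (u \<circ> iota) = of_bool (v = u) - dg v * of_bool (v_inf = u)"
  by (simp add: point_divisor_def lookup_minus lookup_single when_def)

lemma lookup_sum_points: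
  "Poly_Mapping.lookup (\<Sum>s\<in>A. frag_cmul (k s) (point_divisor (P s))) (u \<circ> iota) =
     (\<Sum>s\<in>A. k s * (of_bool (P s = u) - dg (P s) * of_bool (v_inf = u)))"
  by (simp add: lookup_sum lookup_point_divisor)

text \<open>
  Orders at infinity do not occur in the hypotheses: by the product formula they are determined by
  the orders at the finite places.
\<close>

theorem jacobian_basis:
  assumes S: "finite S" "\<And>s. s \<in> S \<Longrightarrow> fin (P s)"
    and gen: "\<And>v. fin v \<Longrightarrow> \<exists>h k. h \<noteq> 0 \<and>
      (\<forall>u. fin u \<longrightarrow> u h = of_bool (v = u) - (\<Sum>s\<in>S. k s * of_bool (P s = u)))"
    and indep: "\<And>h k s. h \<noteq> 0 \<Longrightarrow> (\<And>u. fin u \<Longrightarrow> u h = (\<Sum>s\<in>S. k s * of_bool (P s = u))) \<Longrightarrow>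
      s \<in> S \<Longrightarrow> k s = (0::int)"
  shows "basis_family J S (\<lambda>s. place_class F (P s \<circ> iota))"
proof -
  have D0: "point_divisor (P s) \<in> carrier D0" if "s \<in> S" for s
    using that S(2) fin_valuation point_divisor_D0 by blast
  let ?f = "\<lambda>s. cls (point_divisor (P s))"
  let ?sum = "\<lambda>k. \<Sum>s\<in>S. frag_cmul (k s) (point_divisor (P s))"
  have comb: "int_comb J ?f S k = cls (?sum k)" for k
    using cls_sum[OF S(1) D0] by simp
  have sumD0: "?sum k \<in> carrier D0" for k using sum_D0[OF S(1) D0] .
  have point: "\<exists>k. cls (point_divisor v) = cls (?sum k)" if v: "discrete_valuation c v" for v
  proof (cases "v = v_inf")
    case True
    have eq: "point_divisor v = ?sum (\<lambda>_. 0)"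
      by (simp add: point_divisor_def True place_degree_infinity)
    show ?thesis by (rule exI[of _ "\<lambda>_. 0"]) (simp only: eq)
  next
    case False
    with v have "fin v" by (simp add: finite_or_inf)
    then obtain h k where h: "h \<noteq> 0"
      "\<And>u. fin u \<Longrightarrow> u h = of_bool (v = u) - (\<Sum>s\<in>S. k s * of_bool (P s = u))"
      using gen by blast
    let ?D = "point_divisor v - ?sum k"
    have vD0: "point_divisor v \<in> carrier D0" using v point_divisor_D0 by blast
    have D: "?D \<in> carrier D0"
      using D0.m_closed[OF vD0 D0_uminus[OF sumD0[of k]]] by simp
    define A where "A = insert v (P ` S)"
    have A: "finite A" "\<And>u. u \<in> A \<Longrightarrow> fin u" using S \<open>fin v\<close> by (auto simp: A_def)
    have "v_inf h = - (\<Sum>u\<in>A. u h * dg u)"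
    proof (rule product_formula[OF h(1) A])
      fix u assume u: "fin u" "u \<notin> A"
      then have "v \<noteq> u" "\<And>s. s \<in> S \<Longrightarrow> P s \<noteq> u" by (auto simp: A_def)
      then show "u h = 0" using h(2)[OF u(1)] by simp
    qed
    also have "(\<Sum>u\<in>A. u h * dg u) =
       (\<Sum>u\<in>A. of_bool (v = u) * dg u) - (\<Sum>u\<in>A. \<Sum>s\<in>S. k s * (of_bool (P s = u) * dg u))"
      unfolding sum_subtractf[symmetric]
      by (rule sum.cong) (simp_all add: h(2) A left_diff_distrib sum_distrib_right mult.assoc)
    also have "(\<Sum>u\<in>A. \<Sum>s\<in>S. k s * (of_bool (P s = u) * dg u)) =
       (\<Sum>s\<in>S. k s * (\<Sum>u\<in>A. of_bool (P s = u) * dg u))"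
      unfolding sum_distrib_left by (rule sum.swap)
    also have "\<dots> = (\<Sum>s\<in>S. k s * dg (P s))"
      by (rule sum.cong) (simp_all add: sum_of_bool[OF A(1)], simp add: A_def)
    also have "(\<Sum>u\<in>A. of_bool (v = u) * dg u) = dg v"
      by (simp add: sum_of_bool[OF A(1)]) (simp add: A_def)
    finally have inf: "v_inf h = - (dg v - (\<Sum>s\<in>S. k s * dg (P s)))" .
    have ninf: "P s \<noteq> v_inf" if "s \<in> S" for s using S(2)[OF that] v_inf_not_finite by metis
    have "?D \<in> H"
      unfolding principal_iff
    proof (intro conjI exI[of _ h] allI impI)
      show "Poly_Mapping.keys ?D \<subseteq> places F" using D by (simp add: carrier_D0)
      show "Poly_Mapping.lookup ?D (v_inf \<circ> iota) = v_inf h"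
        using False ninf
        by (simp add: lookup_minus lookup_sum_points lookup_point_divisor inf sum_negf)
      fix u assume u: "fin u"
      then have "v_inf \<noteq> u" using v_inf_not_finite by metis
      then show "Poly_Mapping.lookup ?D (u \<circ> iota) = u h"
        by (simp add: lookup_minus lookup_sum_points lookup_point_divisor h(2)[OF u])
    qed (rule h(1))
    then have "cls ?D = \<one>\<^bsub>J\<^esub>" using cls_eq_one_iff[OF D] by simp
    moreover have "cls (point_divisor v) = cls ?D \<otimes>\<^bsub>J\<^esub> cls (?sum k)"
      using cls.hom_mult[OF D sumD0[of k]] by simp
    ultimately show ?thesis using cls.hom_closed[OF sumD0[of k]] by auto
  qed
  have closed: "\<exists>k. cls (\<Sum>w\<in>A. frag_cmul (l w) (D w)) = cls (?sum k)"
    if "finite A" "\<And>w. w \<in> A \<Longrightarrow> D w \<in> carrier D0" "\<And>w. w \<in> A \<Longrightarrow> \<exists>k. cls (D w) = cls (?sum k)"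
    for A D and l :: "_ \<Rightarrow> int"
    using that
  proof (induct A)
    case empty
    have eq: "?sum (\<lambda>_. 0) = 0" by simp
    show ?case by (rule exI[of _ "\<lambda>_. 0"]) (simp only: eq sum.empty)
  next
    case (insert w A)
    then obtain k where k: "cls (\<Sum>w\<in>A. frag_cmul (l w) (D w)) = cls (?sum k)" by blast
    obtain k' where k': "cls (D w) = cls (?sum k')" using insert by blast
    have "cls (\<Sum>w\<in>insert w A. frag_cmul (l w) (D w)) =
       cls (frag_cmul (l w) (D w)) \<otimes>\<^bsub>J\<^esub> cls (\<Sum>w\<in>A. frag_cmul (l w) (D w))"
    proof -
      have "frag_cmul (l w) (D w) \<in> carrier D0" using insert by (intro cmul_D0) simp
      moreover have "(\<Sum>w\<in>A. frag_cmul (l w) (D w)) \<in> carrier D0"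
        using insert by (intro sum_D0) simp_all
      ultimately have "cls (frag_cmul (l w) (D w) + (\<Sum>w\<in>A. frag_cmul (l w) (D w))) =
        cls (frag_cmul (l w) (D w)) \<otimes>\<^bsub>J\<^esub> cls (\<Sum>w\<in>A. frag_cmul (l w) (D w))"
        using cls.hom_mult by (simp only: D0_ops)
      then show ?thesis by (simp only: sum.insert[OF insert(1,2)])
    qed
    also have "cls (frag_cmul (l w) (D w)) = cls (frag_cmul (l w) (?sum k'))"
      using insert k' by (simp add: cls_cmul sumD0)
    also have "cls (\<Sum>w\<in>A. frag_cmul (l w) (D w)) = cls (?sum k)" by (rule k)
    also have "cls (frag_cmul (l w) (?sum k')) \<otimes>\<^bsub>J\<^esub> cls (?sum k) =
       cls (frag_cmul (l w) (?sum k') + ?sum k)"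
      using cls.hom_mult[OF cmul_D0[OF sumD0] sumD0] by simp
    also have "frag_cmul (l w) (?sum k') + ?sum k = ?sum (\<lambda>s. l w * k' s + k s)"
      by (simp add: frag_cmul_sum frag_cmul_distrib sum.distrib)
    finally show ?case by (rule exI[of _ "\<lambda>s. l w * k' s + k s"])
  qed
  have gen: "\<exists>k. x = cls (?sum k)" if x: "x \<in> carrier J" for x
  proof -
    obtain D where D: "D \<in> carrier D0" "x = cls D" using cls_surj[OF x] by blast
    define E where "E w = point_divisor (w \<circ> iota_inv)" for w
    have iota_cancel: "(w \<circ> iota_inv) \<circ> iota = w" for w by (auto simp: fun_eq_iff)
    have val: "discrete_valuation c (w \<circ> iota_inv)" if "w \<in> Poly_Mapping.keys D" for w
    proof -
      have "(w \<circ> iota_inv) \<circ> iota \<in> places F" using that D(1) by (auto simp: iota_cancel carrier_D0)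
      then show ?thesis by (simp only: place_iff)
    qed
    have "D = (\<Sum>w\<in>Poly_Mapping.keys D. frag_cmul (Poly_Mapping.lookup D w) (E w))"
    proof (rule poly_mapping_eqI)
      fix u
      have "Poly_Mapping.lookup (\<Sum>w\<in>Poly_Mapping.keys D. frag_cmul (Poly_Mapping.lookup D w) (E w)) u =
        (\<Sum>w\<in>Poly_Mapping.keys D. Poly_Mapping.lookup D w * of_bool (w = u))
        - (\<Sum>w\<in>Poly_Mapping.keys D. Poly_Mapping.lookup D w * int (place_degree F w)) * of_bool (v_inf \<circ> iota = u)"
        unfolding sum_distrib_right sum_subtractf[symmetric] lookup_sum
        by (rule sum.cong)
           (simp_all add: E_def point_divisor_def iota_cancel lookup_minus lookup_single when_def algebra_simps)
      also have "(\<Sum>w\<in>Poly_Mapping.keys D. Poly_Mapping.lookup D w * int (place_degree F w)) = 0"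
        using D(1) by (simp add: carrier_D0 divisor_degree_def)
      also have "(\<Sum>w\<in>Poly_Mapping.keys D. Poly_Mapping.lookup D w * of_bool (w = u)) =
          (\<Sum>w\<in>Poly_Mapping.keys D. of_bool (u = w) * Poly_Mapping.lookup D w)"
        by (rule sum.cong) auto
      also have "\<dots> = Poly_Mapping.lookup D u"
        using sum_of_bool[OF finite_keys[of D], of u "Poly_Mapping.lookup D"] by (simp add: in_keys_iff)
      finally show "Poly_Mapping.lookup D u =
        Poly_Mapping.lookup (\<Sum>w\<in>Poly_Mapping.keys D. frag_cmul (Poly_Mapping.lookup D w) (E w)) u"
        by simp
    qed
    then have c: "cls D = cls (\<Sum>w\<in>Poly_Mapping.keys D. frag_cmul (Poly_Mapping.lookup D w) (E w))"
      by (rule arg_cong)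
    have "\<exists>k. cls (\<Sum>w\<in>Poly_Mapping.keys D. frag_cmul (Poly_Mapping.lookup D w) (E w)) = cls (?sum k)"
      using val point point_divisor_D0 by (intro closed) (auto simp: E_def)
    then obtain k where
      k: "cls (\<Sum>w\<in>Poly_Mapping.keys D. frag_cmul (Poly_Mapping.lookup D w) (E w)) = cls (?sum k)" ..
    show ?thesis by (rule exI[of _ k]) (rule trans[OF D(2) trans[OF c k]])
  qed
  have indep: "k s = 0" if k: "cls (?sum k) = \<one>\<^bsub>J\<^esub>" and s: "s \<in> S" for k s
  proof -
    have "?sum k \<in> H" using k cls_eq_one_iff[OF sumD0] by simp
    then obtain h where h: "h \<noteq> 0" "\<And>u. fin u \<Longrightarrow> Poly_Mapping.lookup (?sum k) (u \<circ> iota) = u h"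
      unfolding principal_iff by blast
    have "u h = (\<Sum>s\<in>S. k s * of_bool (P s = u))" if u: "fin u" for u
    proof -
      have "v_inf \<noteq> u" using u v_inf_not_finite by metis
      then show ?thesis using h(2)[OF u] by (simp add: lookup_sum_points)
    qed
    from indep[OF h(1) this s] show ?thesis .
  qed
  show ?thesis
    unfolding place_class_eq
  proof (intro basis_family.intro basis_family_axioms.intro J.comm_group_axioms)
    show "?f s \<in> carrier J" if "s \<in> S" for s using D0[OF that] by simp
  qed (use S gen indep comb in auto)
qed

end

section \<open>Polynomials over a field and over a factorial ring\<close>

lemma bezout_irreducible:
  fixes p b :: "'k::field poly"
  assumes p: "irreducible p" and b: "\<not> p dvd b"
  shows "\<exists>x y. x * p + y * b = 1"
proof -
  let ?P = "\<lambda>m. m \<noteq> 0 \<and> (\<exists>x y. m = x * p + y * b)"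
  have "p = 1 * p + 0 * b" by simp
  then have "?P p" using p unfolding irreducible_def by blast
  define m where "m = arg_min degree ?P"
  have m: "?P m" unfolding m_def by (rule arg_min_natI) fact
  have min: "degree m \<le> degree m'" if "?P m'" for m'
    unfolding m_def using that by (rule arg_min_nat_le)
  obtain x y where xy: "m = x * p + y * b" using m by blast
  have dvd: "m dvd x' * p + y' * b" for x' y'
  proof (rule ccontr)
    let ?z = "x' * p + y' * b"
    assume "\<not> m dvd ?z"
    then have nz: "?z mod m \<noteq> 0" by auto
    have "?z mod m = ?z - ?z div m * (x * p + y * b)"
      unfolding xy[symmetric] by (simp add: minus_div_mult_eq_mod)
    also have "\<dots> = (x' - ?z div m * x) * p + (y' - ?z div m * y) * b"
      by (simp only: algebra_simps)
    finally have "?P (?z mod m)" using nz by blast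
    from min[OF this] show False
      using degree_mod_less[OF conjunct1[OF m], of ?z] nz by auto
  qed
  have "m dvd p" "m dvd b" using dvd[of 1 0] dvd[of 0 1] by simp_all
  then have "is_unit m"
    using p b by (metis irreducibleD' dvd_trans)
  then obtain m' where "m * m' = 1" by (metis dvdE)
  then have "(x * m') * p + (y * m') * b = 1" by (simp add: xy algebra_simps)
  then show ?thesis by blast
qed

lemma exists_irreducible_divisor:
  fixes b :: "'k::field poly"
  assumes "b \<noteq> 0" "\<not> is_unit b" shows "\<exists>p. irreducible p \<and> p dvd b"
proof -
  let ?P = "\<lambda>p. p dvd b \<and> \<not> is_unit p"
  define p where "p = arg_min degree ?P"
  have p: "?P p" unfolding p_def by (rule arg_min_natI[of ?P b]) (use assms in simp)
  have min: "degree p \<le> degree p'" if "?P p'" for p'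
    unfolding p_def using that by (rule arg_min_nat_le)
  have p0: "p \<noteq> 0" using p assms by auto
  have "irreducible p"
  proof (rule irreducibleI)
    fix x y assume xy: "p = x * y"
    show "is_unit x \<or> is_unit y"
    proof (rule ccontr)
      assume "\<not> ?thesis"
      then have "?P x" "\<not> is_unit y" using p xy by (auto dest: dvd_mult_left)
      moreover have "x \<noteq> 0" "y \<noteq> 0" using p0 xy by auto
      moreover from this have "degree p = degree x + degree y" by (simp add: xy degree_mult_eq)
      ultimately show False using min[of x] by (simp add: is_unit_iff_degree)
    qed
  qed (use p p0 in auto)
  with p show ?thesis by blast
qed

lemma top_index:
  fixes u :: "'r::idom poly"
  assumes "\<not> [:r:] dvd u"
  shows "\<exists>i. \<not> r dvd poly.coeff u i \<and> (\<forall>k>i. r dvd poly.coeff u k)"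
proof -
  let ?A = "{i. \<not> r dvd poly.coeff u i}"
  have "?A \<subseteq> {..degree u}"
    by (auto simp: not_le[symmetric]) (metis coeff_eq_0 dvd_0_right not_le)
  then have "finite ?A" by (rule finite_subset) simp
  moreover have "?A \<noteq> {}" using assms by (auto simp: const_poly_dvd_iff)
  ultimately show ?thesis
    using Max_in[of ?A] Max_ge[of ?A] by (intro exI[of _ "Max ?A"]) (metis linorder_not_less mem_Collect_eq)
qed

lemma top_index_mult:
  fixes u w :: "'r::idom poly"
  assumes r: "prime_elem r"
    and u: "\<not> r dvd poly.coeff u i" "\<forall>k>i. r dvd poly.coeff u k"
    and w: "\<not> r dvd poly.coeff w j" "\<forall>k>j. r dvd poly.coeff w k"
  shows "\<not> r dvd poly.coeff (u * w) (i + j)" "\<forall>k>i + j. r dvd poly.coeff (u * w) k"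
proof -
  have "poly.coeff (u * w) (i + j) = poly.coeff u i * poly.coeff w j +
      (\<Sum>k\<in>{..i + j} - {i}. poly.coeff u k * poly.coeff w (i + j - k))"
    unfolding coeff_mult by (subst sum.remove[of _ i]) auto
  moreover have "r dvd (\<Sum>k\<in>{..i + j} - {i}. poly.coeff u k * poly.coeff w (i + j - k))"
  proof (rule dvd_sum)
    fix k assume "k \<in> {..i + j} - {i}"
    then have "i < k \<or> j < i + j - k" by auto
    with u(2) w(2) show "r dvd poly.coeff u k * poly.coeff w (i + j - k)" by auto
  qed
  ultimately show "\<not> r dvd poly.coeff (u * w) (i + j)"
    using u(1) w(1) r by (auto simp: dvd_add_left_iff prime_elem_dvd_mult_iff)
  show "\<forall>k>i + j. r dvd poly.coeff (u * w) k"
  proof (intro allI impI)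
    fix k assume k: "i + j < k"
    show "r dvd poly.coeff (u * w) k"
      unfolding coeff_mult
    proof (rule dvd_sum)
      fix l assume "l \<in> {..k}"
      with k have "i < l \<or> j < k - l" by auto
      with u(2) w(2) show "r dvd poly.coeff u l * poly.coeff w (k - l)" by auto
    qed
  qed
qed

text \<open>
  Reduced modulo the prime \<open>r\<close>, the two terms of \<open>u\<^sup>2 - w\<^sup>2 F\<close> have degrees of different parity. The
  degree of a reduction is the position of the last coefficient that \<open>r\<close> does not divide.
\<close>

lemma prime_dvd_norm:
  fixes u w F :: "'r::idom poly"
  assumes r: "prime_elem r" and F: "odd (degree F)" "\<not> r dvd lead_coeff F"
    and dvd: "[:r:] dvd u * u - w * w * F"
  shows "[:r:] dvd u \<and> [:r:] dvd w"
proof -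
  have dvd_diff: "r dvd poly.coeff (u * u) k - poly.coeff (w * w * F) k" for k
    using dvd by (simp add: const_poly_dvd_iff)
  have F': "\<forall>k>degree F. r dvd poly.coeff F k" by (simp add: coeff_eq_0)
  have w: "[:r:] dvd w"
  proof (rule ccontr)
    assume "\<not> [:r:] dvd w"
    then obtain j where j: "\<not> r dvd poly.coeff w j" "\<forall>k>j. r dvd poly.coeff w k"
      using top_index by blast
    note ww = top_index_mult[OF r j j]
    note wwF = top_index_mult[OF r ww F(2) F']
    have "\<not> [:r:] dvd u"
    proof
      assume "[:r:] dvd u"
      then have "[:r:] dvd w * w * F" using dvd
        by (metis dvd_diff_right_iff dvd_mult2)
      with wwF(1) show False by (simp add: const_poly_dvd_iff)
    qed
    then obtain i where i: "\<not> r dvd poly.coeff u i" "\<forall>k>i. r dvd poly.coeff u k"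
      using top_index by blast
    note uu = top_index_mult[OF r i i]
    have "i + i \<noteq> j + j + degree F" using F(1) by presburger
    then consider "i + i < j + j + degree F" | "j + j + degree F < i + i" by linarith
    then show False
    proof cases
      case 1
      then show False using uu(2) wwF(1) dvd_diff by (metis dvd_diff_right_iff)
    next
      case 2
      then show False using uu(1) wwF(2) dvd_diff by (metis dvd_diff_left_iff)
    qed
  qed
  then have "[:r:] dvd u * u" using dvd by (metis dvd_diff_left_iff dvd_mult2)
  moreover have "prime_elem [:r:]" using r by (simp add: prime_elem_const_poly_iff)
  ultimately show ?thesis using w by (simp add: prime_elem_dvd_mult_iff)
qed

lemma fract_poly_denominator:
  fixes a :: "'r::{factorial_semiring,semiring_Gcd,ring_gcd,idom_divide,semiring_gcd_mult_normalize} fract poly"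
  shows "\<exists>d a'. d \<noteq> 0 \<and> Polynomial.smult (to_fract d) a = map_poly to_fract a'"
proof -
  obtain x a' where a: "a = Polynomial.smult x (map_poly to_fract a')" by (rule content_decompose_fract)
  obtain n d where x: "x = to_fract n / to_fract d" "d \<noteq> 0" by (metis Fract_cases Fract_conv_to_fract)
  then have "Polynomial.smult (to_fract d) a = map_poly to_fract (Polynomial.smult n a')"
    by (simp add: a)
  with x(2) show ?thesis by blast
qed

section \<open>Rational constants in rational functions\<close>

lemma unit_const:
  fixes q :: "rat poly"
  assumes "is_unit q" obtains a where "q = [:a:]" "a \<noteq> 0"
proof -
  obtain a where a: "q = [:a:]" using assms unfolding is_unit_poly_iff by blast
  moreover have "a \<noteq> 0" using a assms by auto
  ultimately show ?thesis by (rule that)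
qed

lemma ring_morphism_rat_const: "ring_morphism rat_const"
  by unfold_locales (simp_all add: rat_const_def to_fract_add[symmetric] to_fract_mult[symmetric]
      one_pCons[symmetric] del: to_fract_add to_fract_mult)

lemma rat_const_eq_0_iff [simp]: "rat_const a = 0 \<longleftrightarrow> a = 0"
  by (simp add: rat_const_def)

lemma rat_const_0 [simp]: "rat_const 0 = 0" by simp

lemma degree_map_rat_const [simp]: "degree (map_poly rat_const p) = degree p"
  by (rule degree_map_poly) simp

lemma coeff_map_rat_const [simp]: "poly.coeff (map_poly rat_const p) i = rat_const (poly.coeff p i)"
  by (rule coeff_map_poly) simp

lemma map_rat_const_eq_0_iff [simp]: "map_poly rat_const p = 0 \<longleftrightarrow> p = 0"
  by (simp add: map_poly_eq_0_iff)

interpretation rcp: ring_morphism "map_poly rat_const"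
  using ring_morphism.ring_morphism_map_poly[OF ring_morphism_rat_const] .

lemma map_poly_const_comp:
  "map_poly rat_const p = map_poly to_fract (map_poly (\<lambda>a. [:a:]) p)"
  by (intro poly_eqI) (simp add: coeff_map_poly rat_const_def)

text \<open>A factorization over \<open>\<rat>(T)\<close> gives one over \<open>\<rat>[T]\<close> by the lemma of Gauss; there, setting
  \<open>T = 0\<close> preserves the degrees, as the product of the leading coefficients is constant.\<close>

lemma irreducible_map_rat_const:
  fixes p :: "rat poly"
  assumes "irreducible p" shows "irreducible (map_poly rat_const p)"
proof -
  let ?q = "map_poly (\<lambda>a. [:a:]) p :: rat poly poly"
  let ?at0 = "\<lambda>a::rat poly. poly a 0"
  interpret at0: ring_morphism ?at0 by unfold_locales auto
  interpret at0p: ring_morphism "map_poly ?at0" by (rule at0.ring_morphism_map_poly)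
  have p0: "p \<noteq> 0" "\<not> is_unit p" using assms by (auto simp: irreducible_def)
  then have dp: "degree p \<noteq> 0" by (simp add: is_unit_iff_degree)
  have dq: "degree ?q = degree p" by (rule degree_map_poly) simp
  have at0_q: "map_poly ?at0 ?q = p"
    by (intro poly_eqI) (simp add: coeff_map_poly)
  have lc: "is_unit (lead_coeff ?q)"
    using p0 by (simp add: dq coeff_map_poly is_unit_const_poly_iff dvd_field_iff)
  \<comment> \<open>The lemma of Gauss reduces the claim to \<open>\<rat>[T]\<close>.\<close>
  have "irreducible ?q"
  proof (rule irreducibleI)
    show "?q \<noteq> 0" using dq dp by auto
    show "\<not> is_unit ?q"
      using dq dp by (metis is_unit_polyE degree_pCons_0)
    fix x y assume xy: "?q = x * y"
    have unit: "is_unit (lead_coeff x)" "is_unit (lead_coeff y)"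
      using lc unfolding xy lead_coeff_mult by (auto dest: dvd_mult_left dvd_mult_right)
    have deg: "degree (map_poly ?at0 z) = degree z"
      if unit_z: "is_unit (lead_coeff z)" for z :: "rat poly poly"
    proof -
      obtain a where "lead_coeff z = [:a:]" "is_unit a"
        using unit_z unfolding is_unit_poly_iff by blast
      then have "lead_coeff z = [:a:]" "a \<noteq> 0" by auto
      then have "poly.coeff (map_poly ?at0 z) (degree z) \<noteq> 0"
        by (simp add: coeff_map_poly)
      then show ?thesis
        by (intro antisym degree_le le_degree) (auto simp: coeff_map_poly coeff_eq_0)
    qed
    have "p = map_poly ?at0 x * map_poly ?at0 y"
      using at0_q by (simp add: xy at0p.h_mult)
    with assms have "is_unit (map_poly ?at0 x) \<or> is_unit (map_poly ?at0 y)"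
      by (rule irreducibleD)
    then have "degree x = 0 \<or> degree y = 0"
      using deg unit by (metis is_unit_polyE degree_pCons_0)
    then show "is_unit x \<or> is_unit y"
      using unit by (metis degree_eq_zeroE is_unit_const_poly_iff lead_coeff_pCons(2) pCons_eq_0_iff coeff_pCons_0 degree_pCons_0)
  qed
  then have "irreducible (map_poly to_fract ?q)"
    using nonconst_poly_irreducible_iff[of ?q] dq dp by simp
  then show ?thesis by (simp add: map_poly_const_comp)
qed

lemma map_rat_const_dvd_iff:
  assumes p: "irreducible p" and b: "map_poly rat_const p dvd map_poly rat_const b"
  shows "p dvd b"
proof (rule ccontr)
  assume "\<not> p dvd b"
  then obtain x y where "x * p + y * b = 1" using bezout_irreducible[OF p] by blast
  then have "map_poly rat_const x * map_poly rat_const p + map_poly rat_const y * map_poly rat_const b = 1"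
    by (metis rcp.h_1 rcp.h_add rcp.h_mult)
  then have "map_poly rat_const p dvd 1" using b by (metis dvd_add dvd_mult dvd_refl)
  with irreducible_map_rat_const[OF p] show False by (simp add: irreducible_def)
qed

lemma degree_family: "0 < degree f \<Longrightarrow> degree (family f) = degree f"
proof -
  assume f: "0 < degree f"
  have "T_var \<noteq> 0" by (simp add: T_var_def)
  then have "degree ([:T_var:] * map_poly rat_const f) = degree f" by simp
  with f show ?thesis unfolding family_def by (subst degree_add_eq_left) auto
qed

text \<open>A double factor of \<open>f T + 1\<close> would divide the derivative \<open>f' T\<close>, so it would have an
  irreducible factor \<open>p\<close> with rational coefficients; then \<open>f\<close> would be congruent to \<open>- 1 / T\<close> modulo \<open>p\<close>.\<close>

lemma squarefree_family:
  assumes f: "0 < degree f" and q: "q * q dvd family f"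
  shows "is_unit q"
proof (rule ccontr)
  assume "\<not> is_unit q"
  moreover have q0: "q \<noteq> 0"
  proof
    assume "q = 0"
    then have "family f = 0" using q by simp
    with degree_family[OF f] f show False by simp
  qed
  ultimately obtain r where r: "irreducible r" "r dvd q"
    using exists_irreducible_divisor by blast
  have prime_r: "prime_elem r" using r(1) by (rule field_poly_irreducible_imp_prime)
  from q obtain k where k: "family f = q * q * k" by auto
  then have "pderiv (family f) = q * (pderiv q * k + pderiv q * k + q * pderiv k)"
    by (simp add: pderiv_mult algebra_simps)
  moreover have "pderiv (family f) = [:T_var:] * map_poly rat_const (pderiv f)"
  proof -
    have "pderiv (map_poly rat_const f) = map_poly rat_const (pderiv f)"
    proof (rule poly_eqI)
      interpret rc: ring_morphism rat_const by (rule ring_morphism_rat_const)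
      have nat: "rat_const (of_nat n) = of_nat n" for n
        by (induct n) (auto simp: rc.h_simps)
      show "poly.coeff (pderiv (map_poly rat_const f)) n = poly.coeff (map_poly rat_const (pderiv f)) n" for n
        by (simp add: coeff_pderiv rc.h_mult nat[symmetric] rc.h_add del: of_nat_Suc)
    qed
    then show ?thesis by (simp add: family_def pderiv_add pderiv_smult)
  qed
  ultimately have "r dvd [:T_var:] * map_poly rat_const (pderiv f)"
    using r(2) by (metis dvd_mult2)
  moreover have "T_var \<noteq> 0" by (simp add: T_var_def)
  ultimately have r_dvd: "r dvd map_poly rat_const (pderiv f)" by (simp add: dvd_smult_iff)
  have "\<exists>p. irreducible p \<and> r dvd map_poly rat_const p" if "b \<noteq> 0" "r dvd map_poly rat_const b" for b
    using that
  proof (induct b rule: prime_divisors_induct)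
    case zero
    then show ?case by simp
  next
    case (unit b)
    then obtain b' where "b * b' = 1" by (metis dvdE)
    then have "map_poly rat_const b * map_poly rat_const b' = 1" by (metis rcp.h_1 rcp.h_mult)
    then have "r dvd 1" using unit(3) by (metis dvd_mult2 )
    with r(1) show ?case by (simp add: irreducible_def)
  next
    case (factor p b)
    then show ?case
      using prime_r by (auto simp: rcp.h_mult prime_elem_dvd_mult_iff prime_imp_prime_elem
          intro: prime_elem_imp_irreducible)
  qed
  moreover have "pderiv f \<noteq> 0" using f by (simp add: pderiv_eq_0_iff)
  ultimately obtain p where p: "irreducible p" "r dvd map_poly rat_const p" using r_dvd by blast
  have "map_poly rat_const p dvd r"
    using p(2) irreducible_map_rat_const[OF p(1)] r(1)
    by (metis irreducibleD' irreducible_def)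
  then have pF: "map_poly rat_const p dvd family f"
    using r(2) k by (metis dvd_mult2 dvd_trans dvd_triv_left mult.assoc)
  define s where "s = [:T_var:] * map_poly rat_const (f mod p) + 1"
  have "family f = map_poly rat_const p * ([:T_var:] * map_poly rat_const (f div p)) + s"
  proof -
    have "map_poly rat_const f = map_poly rat_const (f div p) * map_poly rat_const p + map_poly rat_const (f mod p)"
      by (metis div_mult_mod_eq rcp.h_add rcp.h_mult)
    then show ?thesis unfolding family_def s_def by (simp add: algebra_simps smult_add_right)
  qed
  with pF have ps: "map_poly rat_const p dvd s"
    by (metis dvd_add_right_iff dvd_triv_left)
  have p0: "p \<noteq> 0" "0 < degree p"
    using p(1) by (auto simp: irreducible_def is_unit_iff_degree)
  have "degree (f mod p) < degree p"
    using degree_mod_less[OF p0(1)] p0(2) by (metis degree_0)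
  then have "degree s < degree (map_poly rat_const p)"
    unfolding s_def using p0(2) by (intro degree_add_less) auto
  then have "s = 0" using ps by (metis dvd_imp_degree_le linorder_not_less)
  then have "poly.coeff s 0 = 0" by simp
  then have "to_fract [:0, 1:] * to_fract [:poly.coeff (f mod p) 0:] + 1 = 0"
    by (simp add: s_def T_var_def rat_const_def)
  then have "to_fract ([:0, 1:] * [:poly.coeff (f mod p) 0:] + 1) = 0"
    by (simp only: to_fract_add to_fract_mult to_fract_1)
  then show False unfolding to_fract_eq_0_iff by (simp add: one_pCons)
qed

section \<open>The rational function field in two variables as a hyperelliptic model\<close>

text \<open>Polynomials in \<open>x, y\<close> have type \<open>rat poly poly\<close>, with \<open>y\<close> as the outer variable.\<close>

type_synonym ratfun2 = "rat poly poly fract"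

definition px :: "rat poly \<Rightarrow> ratfun2" where "px p = to_fract [:p:]"
definition cM :: "rat \<Rightarrow> ratfun2" where "cM a = px [:a:]"
definition xM :: ratfun2 where "xM = px [:0, 1:]"
definition yM :: ratfun2 where "yM = to_fract [:0, 1:]"
definition tM :: "rat poly \<Rightarrow> ratfun2" where "tM f = (yM * yM - 1) / px f"

interpretation px: injective_morphism px
  by unfold_locales (simp_all add: px_def to_fract_add[symmetric] to_fract_mult[symmetric]
      one_pCons[symmetric] del: to_fract_add to_fract_mult)

interpretation cM: injective_morphism cM
  by unfold_locales (simp_all add: cM_def px.h_simps[symmetric] one_pCons[symmetric])

lemma px_eq_ev: "px p = ev cM xM p"
proof (induct p)
  case (pCons a p)
  have "px (pCons a p) = px ([:a:] + [:0, 1:] * p)" by simp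
  also have "\<dots> = cM a + xM * px p" by (simp only: px.h_simps cM_def xM_def)
  finally show ?case using pCons by simp
qed simp

lemma to_fract_eq_ev: "to_fract g = ev px yM g"
proof (induct g)
  case (pCons p g)
  have "to_fract (pCons p g) = to_fract ([:p:] + [:0, 1:] * g)" by simp
  also have "\<dots> = px p + yM * to_fract g" by (simp only: to_fract_add to_fract_mult px_def yM_def)
  finally show ?case using pCons by simp
qed simp

definition inner_const :: "rat poly \<Rightarrow> rat poly poly" where
  "inner_const = map_poly (\<lambda>a. [:a:])"

interpretation ic: ring_morphism inner_const
proof -
  interpret ring_morphism "\<lambda>a::rat. [:a:]" by unfold_locales (simp_all add: one_pCons)
  show "ring_morphism inner_const" unfolding inner_const_def by (rule ring_morphism_map_poly)
qed

lemma coeff_inner_const: "poly.coeff (inner_const p) i = [:poly.coeff p i:]"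
  by (simp add: inner_const_def coeff_map_poly)

lemma inner_const_eq_0_iff [simp]: "inner_const p = 0 \<longleftrightarrow> p = 0"
  by (simp add: inner_const_def map_poly_eq_0_iff)

text \<open>The exchange of the two variables.\<close>

definition swap :: "rat poly poly \<Rightarrow> rat poly poly" where
  "swap = ev inner_const [:[:0, 1:]:]"

interpretation swap: ring_morphism swap
  unfolding swap_def by (rule ic.ring_morphism_ev)

lemma swap_pCons: "swap (pCons a g) = inner_const a + [:[:0, 1:]:] * swap g"
  by (simp add: swap_def)

lemma coeff_swap: "poly.coeff (poly.coeff (swap g) j) i = poly.coeff (poly.coeff g i) j"
proof (induct g arbitrary: i)
  case (pCons a g)
  show ?case
    using pCons(2) by (cases i) (simp_all add: swap_pCons coeff_inner_const)
qed simp

lemma swap_swap [simp]: "swap (swap g) = g"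
  by (intro poly_eqI) (simp add: coeff_swap)

lemma swap_eq_0_iff [simp]: "swap g = 0 \<longleftrightarrow> g = 0"
  by (metis swap_swap swap.h_0)

locale rational_family =
  fixes f :: "rat poly"
  assumes odd_f: "odd (degree f)"
begin

lemma f_nonzero: "f \<noteq> 0" and degree_f: "0 < degree f"
  using odd_f by (auto intro: Nat.gr0I)

abbreviation "tt \<equiv> tM f"

lemma tt_px: "tt * px f = yM * yM - 1"
  using f_nonzero by (simp add: tM_def)

text \<open>The outer variable is \<open>T\<close> in arguments of \<open>evXT\<close>, but \<open>x\<close> in arguments of \<open>evTX\<close> below.\<close>

definition evXT :: "rat poly poly \<Rightarrow> ratfun2" where "evXT = ev px tt"

definition k0 :: "rat poly \<Rightarrow> ratfun2" where "k0 = ev cM tt"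

sublocale evXT: ring_morphism evXT
  unfolding evXT_def by (rule px.ring_morphism_ev)

lemma evXT_pCons [simp]: "evXT (pCons p u) = px p + tt * evXT u"
  by (simp add: evXT_def)

text \<open>Clearing the denominator \<open>f\<^sup>d\<close> of a polynomial of degree \<open>d\<close> in \<open>T\<close> leaves a polynomial of
  degree \<open>2 d\<close> in \<open>y\<close>. So \<open>T\<close> is transcendental over \<open>\<rat>(x)\<close>.\<close>

lemma evXT_clear:
  "u \<noteq> 0 \<Longrightarrow> \<exists>g. px f ^ degree u * evXT u = to_fract g \<and> g \<noteq> 0 \<and> degree g = 2 * degree u"
proof (induct u)
  case (pCons p u)
  show ?case
  proof (cases "u = 0")
    case True
    with pCons(1) show ?thesis by (intro exI[of _ "[:p:]"]) (simp add: px_def)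
  next
    case False
    then obtain g where g: "px f ^ degree u * evXT u = to_fract g" "g \<noteq> 0" "degree g = 2 * degree u"
      using pCons by blast
    let ?g = "[:f ^ degree (pCons p u) * p:] + [:-1, 0, 1:] * g"
    have y2: "yM * yM - 1 = to_fract [:-1, 0, 1:]"
    proof -
      have "yM * yM - 1 = to_fract ([:0, 1:] * [:0, 1:] - 1)"
        by (simp only: yM_def to_fract_mult to_fract_diff to_fract_1)
      then show ?thesis by (simp add: one_pCons)
    qed
    have "px f ^ degree (pCons p u) * evXT (pCons p u)
        = px (f ^ degree (pCons p u) * p) + (tt * px f) * (px f ^ degree u * evXT u)"
      using False by (simp add: px.h_simps algebra_simps)
    also have "\<dots> = px (f ^ degree (pCons p u) * p) + to_fract [:-1, 0, 1:] * to_fract g"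
      by (simp only: tt_px g(1) y2)
    also have "\<dots> = to_fract ?g"
      by (simp only: px_def to_fract_add to_fract_mult)
    finally have eq: "px f ^ degree (pCons p u) * evXT (pCons p u) = to_fract ?g" .
    have "degree ([:-1, 0, 1:] * g) = 2 + degree g"
      using g by (subst degree_mult_eq) auto
    then have "degree ?g = 2 * degree (pCons p u)"
      using g False by (subst degree_add_eq_right) auto
    moreover from this have "?g \<noteq> 0" using False by (metis degree_0 degree_pCons_eq mult_is_0 old.nat.distinct(2) zero_neq_numeral)
    ultimately show ?thesis using eq by blast
  qed
qed simp

sublocale evXT: injective_morphism evXT
proof
  fix u assume 0: "evXT u = 0"
  show "u = 0"
  proof (rule ccontr)
    assume "u \<noteq> 0"
    from evXT_clear[OF this] 0 show False by auto
  qed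
qed

lemma k0_eq: "k0 p = evXT (inner_const p)"
proof -
  have "ring_morphism (\<lambda>a::rat. [:a:])" by unfold_locales (simp_all add: one_pCons)
  then have "evXT (inner_const p) = ev (\<lambda>a. px [:a:]) tt p"
    unfolding evXT_def inner_const_def by (rule ev_map_poly[OF px.ring_morphism_axioms])
  then show ?thesis by (simp add: k0_def cM_def[abs_def])
qed

sublocale k0: injective_morphism k0
  by unfold_locales (simp_all add: k0_eq ic.h_simps evXT.h_simps)

definition kap :: "ratfun \<Rightarrow> ratfun2" where "kap = fract_lift k0"

sublocale kap: injective_morphism kap
  unfolding kap_def by (rule k0.injective_morphism_fract_lift)

lemma kap_to_fract [simp]: "kap (to_fract p) = k0 p"
  by (simp add: kap_def)

lemma kap_rat_const [simp]: "kap (rat_const a) = cM a"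
  by (simp add: rat_const_def k0_def)

lemma kap_T_var [simp]: "kap T_var = tt"
  by (simp add: T_var_def k0_def)

definition evTX :: "rat poly poly \<Rightarrow> ratfun2" where "evTX = ev k0 xM"

sublocale evTX: ring_morphism evTX
  unfolding evTX_def by (rule k0.ring_morphism_ev)

lemma evXT_const [simp]: "evXT [:p:] = px p"
  by simp

lemma evTX_eq: "evTX g = evXT (swap g)"
proof (induct g)
  case (pCons a g)
  have "evTX (pCons a g) = k0 a + xM * evTX g" by (simp add: evTX_def)
  also have "\<dots> = evXT (inner_const a + [:[:0, 1:]:] * swap g)"
    by (simp only: evXT.h_simps k0_eq evXT_const xM_def pCons(2))
  finally show ?case by (simp only: swap_pCons)
qed simp

lemma evXT_eq: "evXT g = evTX (swap g)"
  by (simp add: evTX_eq)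

lemma evTX_const [simp]: "evTX [:c:] = k0 c"
  by (simp add: evTX_def)

abbreviation "eK \<equiv> ev kap xM"

lemma eK_fract: "eK (map_poly to_fract g) = evTX g"
proof -
  have "eK (map_poly to_fract g) = ev (\<lambda>a. kap (to_fract a)) xM g"
    by (rule ev_map_poly[OF kap.ring_morphism_axioms ring_morphism_to_fract])
  then show ?thesis by (simp add: evTX_def)
qed

lemma eK_rat_const: "eK (map_poly rat_const p) = px p"
proof -
  have "eK (map_poly rat_const p) = ev (\<lambda>a. kap (rat_const a)) xM p"
    by (rule ev_map_poly[OF kap.ring_morphism_axioms ring_morphism_rat_const])
  then show ?thesis by (simp add: px_eq_ev)
qed

lemma eK_nonzero: "eK u = 0 \<Longrightarrow> u = 0"
proof (rule ccontr)
  assume 0: "eK u = 0" "u \<noteq> 0"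
  obtain a u' where u: "u = Polynomial.smult a (map_poly to_fract u')" by (rule content_decompose_fract)
  have "kap a * evTX u' = 0" using 0(1) by (simp add: u kap.ev_smult eK_fract)
  with u 0(2) show False by (auto simp: evTX_eq)
qed

text \<open>The polynomial \<open>f T + 1\<close> over \<open>\<rat>[T]\<close>.\<close>

definition fam :: "rat poly poly" where
  "fam = [:[:0, 1:]:] * inner_const f + 1"

lemma family_eq: "family f = map_poly to_fract fam"
proof -
  have "map_poly to_fract (inner_const f) = map_poly rat_const f"
    by (simp add: map_poly_const_comp inner_const_def)
  then have "map_poly to_fract ([:[:0, 1:]:] * inner_const f) = [:T_var:] * map_poly rat_const f"
    by (simp only: fract_poly_mult) (simp add: T_var_def map_poly_pCons)
  then show ?thesis unfolding family_def fam_def fract_poly_add fract_poly_1 by simp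
qed

lemma eK_family: "eK (family f) = yM * yM"
proof -
  interpret eK: ring_morphism eK by (rule kap.ring_morphism_ev)
  have "eK (family f) = eK [:T_var:] * px f + 1"
    by (simp only: family_def eK.h_simps eK.h_1 eK_rat_const)
  then show ?thesis using tt_px by simp
qed

lemma to_fract_repr: "\<exists>u w. to_fract g = evXT u + evXT w * yM"
proof (induct g)
  case 0
  show ?case by (intro exI[of _ 0]) simp
next
  case (pCons p g)
  then obtain u w where uw: "to_fract g = evXT u + evXT w * yM" by blast
  have y2: "yM * yM = evXT [:1, f:]" using tt_px by (simp add: algebra_simps)
  have "to_fract (pCons p g) = px p + yM * to_fract g"
    by (simp add: to_fract_eq_ev)
  also have "\<dots> = evXT ([:p:] + w * [:1, f:]) + evXT u * yM"
    unfolding uw evXT.h_add evXT.h_mult y2[symmetric] by (simp add: algebra_simps)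
  finally show ?case by blast
qed

text \<open>
  Numerator and denominator of a rational function in \<open>x, y\<close> are of the form \<open>u + w y\<close> because
  \<open>y\<^sup>2 = f T + 1\<close>; multiplication by the conjugate makes the denominator a polynomial in \<open>x\<close>.
\<close>

lemma elt_generated_fam: "\<exists>u w d. d \<noteq> 0 \<and> g = (eK u + eK w * yM) / eK d"
proof -
  interpret eK: injective_morphism eK
    by (simp add: injective_morphism_def injective_morphism_axioms_def kap.ring_morphism_ev eK_nonzero)
  have repr: "\<exists>u w. to_fract a = eK u + eK w * yM" for a
  proof -
    obtain u w where "to_fract a = evXT u + evXT w * yM" using to_fract_repr by blast
    then have "to_fract a = eK (map_poly to_fract (swap u)) + eK (map_poly to_fract (swap w)) * yM"
      by (simp add: eK_fract evXT_eq)
    then show ?thesis by blast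
  qed
  obtain a b where ab: "g = to_fract a / to_fract b" "b \<noteq> 0" by (metis Fract_cases Fract_conv_to_fract)
  obtain u w where u: "to_fract a = eK u + eK w * yM" using repr by blast
  obtain u' w' where u': "to_fract b = eK u' + eK w' * yM" using repr by blast
  define d where "d = u' * u' - w' * w' * family f"
  have conj: "to_fract b * (eK u' - eK w' * yM) = eK d"
    unfolding u' d_def eK.h_simps eK_family by (simp add: algebra_simps)
  have "d \<noteq> 0"
  proof
    assume d: "d = 0"
    have "w' = 0"
    proof (rule ccontr)
      assume "w' \<noteq> 0"
      then have "degree (w' * w' * family f) = 2 * degree w' + degree f"
        using degree_f degree_family[OF degree_f]
        by (subst degree_mult_eq) (auto simp: degree_mult_eq)
      moreover have "u' * u' = w' * w' * family f" using d by (simp add: d_def)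
      moreover have "degree (u' * u') = 2 * degree u'"
        by (cases "u' = 0") (auto simp: degree_mult_eq)
      ultimately show False using odd_f by presburger
    qed
    with d u' ab(2) show False by (simp add: d_def)
  qed
  moreover have "g = (eK (u * u' - w * w' * family f) + eK (w * u' - u * w') * yM) / eK d"
  proof -
    have "g = to_fract a * (eK u' - eK w' * yM) / eK d"
    proof -
      have "eK u' - eK w' * yM \<noteq> 0" using conj \<open>d \<noteq> 0\<close> by auto
      then show ?thesis unfolding conj[symmetric] ab(1) by simp
    qed
    also have "to_fract a * (eK u' - eK w' * yM) =
        eK (u * u' - w * w' * family f) + eK (w * u' - u * w') * yM"
      unfolding u eK.h_simps eK_family by (simp add: algebra_simps)
    finally show ?thesis .
  qed
  ultimately show ?thesis by blast
qed

sublocale hyperelliptic kap xM yM "family f"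
proof
  show "(2::ratfun) \<noteq> 0"
  proof
    assume "(2::ratfun) = 0"
    moreover have "(2::ratfun) = to_fract 2" by (metis one_add_one to_fract_1 to_fract_add)
    ultimately have "(2::rat poly) = 0" by simp
    then show False by simp
  qed
  show "yM * yM = eK (family f)" by (simp add: eK_family)
  show "odd (degree (family f))" using odd_f degree_f by (simp add: degree_family)
  show "\<And>q. q * q dvd family f \<Longrightarrow> is_unit q" using squarefree_family degree_f by blast
qed (use eK_nonzero elt_generated_fam in auto)

end

section \<open>Valuations of the rational function field in two variables\<close>

text \<open>The order of vanishing along the plane curve \<open>h = 0\<close>.\<close>

definition ordv :: "rat poly poly \<Rightarrow> ratfun2 \<Rightarrow> int" where
  "ordv h z = (if z = 0 then 0 else
     int (multiplicity h (fst (quot_of_fract z))) - int (multiplicity h (snd (quot_of_fract z))))"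

lemma ordv_fraction:
  assumes h: "prime_elem h" and ab: "a \<noteq> 0" "b \<noteq> 0"
  shows "ordv h (to_fract a / to_fract b) = int (multiplicity h a) - int (multiplicity h b)"
proof -
  define z where "z = to_fract a / to_fract b"
  define a' b' where "a' = fst (quot_of_fract z)" and "b' = snd (quot_of_fract z)"
  have z0: "z \<noteq> 0" using ab by (simp add: z_def)
  have z: "z = to_fract a' / to_fract b'" "b' \<noteq> 0"
    unfolding a'_def b'_def by (simp_all add: Fract_conv_to_fract[symmetric])
  then have "a' \<noteq> 0" using z0 by auto
  have "to_fract (a' * b) = to_fract (a * b')"
    using z ab unfolding z_def by (simp add: frac_eq_eq)
  then have "a' * b = a * b'" by (simp only: to_fract_eq_iff)
  then have "multiplicity h (a' * b) = multiplicity h (a * b')" by simp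
  then have "multiplicity h a' + multiplicity h b = multiplicity h a + multiplicity h b'"
    using h ab z(2) \<open>a' \<noteq> 0\<close> by (simp add: prime_elem_multiplicity_mult_distrib)
  then show ?thesis
    using z0 unfolding ordv_def z_def[symmetric] a'_def[symmetric] b'_def[symmetric] by simp
qed

lemma ordv_to_fract: "prime_elem h \<Longrightarrow> a \<noteq> 0 \<Longrightarrow> ordv h (to_fract a) = int (multiplicity h a)"
  using ordv_fraction[of h a 1] by simp

lemma ordv_mult:
  assumes h: "prime_elem h" and z: "z \<noteq> 0" "w \<noteq> 0" shows "ordv h (z * w) = ordv h z + ordv h w"
proof -
  obtain a b where a: "z = to_fract a / to_fract b" "b \<noteq> 0" by (metis Fract_cases Fract_conv_to_fract)
  obtain a' b' where a': "w = to_fract a' / to_fract b'" "b' \<noteq> 0" by (metis Fract_cases Fract_conv_to_fract)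
  have "a \<noteq> 0" "a' \<noteq> 0" using a a' z by auto
  moreover have "z * w = to_fract (a * a') / to_fract (b * b')" using a a' by simp
  ultimately have "ordv h (z * w) = int (multiplicity h (a * a')) - int (multiplicity h (b * b'))"
    using a a' ordv_fraction[OF h, of "a * a'" "b * b'"] by simp
  moreover have "ordv h z = int (multiplicity h a) - int (multiplicity h b)"
    using a \<open>a \<noteq> 0\<close> ordv_fraction[OF h] by simp
  moreover have "ordv h w = int (multiplicity h a') - int (multiplicity h b')"
    using a' \<open>a' \<noteq> 0\<close> ordv_fraction[OF h] by simp
  ultimately show ?thesis
    using a a' h \<open>a \<noteq> 0\<close> \<open>a' \<noteq> 0\<close> by (simp add: prime_elem_multiplicity_mult_distrib)
qed

lemma ordv_add:
  assumes h: "prime_elem h" and z: "z \<noteq> 0" "w \<noteq> 0" "z + w \<noteq> 0"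
  shows "min (ordv h z) (ordv h w) \<le> ordv h (z + w)"
proof -
  obtain a b where a: "z = to_fract a / to_fract b" "b \<noteq> 0" by (metis Fract_cases Fract_conv_to_fract)
  obtain a' b' where a': "w = to_fract a' / to_fract b'" "b' \<noteq> 0" by (metis Fract_cases Fract_conv_to_fract)
  have nz: "a \<noteq> 0" "a' \<noteq> 0" using a a' z by auto
  have sum: "z + w = to_fract (a * b' + a' * b) / to_fract (b * b')"
    using a a' by (simp add: add_frac_eq)
  have nz': "a * b' + a' * b \<noteq> 0"
  proof
    assume "a * b' + a' * b = 0"
    then have "z + w = 0" unfolding sum by (simp only: to_fract_0 div_0)
    with z(3) show False by simp
  qed
  define n where "n = min (multiplicity h (a * b')) (multiplicity h (a' * b))"
  have "h ^ n dvd a * b'" "h ^ n dvd a' * b"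
    unfolding n_def by (auto intro: multiplicity_dvd')
  then have "h ^ n dvd a * b' + a' * b" by (rule dvd_add)
  then have "n \<le> multiplicity h (a * b' + a' * b)"
    using h nz' by (intro multiplicity_geI) (auto simp: prime_elem_def)
  then have "min (multiplicity h a + multiplicity h b') (multiplicity h a' + multiplicity h b)
     \<le> multiplicity h (a * b' + a' * b)"
    unfolding n_def using h nz a a' by (simp add: prime_elem_multiplicity_mult_distrib)
  moreover have "ordv h (z + w) = int (multiplicity h (a * b' + a' * b)) - int (multiplicity h (b * b'))"
    unfolding sum using a(2) a'(2) nz' by (intro ordv_fraction h) auto
  moreover have "ordv h z = int (multiplicity h a) - int (multiplicity h b)"
    unfolding a(1) by (intro ordv_fraction h nz a)
  moreover have "ordv h w = int (multiplicity h a') - int (multiplicity h b')"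
    unfolding a'(1) by (intro ordv_fraction h nz a')
  ultimately show ?thesis
    using a(2) a'(2) h by (simp add: prime_elem_multiplicity_mult_distrib)
qed

lemma discrete_valuation_ordv:
  assumes h: "prime_elem h" and k: "\<And>a. a \<noteq> 0 \<Longrightarrow> ordv h (k a) = 0"
  shows "discrete_valuation k (ordv h)"
proof
  have "ordv h (to_fract h) = 1"
    using h by (simp add: ordv_to_fract prime_elem_def)
  then show "\<exists>g. g \<noteq> 0 \<and> ordv h g = 1" using h by (metis to_fract_eq_0_iff prime_elem_def)
qed (use h k in \<open>simp_all add: ordv_mult ordv_add ordv_def[of h 0]\<close>)

lemma to_fract_vge_ordv:
  assumes h: "prime_elem h" shows "to_fract a \<in> vge (ordv h) 1 \<longleftrightarrow> h dvd a"
proof (cases "a = 0")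
  case False
  then have "1 \<le> ordv h (to_fract a) \<longleftrightarrow> 0 < multiplicity h a"
    using h by (simp add: ordv_to_fract Suc_le_eq)
  also have "\<dots> \<longleftrightarrow> h dvd a"
    using False h by (subst multiplicity_gt_zero_iff) (auto simp: prime_elem_def)
  finally show ?thesis using False by (simp add: vge_def)
qed simp

lemma to_fract_power: "to_fract (a ^ n) = to_fract a ^ n"
  by (induct n) simp_all

context rational_family
begin

abbreviation fpl :: "(ratfun2 \<Rightarrow> int) \<Rightarrow> bool" where
  "fpl \<equiv> finite_place kap xM yM (family f)"

lemma finite_place_to_fract_integral:
  assumes "fpl v" shows "to_fract g \<in> vge v 0"
proof -
  interpret finite_place kap xM yM "family f" v by fact
  have "px p \<in> vge v 0" for p using e_integral[of "map_poly rat_const p"] by (simp only: eK_rat_const)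
  then show ?thesis
    unfolding to_fract_eq_ev using Y_integral by (intro ev_in_vge px.ring_morphism_axioms)
qed

lemma tt_nonzero: "tt \<noteq> 0"
proof -
  have "evXT [:0, 1:] \<noteq> 0" by (simp only: evXT.h_eq_0_iff) simp
  then show ?thesis by simp
qed

lemma kap_valuation: "discrete_valuation kap v \<Longrightarrow> k \<noteq> 0 \<Longrightarrow> v (kap k) = 0"
  by (rule discrete_valuation.v_const)

lemma tt_valuation: "discrete_valuation kap v \<Longrightarrow> v tt = 0"
  using kap_valuation[of v T_var] tt_nonzero by (metis kap.h_0 kap_T_var)

lemma evXT_integral:
  assumes "fpl v" shows "evXT u \<in> vge v 0"
proof -
  interpret finite_place kap xM yM "family f" v by fact
  have "px p \<in> vge v 0" for p using e_integral[of "map_poly rat_const p"] by (simp only: eK_rat_const)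
  moreover have "tt \<in> vge v 0" using tt_valuation[OF discrete_valuation_axioms] by (simp add: vge_def)
  ultimately show ?thesis
    unfolding evXT_def by (intro ev_in_vge px.ring_morphism_axioms)
qed

lemma px_eq_to_fract: "px p = to_fract [:p:]"
  by (simp add: px_def)

text \<open>An irreducible polynomial over \<open>\<rat>\<close> stays irreducible over \<open>\<rat>(T)\<close>.\<close>

lemma minimal_polynomial_rational:
  assumes v: "fpl v" and q0: "prime_elem q0" "px q0 \<in> vge v 1"
  shows "eK b \<in> vge v 1 \<longleftrightarrow> map_poly rat_const q0 dvd b"
proof -
  interpret finite_place kap xM yM "family f" v by fact
  let ?q0 = "map_poly rat_const q0"
  have irr: "irreducible ?q0" using q0(1) by (intro irreducible_map_rat_const prime_elem_imp_irreducible)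
  have q: "q dvd ?q0" using q0(2) by (simp only: vge_1_iff_q_dvd[symmetric] eK_rat_const)
  then have "?q0 dvd q" using irr not_unit_q by (metis irreducibleD')
  with q show ?thesis by (simp add: vge_1_iff_q_dvd) (meson dvd_trans)
qed

text \<open>In the residue field, \<open>T\<close> stays transcendental over \<open>\<rat>[x] / q0\<close>. So a polynomial in \<open>x\<close> and \<open>T\<close>
  vanishes at the place only if each of its coefficients does.\<close>

lemma evXT_vanishes:
  assumes v: "fpl v" and q0: "prime_elem q0" "px q0 \<in> vge v 1" and u: "evXT u \<in> vge v 1"
  shows "[:q0:] dvd u"
proof -
  interpret finite_place kap xM yM "family f" v by fact
  define r where "r = map_poly (\<lambda>a. a mod q0) u"
  have coeff_r: "poly.coeff r i = poly.coeff u i mod q0" for i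
    by (simp add: r_def coeff_map_poly)
  have "[:q0:] dvd u - r"
    by (simp add: const_poly_dvd_iff coeff_r minus_mod_eq_mult_div)
  then obtain d where d: "u - r = [:q0:] * d" by auto
  have "evXT r = evXT u - px q0 * evXT d"
    by (simp only: evXT_const[symmetric] evXT.h_mult[symmetric] evXT.h_diff[symmetric] d[symmetric]) simp
  also have "\<dots> \<in> vge v 1"
    by (intro vge_diff u vge_mult_right q0(2) evXT_integral v)
  finally have "eK (map_poly to_fract (swap r)) \<in> vge v 1"
    by (simp add: eK_fract evXT_eq)
  then have dvd: "map_poly rat_const q0 dvd map_poly to_fract (swap r)"
    using minimal_polynomial_rational[OF v q0] by simp
  have "swap r = 0"
  proof (rule ccontr)
    assume nz: "swap r \<noteq> 0"
    have q00: "q0 \<noteq> 0" "0 < degree q0" using q0(1) by (auto simp: prime_elem_def is_unit_iff_degree)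
    have "poly.coeff (swap r) i = 0" if "degree q0 \<le> i" for i
    proof (rule poly_eqI)
      fix j
      have "degree (poly.coeff r j) < degree q0"
        unfolding coeff_r using degree_mod_less[OF q00(1)] q00(2) by (metis degree_0)
      with that show "poly.coeff (poly.coeff (swap r) i) j = poly.coeff 0 j"
        by (simp add: coeff_swap coeff_eq_0)
    qed
    then have "degree (swap r) < degree q0"
      using nz by (metis leading_coeff_0_iff linorder_not_less)
    moreover have "degree (map_poly to_fract (swap r)) = degree (swap r)"
      by (rule degree_map_poly) simp
    moreover have "map_poly to_fract (swap r) \<noteq> 0" using nz by simp
    ultimately show False using dvd by (metis degree_map_rat_const dvd_imp_degree_le linorder_not_less)
  qed
  then have "u = [:q0:] * d" using d by (simp del: mult_pCons_left)
  then show ?thesis by (metis dvd_triv_left)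
qed

lemma exists_prime_factor:
  fixes v :: "ratfun2 \<Rightarrow> int" and g :: "rat poly poly"
  assumes "discrete_valuation k v" and int: "\<And>b. to_fract b \<in> vge v 0"
    and g: "g \<noteq> 0" "to_fract g \<in> vge v 1"
  shows "\<exists>h. prime_elem h \<and> h dvd g \<and> to_fract h \<in> vge v 1"
proof -
  interpret discrete_valuation k v by fact
  show ?thesis
    using g
  proof (induct g rule: prime_divisors_induct)
    case (unit g)
    then obtain g' where "g * g' = 1" by (metis dvdE)
    then have "to_fract g * to_fract g' = 1" by (metis to_fract_1 to_fract_mult)
    moreover have "to_fract g * to_fract g' \<in> vge v 1" using unit(3) int by (rule vge_mult_right)
    ultimately show ?case by (simp add: vge_def)
  next
    case (factor p g)
    then have "to_fract p * to_fract g \<in> vge v 1" by simp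
    then consider "to_fract p \<in> vge v 1" | "to_fract g \<in> vge v 1"
      using vge_1_mult_iff int by blast
    then show ?case
    proof cases
      case 1
      with factor show ?thesis by (intro exI[of _ p]) (auto simp: prime_imp_prime_elem)
    next
      case 2
      with factor show ?thesis by (auto intro: dvd_mult)
    qed
  qed simp
qed

lemma clear_denominator: "\<exists>n g. px f ^ n * evXT u = to_fract g"
proof (cases "u = 0")
  case True
  then show ?thesis by (intro exI[of _ 0]) simp
qed (use evXT_clear in blast)

text \<open>The coordinates \<open>x\<close> and \<open>y\<close> are not both algebraic over \<open>\<rat>\<close> in the residue field, as \<open>T\<close>
  is transcendental there and \<open>f(x)\<close> is invertible.\<close>

lemma prime_in_x_generates:
  assumes v: "fpl v" and good: "px f \<notin> vge v 1"
    and q0: "prime_elem q0" "px q0 \<in> vge v 1" and g: "to_fract g \<in> vge v 1"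
  shows "[:q0:] dvd g"
proof -
  interpret finite_place kap xM yM "family f" v by fact
  obtain u w where uw: "to_fract g = evXT u + evXT w * yM" using to_fract_repr by blast
  have y2: "yM * yM = evXT [:1, f:]" using tt_px by (simp add: algebra_simps)
  have "evXT (u * u - w * w * [:1, f:]) = to_fract g * (evXT u - evXT w * yM)"
    unfolding uw evXT.h_simps y2[symmetric] by (simp add: algebra_simps)
  also have "\<dots> \<in> vge v 1"
    by (intro vge_mult_right g vge_diff vge_mult_left evXT_integral v Y_integral)
  finally have "[:q0:] dvd u * u - w * w * [:1, f:]" by (rule evXT_vanishes[OF v q0])
  moreover have "\<not> q0 dvd lead_coeff [:1, f:]"
  proof
    assume "q0 dvd lead_coeff [:1, f:]"
    then obtain d where d: "f = q0 * d" using f_nonzero by auto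
    have "px q0 * px d \<in> vge v 1"
      unfolding px_eq_to_fract[of d]
      by (intro vge_mult_right q0 finite_place_to_fract_integral v)
    with good show False by (simp add: d px.h_mult)
  qed
  moreover have "odd (degree [:1, f:])" using f_nonzero by simp
  ultimately have "[:q0:] dvd u \<and> [:q0:] dvd w" using prime_dvd_norm[OF q0(1)] by blast
  then obtain u' w' where uw': "u = [:q0:] * u'" "w = [:q0:] * w'" by (auto elim!: dvdE)
  obtain n a where a: "px f ^ n * evXT u' = to_fract a" using clear_denominator by blast
  obtain m b where b: "px f ^ m * evXT w' = to_fract b" using clear_denominator by blast
  have pow: "to_fract ([:f:] ^ k) = px f ^ k" for k
    by (induct k) (simp_all only: power_0 power_Suc to_fract_1 to_fract_mult px_def)
  have "to_fract ([:f:] ^ (n + m) * g) = px f ^ (n + m) * to_fract g"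
    by (simp only: to_fract_mult pow)
  also have "\<dots> = px q0 * (px f ^ m * (px f ^ n * evXT u') + px f ^ n * (px f ^ m * evXT w') * yM)"
    unfolding uw uw' evXT.h_mult evXT_const by (simp add: power_add algebra_simps)
  also have "\<dots> = to_fract ([:q0:] * ([:f:] ^ m * a + [:f:] ^ n * b * [:0, 1:]))"
    unfolding a b by (simp only: to_fract_mult to_fract_add pow px_def[of q0] yM_def)
  finally have eq: "[:f:] ^ (n + m) * g = [:q0:] * ([:f:] ^ m * a + [:f:] ^ n * b * [:0, 1:])"
    by (simp only: to_fract_eq_iff)
  have "prime_elem [:q0:]" using q0(1) by (simp add: prime_elem_const_poly_iff)
  moreover have "[:q0:] dvd [:f:] ^ (n + m) * g" unfolding eq by (rule dvd_triv_left)
  moreover have "\<not> [:q0:] dvd [:f:]"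
    using \<open>\<not> q0 dvd lead_coeff [:1, f:]\<close> f_nonzero by simp
  ultimately show ?thesis by (metis prime_elem_dvd_mult_iff prime_elem_dvd_power)
qed

text \<open>
  Curves without common component have finitely many common points, so some polynomial in \<open>x\<close> alone
  vanishes at all of them: by the lemma of Gauss, \<open>h\<close> stays irreducible over \<open>\<rat>(x)\<close>.
\<close>

lemma bezout_in_x:
  assumes h: "prime_elem h" and g: "\<not> h dvd g"
  shows "\<exists>d a b. d \<noteq> 0 \<and> [:d:] = a * h + b * (g :: rat poly poly)"
proof (cases "degree h = 0")
  case True
  then obtain d where "h = [:d:]" by (rule degree_eq_zeroE)
  moreover have "h \<noteq> 0" using h by auto
  ultimately have "d \<noteq> 0" "[:d:] = 1 * h + 0 * g" by auto
  then show ?thesis by blast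
next
  case False
  have "irreducible h" using h by (rule prime_elem_imp_irreducible)
  then have irr: "irreducible (map_poly to_fract h)" "content h = 1"
    using nonconst_poly_irreducible_iff[OF False] by auto
  then have "\<not> map_poly to_fract h dvd map_poly to_fract g"
    using g fract_poly_dvdD by blast
  then obtain x y where xy: "x * map_poly to_fract h + y * map_poly to_fract g = 1"
    using bezout_irreducible[OF irr(1)] by blast
  obtain d1 a where a: "d1 \<noteq> 0" "Polynomial.smult (to_fract d1) x = map_poly to_fract a"
    using fract_poly_denominator by blast
  obtain d2 b where b: "d2 \<noteq> 0" "Polynomial.smult (to_fract d2) y = map_poly to_fract b"
    using fract_poly_denominator by blast
  have "map_poly to_fract [:d1 * d2:] = Polynomial.smult (to_fract (d1 * d2)) 1"
    by (simp add: map_poly_pCons one_pCons)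
  also have "\<dots> = Polynomial.smult (to_fract d2) (Polynomial.smult (to_fract d1) x * map_poly to_fract h)
      + Polynomial.smult (to_fract d1) (Polynomial.smult (to_fract d2) y * map_poly to_fract g)"
    unfolding xy[symmetric] by (simp add: smult_add_right mult.commute)
  also have "\<dots> = map_poly to_fract (([:d2:] * a) * h + ([:d1:] * b) * g)"
    unfolding a b by simp
  finally have "[:d1 * d2:] = ([:d2:] * a) * h + ([:d1:] * b) * g"
    by (simp only: fract_poly_eq_iff)
  moreover have "d1 * d2 \<noteq> 0" using a b by simp
  ultimately show ?thesis by blast
qed

text \<open>Away from \<open>f = 0\<close>, the centre of a finite place on the plane is a curve and not a point.\<close>

lemma centre_is_curve:
  assumes v: "fpl v" and good: "px f \<notin> vge v 1"
  shows "\<exists>h. prime_elem h \<and> (\<forall>g. to_fract g \<in> vge v 1 \<longleftrightarrow> h dvd g)"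
proof -
  interpret finite_place kap xM yM "family f" v by fact
  note int = finite_place_to_fract_integral[OF v]
  have "\<exists>g. g \<noteq> 0 \<and> to_fract g \<in> vge v 1"
  proof -
    obtain d q' where q': "d \<noteq> 0" "Polynomial.smult (to_fract d) q = map_poly to_fract q'"
      using fract_poly_denominator by blast
    have "evTX q' = kap (to_fract d) * eK q"
      by (simp only: eK_fract[symmetric] q'(2)[symmetric] kap.ev_smult)
    also have "\<dots> \<in> vge v 1"
      by (intro vge_mult_left q vge_const) simp
    finally have in1: "evXT (swap q') \<in> vge v 1" by (simp only: evTX_eq)
    have "q' \<noteq> 0"
    proof
      assume "q' = 0"
      then have "Polynomial.smult (to_fract d) q = 0" using q'(2) by simp
      with q'(1) q(1) show False by simp
    qed
    then obtain g where g: "px f ^ degree (swap q') * evXT (swap q') = to_fract g" "g \<noteq> 0"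
      using evXT_clear[of "swap q'"] by auto
    have "px f ^ degree (swap q') * evXT (swap q') \<in> vge v 1"
      by (intro vge_mult_left power_in_vge in1) (simp add: px_eq_to_fract int)
    with g show ?thesis by auto
  qed
  then obtain h where h: "prime_elem h" "to_fract h \<in> vge v 1"
    using exists_prime_factor[OF discrete_valuation_axioms int] by blast
  have "h dvd g" if g: "to_fract g \<in> vge v 1" for g
  proof (rule ccontr)
    assume ng: "\<not> h dvd g"
    then obtain d a b where d: "d \<noteq> 0" "[:d:] = a * h + b * g" using bezout_in_x[OF h(1)] by blast
    have "to_fract [:d:] = to_fract a * to_fract h + to_fract b * to_fract g" by (simp add: d(2))
    also have "\<dots> \<in> vge v 1" by (intro vge_add vge_mult_left int h g)
    finally obtain h0 where h0: "prime_elem h0" "h0 dvd [:d:]" "to_fract h0 \<in> vge v 1"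
      using exists_prime_factor[OF discrete_valuation_axioms int, of "[:d:]"] d(1) by auto
    then have "degree h0 = 0" using d(1) dvd_imp_degree_le[OF h0(2)] by simp
    then obtain q0 where q0: "h0 = [:q0:]" by (rule degree_eq_zeroE)
    have q0_prime: "prime_elem q0" using h0(1) by (simp add: q0 prime_elem_const_poly_iff)
    have q0_in: "px q0 \<in> vge v 1" using h0(3) by (simp add: q0 px_def)
    note gen = prime_in_x_generates[OF v good q0_prime q0_in]
    have "[:q0:] dvd h" "[:q0:] dvd g" using gen h(2) g by blast+
    then have "h dvd [:q0:]"
      using prime_elem_imp_irreducible[OF h(1)] h0(1) unfolding q0
      by (metis irreducibleD' prime_elem_def)
    with \<open>[:q0:] dvd g\<close> ng show False using dvd_trans by blast
  qed
  moreover have "to_fract g \<in> vge v 1" if "h dvd g" for g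
    using that h(2) int by (auto elim!: dvdE intro!: vge_mult_right)
  ultimately show ?thesis using h(1) by blast
qed

text \<open>
  Both valuations count the power of \<open>h\<close> in numerator and denominator, as polynomials that \<open>h\<close> does
  not divide are units at the place.
\<close>

lemma place_eq_ordv:
  assumes v: "discrete_valuation kap v" and int: "\<And>g. to_fract g \<in> vge v 0"
    and h: "prime_elem h" and ideal: "\<And>g. to_fract g \<in> vge v 1 \<longleftrightarrow> h dvd g"
  shows "v = ordv h"
proof -
  interpret discrete_valuation kap v by fact
  define e where "e = v (to_fract h)"
  have h0: "h \<noteq> 0" using h by auto
  have e: "1 \<le> e" using ideal[of h] h0 by (simp add: vge_def e_def)
  have poly: "v (to_fract a) = e * int (multiplicity h a)" if nz: "a \<noteq> 0" for a
  proof -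
    obtain b where b: "a = h ^ multiplicity h a * b" "\<not> h dvd b"
      by (rule multiplicity_decompose'[of a h]) (use nz h in \<open>auto simp: prime_elem_def\<close>)
    have b0: "b \<noteq> 0" using b nz by auto
    have "v (to_fract b) = 0" using v_unit_iff[OF int, of b] b(2) ideal by simp
    moreover have "v (to_fract a) = v (to_fract h ^ multiplicity h a * to_fract b)"
    proof -
      have pw: "to_fract (h ^ n) = to_fract h ^ n" for n by (induct n) simp_all
      show ?thesis by (subst b(1)) (simp only: to_fract_mult pw)
    qed
    ultimately show ?thesis using h0 b0 by (simp add: v_mult v_power e_def)
  qed
  have scale: "v z = e * ordv h z" if z: "z \<noteq> 0" for z
  proof -
    obtain a b where a: "z = to_fract a / to_fract b" "b \<noteq> 0" by (metis Fract_cases Fract_conv_to_fract)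
    then have "a \<noteq> 0" using z by auto
    with a h show ?thesis by (simp add: ordv_fraction v_divide poly algebra_simps)
  qed
  have "e = 1"
  proof -
    obtain g where "g \<noteq> 0" "v g = 1" using v_normalised by blast
    then have "e * ordv h g = 1" using scale by simp
    with e show ?thesis by (metis pos_zmult_eq_1_iff int_one_le_iff_zero_less)
  qed
  then show ?thesis using scale ordv_def[of h 0] by (intro ext) (metis mult_1 v_0)
qed

end

section \<open>The points above the zeros of f\<close>

locale split_family = rational_family f for f +
  fixes Pi :: "rat poly set"
  assumes finite_Pi: "finite Pi"
    and irreducible_Pi: "p \<in> Pi \<Longrightarrow> irreducible p"
    and monic_Pi: "p \<in> Pi \<Longrightarrow> lead_coeff p = 1"
    and f_prod: "f = \<Prod>Pi"
begin

lemma Pi_prime: "p \<in> Pi \<Longrightarrow> prime_elem p"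
  using irreducible_Pi field_poly_irreducible_imp_prime by blast

lemma Pi_prime_const: "p \<in> Pi \<Longrightarrow> prime_elem [:p:]"
  using Pi_prime by (simp add: prime_elem_const_poly_iff)

lemma Pi_nonzero: "p \<in> Pi \<Longrightarrow> p \<noteq> 0"
  using irreducible_Pi by (auto simp: irreducible_def)

lemma Pi_dvd_imp_eq:
  assumes "p \<in> Pi" "p' \<in> Pi" "p dvd p'" shows "p = p'"
proof -
  obtain c where c: "p' = p * c" using assms(3) by auto
  then have "is_unit c"
    using irreducible_Pi[OF assms(2)] irreducible_Pi[OF assms(1)] by (metis irreducibleD irreducible_def)
  then obtain a where "c = [:a:]" unfolding is_unit_poly_iff by blast
  moreover have "lead_coeff p' = lead_coeff p * lead_coeff c" by (simp add: c lead_coeff_mult)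
  ultimately have "c = 1" using monic_Pi assms by (simp add: one_pCons)
  with c show ?thesis by simp
qed

lemma prime_dvd_prod:
  fixes q :: "'r::comm_semiring_1"
  assumes "prime_elem q" "finite A" "q dvd prod g A" shows "\<exists>a\<in>A. q dvd g a"
  using assms(2,3)
proof (induct A)
  case empty
  with assms(1) show ?case by (simp add: prime_elem_def)
next
  case (insert a A)
  then show ?case using assms(1) by (auto simp: prime_elem_dvd_mult_iff)
qed

definition cofactor :: "rat poly \<Rightarrow> rat poly" where "cofactor p = \<Prod>(Pi - {p})"

lemma f_cofactor: "p \<in> Pi \<Longrightarrow> f = p * cofactor p"
  unfolding f_prod cofactor_def using finite_Pi by (simp add: prod.remove)

lemma not_dvd_cofactor: "p \<in> Pi \<Longrightarrow> \<not> p dvd cofactor p"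
  unfolding cofactor_def using prime_dvd_prod[OF Pi_prime, of p "Pi - {p}" "\<lambda>x. x"] finite_Pi Pi_dvd_imp_eq
  by auto

lemma px_f: "px f = (\<Prod>p\<in>Pi. px p)"
  by (simp add: f_prod px.h_prod)

text \<open>The place is the order along the exceptional curve of the blow-up of the plane at the point. The
  substitution \<open>y \<leadsto> s + p y\<close> turns it into the order of vanishing along \<open>p = 0\<close>.\<close>

lemma exists_point:
  assumes p: "p \<in> Pi" and s: "s * s = 1"
  shows "\<exists>v. fpl v \<and> px p \<in> vge v 1 \<and> yM - cM s \<in> vge v 1"
proof -
  let ?y = "[:[:s:], p:]"
  have dy: "degree ?y = 1" using Pi_nonzero[OF p] by simp
  interpret sub: injective_morphism "\<lambda>r. to_fract (pcompose r ?y)"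
    by unfold_locales (use dy in \<open>auto simp: pcompose_1 pcompose_add pcompose_mult pcompose_eq_0_iff\<close>)
  define Phi where "Phi = fract_lift (\<lambda>r. to_fract (pcompose r ?y))"
  interpret Phi: injective_morphism Phi
    unfolding Phi_def by (rule sub.injective_morphism_fract_lift)
  have Phi_poly: "Phi (to_fract r) = to_fract (pcompose r ?y)" for r
    unfolding Phi_def by simp
  have Phi_px: "Phi (px g) = px g" for g by (simp add: px_def Phi_poly)
  have Phi_y: "Phi yM = to_fract ?y" by (simp add: yM_def Phi_poly pcompose_pCons)
  have cof0: "px (cofactor p) \<noteq> 0"
    using f_nonzero f_cofactor[OF p] by auto
  define Z where "Z = [:0, [:s + s:], p:]"
  \<comment> \<open>After the substitution \<open>T\<close> is linear in \<open>y\<close> modulo \<open>p\<close>, so it is transcendental in the residue field.\<close>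
  have tau: "Phi tt * px (cofactor p) = to_fract Z"
  proof -
    have pxf: "px f = px p * px (cofactor p)" by (metis f_cofactor[OF p] px.h_mult)
    have "Phi tt * px f = Phi (yM * yM - 1)" by (simp only: tt_px[symmetric] Phi.h_mult Phi_px)
    also have "\<dots> = to_fract (?y * ?y - 1)" by (simp only: Phi.h_diff Phi.h_mult Phi_y Phi.h_1 to_fract_mult to_fract_diff to_fract_1)
    also have "?y * ?y - 1 = [:p:] * Z"
    proof -
      have "[:S, p:] * [:S, p:] - 1 = [:p:] * [:0, S + S, p:]" if "S * S = 1" for S
        using that by (simp add: one_pCons algebra_simps)
      from this[of "[:s:]"] show ?thesis using s unfolding Z_def by (simp only: add_pCons add_0) (simp add: one_pCons)
    qed
    finally have "Phi tt * (px p * px (cofactor p)) = px p * to_fract Z"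
      by (simp only: pxf to_fract_mult px_def[of p])
    then have "px p * (Phi tt * px (cofactor p)) = px p * to_fract Z" by (simp only: ac_simps)
    then show ?thesis using Pi_nonzero[OF p] by simp
  qed
  have s0: "s \<noteq> 0" using s by auto
  have clear: "\<exists>g. px (cofactor p) ^ degree a * Phi (k0 a) = to_fract g \<and> \<not> [:p:] dvd g"
    if "a \<noteq> 0" for a
    using that
  proof (induct a)
    case (pCons r a)
    show ?case
    proof (cases "a = 0")
      case True
      then have r: "r \<noteq> 0" using pCons by simp
      have "k0 (pCons r a) = px [:r:]" by (simp add: True k0_def cM_def)
      then have "px (cofactor p) ^ degree (pCons r a) * Phi (k0 (pCons r a)) = to_fract [:[:r:]:]"
        by (simp add: True Phi_px) (simp add: px_def)
      moreover have "\<not> [:p:] dvd [:[:r:]:]"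
      proof
        assume "[:p:] dvd [:[:r:]:]"
        then have "p dvd [:r:]" by simp
        moreover have "is_unit [:r:]" using r by (simp add: is_unit_const_poly_iff dvd_field_iff)
        ultimately show False using irreducible_Pi[OF p] by (meson dvd_trans irreducible_def)
      qed
      ultimately show ?thesis by blast
    next
      case False
      then obtain g where g: "px (cofactor p) ^ degree a * Phi (k0 a) = to_fract g" "\<not> [:p:] dvd g"
        using pCons by blast
      define A where "A = cofactor p ^ degree (pCons r a) * [:r:]"
      let ?g = "[:A:] + Z * g"
      have pA: "px A = px (cofactor p) ^ degree (pCons r a) * px [:r:]"
        by (simp only: A_def px.h_mult px.h_power)
      have "k0 (pCons r a) = px [:r:] + tt * k0 a" by (simp add: k0_def cM_def)
      then have "px (cofactor p) ^ degree (pCons r a) * Phi (k0 (pCons r a)) =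
          px A + (Phi tt * px (cofactor p)) * (px (cofactor p) ^ degree a * Phi (k0 a))"
        using False by (simp add: pA Phi.h_simps Phi_px algebra_simps)
      also have "\<dots> = px A + to_fract Z * to_fract g" by (simp only: tau g(1))
      also have "\<dots> = to_fract ?g" by (simp only: px_def to_fract_add to_fract_mult)
      finally have 1: "px (cofactor p) ^ degree (pCons r a) * Phi (k0 (pCons r a)) = to_fract ?g" .
      have "\<not> [:p:] dvd ?g"
      proof
        assume dvd: "[:p:] dvd ?g"
        have "?g = pCons A (Polynomial.smult [:s + s:] g) + [:p:] * (pCons 0 (pCons 0 g))"
          by (simp add: Z_def)
        with dvd have "[:p:] dvd pCons A (Polynomial.smult [:s + s:] g)"
          by (metis dvd_add_left_iff dvd_triv_left)
        then have "p dvd poly.coeff (pCons A (Polynomial.smult [:s + s:] g)) (Suc n)" for n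
          by (simp only: const_poly_dvd_iff)
        then have "p dvd Polynomial.smult (s + s) (poly.coeff g n)" for n by simp
        then have "p dvd poly.coeff g n" for n using s0 by (simp add: dvd_smult_iff del: smult_add_left)
        then have "[:p:] dvd g" by (simp add: const_poly_dvd_iff)
        with g(2) show False by contradiction
      qed
      with 1 show ?thesis by blast
    qed
  qed simp
  note h = Pi_prime_const[OF p]
  define w where "w z = ordv [:p:] (Phi z)" for z
  have w_px: "w (px g) = ordv [:p:] (to_fract [:g:])" for g
    unfolding w_def Phi_px by (simp add: px_def)
  have mult: "w (a * b) = w a + w b" if "a \<noteq> 0" "b \<noteq> 0" for a b
    using that by (simp add: w_def Phi.h_mult ordv_mult[OF h])
  have pw: "w (a ^ n) = int n * w a" if "a \<noteq> 0" for a n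
    using that by (induct n) (auto simp: mult algebra_simps, simp add: w_def ordv_fraction[OF h, of 1 1, simplified])
  have w_k0: "w (k0 a) = 0" if a: "a \<noteq> 0" for a
  proof -
    obtain g where g: "px (cofactor p) ^ degree a * Phi (k0 a) = to_fract g" "\<not> [:p:] dvd g"
      using clear[OF a] by blast
    have "w (px (cofactor p)) = 0"
      unfolding w_px using not_dvd_cofactor[OF p] cof0
      by (subst ordv_to_fract[OF h]) (auto simp: not_dvd_imp_multiplicity_0)
    then have "w (px (cofactor p) ^ degree a) = 0" using pw[OF cof0] by simp
    moreover have "w (px (cofactor p) ^ degree a * k0 a) = ordv [:p:] (to_fract g)"
      by (simp add: w_def Phi.h_simps Phi_px g(1))
    moreover have "g \<noteq> 0" using g(2) by auto
    then have "ordv [:p:] (to_fract g) = 0"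
      using g(2) by (subst ordv_to_fract[OF h]) (auto simp: not_dvd_imp_multiplicity_0)
    ultimately show ?thesis using mult[of "px (cofactor p) ^ degree a" "k0 a"] cof0 a by simp
  qed
  have w_p: "w (px p) = 1"
    unfolding w_px using h by (subst ordv_to_fract) (auto simp: prime_elem_def)
  have w_y: "w (yM - cM s) = 1" "yM - cM s \<noteq> 0"
  proof -
    have "Phi (yM - cM s) = to_fract (?y - [:[:s:]:])"
      by (simp only: Phi.h_diff Phi_y cM_def Phi_px) (simp only: px_def to_fract_diff)
    also have "?y - [:[:s:]:] = [:p:] * [:0, 1:]" by simp
    finally have *: "Phi (yM - cM s) = Phi (px p) * to_fract [:0, 1:]"
      by (simp only: to_fract_mult px_def Phi_poly pcompose_const)
    then show "yM - cM s \<noteq> 0" using Pi_nonzero[OF p] by (metis Phi.h_0 Phi.h_eq_0_iff mult_eq_0_iff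
        pCons_eq_0_iff px.h_eq_0_iff to_fract_eq_0_iff zero_neq_one)
    have "\<not> [:p:] dvd [:0, 1:]"
    proof
      assume "[:p:] dvd [:0, 1:]"
      then have "p dvd poly.coeff [:0, 1:] 1" by (simp only: const_poly_dvd_iff)
      then show False using irreducible_Pi[OF p] by (simp add: irreducible_def)
    qed
    then have "ordv [:p:] (to_fract [:0, 1:]) = 0"
      by (subst ordv_to_fract[OF h]) (auto simp: not_dvd_imp_multiplicity_0)
    then show "w (yM - cM s) = 1"
      using w_p Pi_nonzero[OF p] unfolding w_def * by (subst ordv_mult[OF h]) auto
  qed
  have "discrete_valuation kap w"
  proof
    show "w 0 = 0" by (simp add: w_def ordv_def)
    show "min (w a) (w b) \<le> w (a + b)" if "a \<noteq> 0" "b \<noteq> 0" "a + b \<noteq> 0" for a b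
      using that ordv_add[OF h, of "Phi a" "Phi b"] by (metis Phi.h_add Phi.h_eq_0_iff w_def)
    show "w (kap k) = 0" if k: "k \<noteq> 0" for k
    proof -
      obtain a b where ab: "k = to_fract a / to_fract b" "b \<noteq> 0" by (metis Fract_cases Fract_conv_to_fract)
      then have a0: "a \<noteq> 0" using k by auto
      have "to_fract b * k = to_fract a" using ab by simp
      then have "kap (to_fract b * k) = kap (to_fract a)" by simp
      then have "k0 b * kap k = k0 a" by (simp add: kap.h_mult)
      then show ?thesis using mult[of "k0 b" "kap k"] w_k0 ab(2) a0 k by simp
    qed
    show "\<exists>g. g \<noteq> 0 \<and> w g = 1" using w_y by blast
  qed (use mult in auto)
  moreover have "0 \<le> w xM"
    unfolding xM_def w_px by (simp add: ordv_to_fract[OF h])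
  then have "xM \<in> vge w 0" by (simp add: vge_def)
  ultimately have "fpl w"
    using hyperelliptic_axioms by (simp add: finite_place_def finite_place_axioms_def)
  with w_p w_y show ?thesis by (auto simp: vge_def)
qed

text \<open>The place is the closed point \<open>p(x) = 0, y = s\<close>.\<close>

definition pt :: "(ratfun2 \<Rightarrow> int) \<Rightarrow> rat poly \<Rightarrow> rat \<Rightarrow> bool" where
  "pt v p s \<longleftrightarrow> fpl v \<and> p \<in> Pi \<and> s * s = 1 \<and> px p \<in> vge v 1 \<and> yM - cM s \<in> vge v 1"

lemma eK_const: "eK [:rat_const s:] = cM s"
  by simp

text \<open>At these points \<open>y\<close> is congruent to the non-zero constant \<open>s\<close>, so they are of the split kind.\<close>

lemma pt_uniformiser:
  assumes "pt v p s"
  shows "finite_place.uniformises kap xM yM v (eK (finite_place.q kap xM v))"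
proof -
  interpret finite_place kap xM yM "family f" v using assms by (simp add: pt_def)
  have s: "s \<noteq> 0" using assms by (auto simp: pt_def)
  show ?thesis
  proof (rule uniformises_split)
    show "yM - eK [:rat_const s:] \<in> vge v 1" using assms unfolding eK_const pt_def by blast
    have "is_unit [:rat_const s:]" using s by (simp add: is_unit_const_poly_iff dvd_field_iff)
    then show "\<not> q dvd [:rat_const s:]" using not_unit_q dvd_trans by blast
  qed
qed

lemma pt_unique:
  assumes v: "pt v p s" and v': "pt v' p s" shows "v' = v"
proof -
  interpret v: finite_place kap xM yM "family f" v using v by (simp add: pt_def)
  interpret v': finite_place kap xM yM "family f" v' using v' by (simp add: pt_def)
  have p: "prime_elem p" "px p \<in> vge v 1" "px p \<in> vge v' 1" using v v' Pi_prime by (auto simp: pt_def)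
  have q: "eK v.q \<in> vge v' 1"
    using v.q(2) p minimal_polynomial_rational[OF v.finite_place_axioms]
      minimal_polynomial_rational[OF v'.finite_place_axioms] by simp
  show ?thesis
  proof (rule v.section_place_unique)
    show "yM - eK [:rat_const s:] \<in> vge v 1" "yM - eK [:rat_const s:] \<in> vge v' 1"
      using v v' unfolding eK_const pt_def by blast+
    show "v.uniformises (eK v.q)" by (rule pt_uniformiser[OF v])
  qed (rule v.e_integral v'.e_integral v'.finite_place_axioms q)+
qed

lemma cM_valuation: "discrete_valuation kap v \<Longrightarrow> a \<noteq> 0 \<Longrightarrow> v (cM a) = 0"
  using kap_valuation[of v "rat_const a"] by simp

lemma norm_factor: "s * s = 1 \<Longrightarrow> (yM - cM s) * (yM + cM s) = tt * px f"
proof -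
  assume "s * s = 1"
  then have "cM s * cM s = 1" by (simp add: cM.h_mult[symmetric])
  then show ?thesis unfolding tt_px by (simp add: algebra_simps)
qed

lemma y_not_const: "yM - cM s \<noteq> 0" "yM + cM s \<noteq> 0"
proof -
  have "yM - cM a \<noteq> 0" for a
  proof
    assume "yM - cM a = 0"
    then have "to_fract ([:0, 1:] - [:[:a:]:]) = 0"
      by (simp only: yM_def cM_def px_def to_fract_diff)
    then show False unfolding to_fract_eq_0_iff by simp
  qed
  from this[of s] this[of "- s"] show "yM - cM s \<noteq> 0" "yM + cM s \<noteq> 0"
    by (simp_all add: cM.h_uminus)
qed

lemma px_Pi_nonzero: "p \<in> Pi \<Longrightarrow> px p \<noteq> 0"
  using Pi_nonzero by simp

lemma v_px_f:
  assumes "discrete_valuation kap v" shows "v (px f) = (\<Sum>p\<in>Pi. v (px p))"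
  unfolding px_f using px_Pi_nonzero by (rule discrete_valuation.v_prod[OF assms])

text \<open>
  The product of \<open>y - s\<close> and \<open>y + s\<close> is \<open>f T\<close>, which has a simple zero at the point, and only the first
  factor vanishes there.
\<close>

lemma pt_values:
  assumes v: "pt v p s"
  shows "v (px p) = 1" "p' \<in> Pi \<Longrightarrow> p' \<noteq> p \<Longrightarrow> v (px p') = 0"
    "v (yM - cM s) = 1" "v (yM + cM s) = 0"
proof -
  interpret v: finite_place kap xM yM "family f" v using v by (simp add: pt_def)
  have p: "p \<in> Pi" "prime_elem p" "px p \<in> vge v 1" and s: "s * s = 1" "yM - cM s \<in> vge v 1"
    using v Pi_prime by (auto simp: pt_def)
  note minimal = minimal_polynomial_rational[OF v.finite_place_axioms p(2,3)]
  have int: "px g \<in> vge v 0" for g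
    unfolding px_def by (rule finite_place_to_fract_integral[OF v.finite_place_axioms])
  show vp: "v (px p) = 1"
  proof -
    obtain c' where c': "v.q = map_poly rat_const p * c'" using minimal v.q(2) by auto
    then have "eK v.q = px p * eK c'" by (simp add: e.h_mult eK_rat_const)
    moreover have "v (eK v.q) = 1"
      using v.uniformises_valuation[OF pt_uniformiser[OF v] v.e_integral] .
    moreover have "c' \<noteq> 0" using c' v.q(1) by auto
    ultimately have "v (px p) + v (eK c') = 1"
      using px_Pi_nonzero[OF p(1)] v.v_mult[of "px p" "eK c'"] by simp
    moreover have "0 \<le> v (eK c')" using v.e_integral[of c'] \<open>c' \<noteq> 0\<close> by (simp add: vge_def)
    moreover have "1 \<le> v (px p)" using p(3) px_Pi_nonzero[OF p(1)] by (simp add: vge_def)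
    ultimately show ?thesis by linarith
  qed
  show vp': "v (px p') = 0" if p': "p' \<in> Pi" "p' \<noteq> p" for p'
  proof -
    have "px p' \<notin> vge v 1"
    proof
      assume "px p' \<in> vge v 1"
      then have "map_poly rat_const p dvd map_poly rat_const p'"
        by (simp only: minimal[symmetric] eK_rat_const)
      then have "p dvd p'" using map_rat_const_dvd_iff irreducible_Pi[OF p(1)] by blast
      then show False using Pi_dvd_imp_eq p p' by blast
    qed
    then show ?thesis using v.v_unit_iff[OF int] by blast
  qed
  have "yM + cM s \<notin> vge v 1"
  proof
    assume "yM + cM s \<in> vge v 1"
    then have "(yM + cM s) - (yM - cM s) \<in> vge v 1" using s(2) by (rule v.vge_diff)
    moreover have "(yM + cM s) - (yM - cM s) = cM (s + s)" by (simp only: cM.h_add diff_diff_eq2)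
    moreover have "s + s \<noteq> 0" using s(1) by auto
    ultimately show False
      using cM_valuation[OF v.discrete_valuation_axioms, of "s + s"] by (auto simp: vge_def)
  qed
  moreover have "cM s \<in> vge v 0" unfolding cM_def by (rule int)
  ultimately show plus: "v (yM + cM s) = 0"
    using v.v_unit_iff[OF v.vge_add[OF v.Y_integral]] by blast
  have "v (px f) = (\<Sum>p'\<in>Pi. if p' = p then 1 else 0)"
    unfolding v_px_f[OF v.discrete_valuation_axioms] by (rule sum.cong) (auto simp: vp vp')
  then have "v (px f) = 1" using finite_Pi p(1) by simp
  moreover have "v (tt * px f) = v tt + v (px f)" using tt_nonzero f_nonzero by (simp add: v.v_mult)
  ultimately show "v (yM - cM s) = 1"
    using v.v_mult[OF y_not_const(1)[of s] y_not_const(2)[of s]] norm_factor[OF s(1)] plus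
      tt_valuation[OF v.discrete_valuation_axioms] by simp
qed

definition Pt :: "rat poly \<Rightarrow> rat \<Rightarrow> ratfun2 \<Rightarrow> int" where "Pt p s = (THE v. pt v p s)"

lemma pt_Pt: "p \<in> Pi \<Longrightarrow> s * s = 1 \<Longrightarrow> pt (Pt p s) p s"
  unfolding Pt_def using exists_point[of p s] pt_unique
  by (intro theI'[of "\<lambda>v. pt v p s"]) (unfold pt_def, blast)

lemma pt_eq: "pt v p s \<Longrightarrow> v = Pt p s"
  using pt_unique pt_Pt unfolding pt_def by metis

lemma fpl_Pt: "p \<in> Pi \<Longrightarrow> s * s = 1 \<Longrightarrow> fpl (Pt p s)"
  using pt_Pt unfolding pt_def by blast

lemma Pt_eq_iff:
  assumes "p \<in> Pi" "s * s = 1" "p' \<in> Pi" "s' * s' = 1"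
  shows "Pt p s = Pt p' s' \<longleftrightarrow> p = p' \<and> s = s'"
proof
  assume eq: "Pt p s = Pt p' s'"
  note v = pt_values[OF pt_Pt[OF assms(1,2)]] and v' = pt_values[OF pt_Pt[OF assms(3,4)]]
  have "p = p'" using v(1) v'(2)[OF assms(1)] eq by auto
  moreover have "s = s'"
  proof (rule ccontr)
    assume "s \<noteq> s'"
    moreover have "(s - s') * (s + s') = 0" using assms(2,4) by (simp add: algebra_simps)
    ultimately have "s' = - s" by (simp add: eq_neg_iff_add_eq_0 add.commute)
    then show False using v(4) v'(3) eq by (simp add: cM.h_uminus)
  qed
  ultimately show "p = p' \<and> s = s'" by blast
qed simp

text \<open>Where \<open>f(x)\<close> vanishes, so does \<open>y\<^sup>2 - 1 = f T\<close>.\<close>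

lemma point_above_f:
  assumes v: "fpl v" and f: "px f \<in> vge v 1"
  shows "\<exists>p\<in>Pi. v = Pt p 1 \<or> v = Pt p (-1)"
proof -
  interpret v: finite_place kap xM yM "family f" v by fact
  have int: "px g \<in> vge v 0" for g
    unfolding px_def by (rule finite_place_to_fract_integral[OF v])
  have prod: "\<exists>p\<in>A. px p \<in> vge v 1" if "finite A" "(\<Prod>p\<in>A. px p) \<in> vge v 1" for A
    using that
  proof (induct A)
    case empty
    then show ?case by (simp add: vge_def)
  next
    case (insert a A)
    have "(\<Prod>p\<in>A. px p) \<in> vge v 0" unfolding px.h_prod[symmetric] by (rule int)
    with insert show ?case using v.vge_1_mult_iff[OF int] by auto
  qed
  then obtain p where p: "p \<in> Pi" "px p \<in> vge v 1" using f finite_Pi unfolding px_f by blast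
  have "tt \<in> vge v 0" using tt_valuation[OF v.discrete_valuation_axioms] by (simp add: vge_def)
  then have "(yM - cM 1) * (yM + cM 1) \<in> vge v 1"
    unfolding norm_factor[OF mult_1] using f by (rule v.vge_mult_left)
  moreover have c1: "cM 1 \<in> vge v 0" unfolding cM_def by (rule int)
  ultimately consider "yM - cM 1 \<in> vge v 1" | "yM + cM 1 \<in> vge v 1"
    using v.vge_1_mult_iff[OF v.vge_diff[OF v.Y_integral c1] v.vge_add[OF v.Y_integral c1]] by blast
  then show ?thesis
  proof cases
    case 1
    then have "pt v p 1" using v p by (simp add: pt_def)
    then show ?thesis using pt_eq p by blast
  next
    case 2
    then have "pt v p (-1)" using v p by (simp add: pt_def cM.h_uminus)
    then show ?thesis using pt_eq p by blast
  qed
qed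

text \<open>A curve on which both \<open>p(x)\<close> and \<open>y - s\<close> vanish does not exist.\<close>

lemma pt_not_ordv: "prime_elem h \<Longrightarrow> \<not> pt (ordv h) p s"
proof
  assume h: "prime_elem h" and pt: "pt (ordv h) p s"
  have p: "p \<in> Pi" using pt by (simp add: pt_def)
  have "h dvd [:p:]" using pt to_fract_vge_ordv[OF h] by (simp add: pt_def px_def)
  moreover have "[:p:] \<noteq> 0" using Pi_nonzero[OF p] by simp
  ultimately have "degree h \<le> degree [:p:]" by (rule dvd_imp_degree_le)
  then have "degree h = 0" by simp
  then obtain q where q: "h = [:q:]" by (rule degree_eq_zeroE)
  have "yM - cM s = to_fract ([:0, 1:] - [:[:s:]:])"
    by (simp only: yM_def cM_def px_def to_fract_diff)
  then have "h dvd [:0, 1:] - [:[:s:]:]" using pt to_fract_vge_ordv[OF h] by (simp add: pt_def)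
  then have "q dvd poly.coeff ([:0, 1:] - [:[:s:]:]) 1" unfolding q const_poly_dvd_iff by blast
  then have "is_unit h" by (simp add: q is_unit_const_poly_iff)
  with h show False by (simp add: prime_elem_def)
qed

end

section \<open>Functions without horizontal zeros and poles\<close>

context split_family
begin

text \<open>
  The functions whose zeros and poles are curves contained in fibres of \<open>T = (y\<^sup>2 - 1) / f\<close>: the
  factors of \<open>f\<close> are the components of the fibre at infinity, \<open>y = 1\<close> and \<open>y = - 1\<close> those of the
  fibre at \<open>0\<close>, and the other fibres are, up to factors of \<open>f\<close>, given by elements of \<open>\<rat>(T)\<close>.
\<close>

definition U :: "ratfun2 set" where
  "U = {kap k * (\<Prod>p\<in>Pi. px p powi a p) * (yM - cM 1) powi i * (yM + cM 1) powi j | k a i j. k \<noteq> 0}"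

lemma U_I: "k \<noteq> 0 \<Longrightarrow> kap k * (\<Prod>p\<in>Pi. px p powi a p) * (yM - cM 1) powi i * (yM + cM 1) powi j \<in> U"
  unfolding U_def by blast

lemma U_nonzero: "z \<in> U \<Longrightarrow> z \<noteq> 0"
  unfolding U_def using px_Pi_nonzero finite_Pi y_not_const[of 1] by auto

lemma U_mult:
  assumes "z \<in> U" "w \<in> U" shows "z * w \<in> U"
proof -
  from assms obtain k a i j k' a' i' j' where
    z: "z = kap k * (\<Prod>p\<in>Pi. px p powi a p) * (yM - cM 1) powi i * (yM + cM 1) powi j" "k \<noteq> 0" and
    w: "w = kap k' * (\<Prod>p\<in>Pi. px p powi a' p) * (yM - cM 1) powi i' * (yM + cM 1) powi j'" "k' \<noteq> 0"
    unfolding U_def by blast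
  have "(\<Prod>p\<in>Pi. px p powi (a p + a' p)) = (\<Prod>p\<in>Pi. px p powi a p) * (\<Prod>p\<in>Pi. px p powi a' p)"
    unfolding prod.distrib[symmetric] by (rule prod.cong) (simp_all add: power_int_add px_Pi_nonzero Pi_nonzero)
  then have "z * w = kap (k * k') * (\<Prod>p\<in>Pi. px p powi (a p + a' p)) *
      (yM - cM 1) powi (i + i') * (yM + cM 1) powi (j + j')"
    using y_not_const[of 1] by (simp add: z w kap.h_mult power_int_add)
  also have "\<dots> \<in> U" using z w by (intro U_I) simp
  finally show ?thesis .
qed

lemma U_inverse:
  assumes "z \<in> U" shows "inverse z \<in> U"
proof -
  from assms obtain k a i j where
    z: "z = kap k * (\<Prod>p\<in>Pi. px p powi a p) * (yM - cM 1) powi i * (yM + cM 1) powi j" "k \<noteq> 0"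
    unfolding U_def by blast
  have "inverse (\<Prod>p\<in>Pi. px p powi a p) = (\<Prod>p\<in>Pi. px p powi (- a p))"
    unfolding prod_inversef[symmetric] by (rule prod.cong) (simp_all add: power_int_minus o_def)
  moreover have "inverse (kap k) = kap (inverse k)"
    using kap.h_mult[of k "inverse k"] z(2) by (metis inverse_unique kap.h_1 right_inverse)
  ultimately have "inverse z = kap (inverse k) * (\<Prod>p\<in>Pi. px p powi (- a p)) *
      (yM - cM 1) powi (- i) * (yM + cM 1) powi (- j)"
    by (simp only: z inverse_mult_distrib power_int_minus)
  also have "\<dots> \<in> U" using z by (intro U_I) simp
  finally show ?thesis .
qed

lemma U_divide: "z \<in> U \<Longrightarrow> w \<in> U \<Longrightarrow> z / w \<in> U"
  by (simp add: divide_inverse U_mult U_inverse)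

lemma U_kap: "k \<noteq> 0 \<Longrightarrow> kap k \<in> U"
  using U_I[of k "\<lambda>_. 0" 0 0] by simp

lemma U_px:
  assumes "p \<in> Pi" shows "px p \<in> U"
proof -
  have "(\<Prod>p'\<in>Pi. px p' powi of_bool (p' = p)) = (\<Prod>p'\<in>Pi. if p' = p then px p' else 1)"
    by (rule prod.cong) auto
  also have "\<dots> = px p" using finite_Pi assms by simp
  finally show ?thesis using U_I[of 1 "\<lambda>p'. of_bool (p' = p)" 0 0] by simp
qed

lemma U_y: "yM - cM 1 \<in> U" "yM + cM 1 \<in> U"
  using U_I[of 1 "\<lambda>_. 0" 1 0] U_I[of 1 "\<lambda>_. 0" 0 1] by simp_all

lemma U_1: "1 \<in> U"
  using U_kap[of 1] by simp

lemma U_power: "z \<in> U \<Longrightarrow> z ^ n \<in> U"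
  by (induct n) (auto simp: U_1 U_mult)

lemma U_px_f: "px f \<in> U"
proof -
  have "(\<Prod>p\<in>A. px p) \<in> U" if "finite A" "A \<subseteq> Pi" for A
    using that by (induct A) (auto simp: U_1 U_mult U_px)
  from this[OF finite_Pi] show ?thesis by (simp add: px_f)
qed

lemma U_unit:
  assumes "is_unit (r :: rat poly poly)" shows "to_fract r \<in> U"
proof -
  obtain q where q: "r = [:q:]" "is_unit q" using assms unfolding is_unit_poly_iff by blast
  obtain a where a: "q = [:a:]" "a \<noteq> 0" using q(2) by (rule unit_const)
  have "to_fract r = kap (rat_const a)" by (simp add: q a cM_def px_def)
  then show ?thesis using U_kap[of "rat_const a"] a by simp
qed

lemma U_associate:
  assumes h: "prime_elem h" "h dvd g" and g: "irreducible g" "to_fract g \<in> U"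
  shows "to_fract h \<in> U"
proof -
  obtain c where c: "g = h * c" using h(2) by auto
  then have "is_unit c" using g(1) h(1) by (metis irreducibleD prime_elem_def)
  then have "to_fract g / to_fract c \<in> U" using g(2) U_unit U_divide by blast
  moreover have "c \<noteq> 0" using \<open>is_unit c\<close> by auto
  ultimately show ?thesis by (simp add: c)
qed

lemma prime_dvd_f_U:
  assumes h: "prime_elem h" "h dvd [:f:]" shows "to_fract h \<in> U"
proof -
  have const: "[:prod (\<lambda>p. p) A:] = (\<Prod>p\<in>A. [:p:])" for A :: "rat poly set"
  proof (induct A rule: infinite_finite_induct)
    case (insert p A)
    have "[:p * \<Prod>A:] = [:p:] * [:\<Prod>A:]" by simp
    then show ?case by (simp only: prod.insert[OF insert(1,2)] insert(3))
  qed (simp_all add: one_pCons)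
  have "h dvd (\<Prod>p\<in>Pi. [:p:])" using h(2) by (simp only: f_prod const)
  then obtain p where p: "p \<in> Pi" "h dvd [:p:]" using prime_dvd_prod[OF h(1) finite_Pi] by blast
  then show ?thesis
    using U_associate[OF h(1) p(2) prime_elem_imp_irreducible[OF Pi_prime_const[OF p(1)]]] U_px[OF p(1)]
    by (simp add: px_def)
qed

lemma dvd_f_power_U: "r dvd [:f:] ^ n \<Longrightarrow> to_fract r \<in> U"
proof (induct r rule: prime_divisors_induct)
  case zero
  then show ?case using f_nonzero by simp
next
  case (unit r)
  then show ?case by (intro U_unit) simp
next
  case (factor p r)
  then have "p dvd [:f:] ^ n" "r dvd [:f:] ^ n" by (meson dvd_mult_left dvd_mult_right)+
  moreover have "prime_elem p" using factor by (simp add: prime_imp_prime_elem)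
  ultimately have "to_fract p \<in> U" "to_fract r \<in> U"
    using factor prime_dvd_f_U prime_elem_dvd_power by blast+
  then show ?case by (simp add: U_mult)
qed

lemma evTX_clear: "\<exists>n a. px f ^ n * (evTX u + evTX w * yM) = to_fract a"
proof -
  obtain n a where a: "px f ^ n * evTX u = to_fract a" using clear_denominator evTX_eq by metis
  obtain m b where b: "px f ^ m * evTX w = to_fract b" using clear_denominator evTX_eq by metis
  have pow: "to_fract ([:f:] ^ k) = px f ^ k" for k by (simp only: to_fract_power px_def)
  have "px f ^ (n + m) * (evTX u + evTX w * yM) =
      px f ^ m * (px f ^ n * evTX u) + px f ^ n * (px f ^ m * evTX w) * yM"
    by (simp add: power_add algebra_simps)
  also have "\<dots> = to_fract ([:f:] ^ m * a + [:f:] ^ n * b * [:0, 1:])"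
    unfolding a b by (simp only: to_fract_mult to_fract_add pow yM_def)
  finally show ?thesis by blast
qed

lemma to_fract_repr_TX: "\<exists>u w. to_fract g = evTX u + evTX w * yM"
  using to_fract_repr[of g] evXT_eq by metis

lemma evTX_fam: "evTX fam = yM * yM"
proof -
  have "evTX fam = eK (family f)" by (simp only: eK_fract family_eq)
  then show ?thesis by (simp only: eK_family)
qed

lemma evTX_independent:
  assumes "evTX u + evTX w * yM = evTX u' + evTX w' * yM" shows "u = u' \<and> w = w'"
proof -
  have "elt (map_poly to_fract u) (map_poly to_fract w) = elt (map_poly to_fract u') (map_poly to_fract w')"
    unfolding elt_def eK_fract by (rule assms)
  then show ?thesis by (simp only: elt_eq_iff fract_poly_eq_iff)
qed

lemma fam_degree: "degree fam = degree f" "poly.coeff fam (degree f) = [:0, lead_coeff f:]"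
proof -
  have "degree (map_poly to_fract fam) = degree fam" by (rule degree_map_poly) simp
  then show "degree fam = degree f" using degree_family[OF degree_f] family_eq by simp
  show "poly.coeff fam (degree f) = [:0, lead_coeff f:]"
    using degree_f by (simp add: fam_def coeff_inner_const one_pCons coeff_pCons split: nat.splits)
qed

text \<open>The ring \<open>\<rat>[T][x] + \<rat>[T][x] y\<close> modulo a prime \<open>r\<close> of \<open>\<rat>[T]\<close> other than \<open>T\<close> is a domain, as
  the degree of \<open>f\<close> is odd: so \<open>r\<close> is a prime element there.\<close>

lemma fibre_irreducible:
  assumes r: "prime_elem r" "\<not> [:0, 1:] dvd r"
    and dvd: "[:r:] dvd u * u' + w * w' * fam" "[:r:] dvd u * w' + w * u'"
  shows "([:r:] dvd u \<and> [:r:] dvd w) \<or> ([:r:] dvd u' \<and> [:r:] dvd w')"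
proof -
  have "[:r:] dvd (u * u' + w * w' * fam) * (u * u' + w * w' * fam)
      - (u * w' + w * u') * ((u * w' + w * u') * fam)"
    using dvd by (intro dvd_diff dvd_mult2)
  also have "(u * u' + w * w' * fam) * (u * u' + w * w' * fam)
      - (u * w' + w * u') * ((u * w' + w * u') * fam) = (u * u - w * w * fam) * (u' * u' - w' * w' * fam)"
    by (simp add: algebra_simps)
  finally have norms: "[:r:] dvd u * u - w * w * fam \<or> [:r:] dvd u' * u' - w' * w' * fam"
    using r(1) by (simp add: prime_elem_const_poly_iff prime_elem_dvd_mult_iff)
  \<comment> \<open>The leading coefficient of \<open>f T + 1\<close> is \<open>T\<close> up to a constant factor.\<close>
  have "\<not> r dvd lead_coeff fam"
  proof
    assume "r dvd lead_coeff fam"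
    then have "r dvd [:0, 1:] * [:lead_coeff f:]" by (simp add: fam_degree)
    moreover have "\<not> r dvd [:lead_coeff f:]"
    proof
      assume "r dvd [:lead_coeff f:]"
      moreover have "is_unit [:lead_coeff f:]" using f_nonzero by (simp add: is_unit_const_poly_iff dvd_field_iff)
      ultimately show False using r(1) by (meson dvd_trans prime_elem_def)
    qed
    ultimately have "r dvd [:0, 1:]" using r(1) by (simp only: prime_elem_dvd_mult_iff) blast
    then obtain c where c: "[:0, 1:] = r * c" by auto
    have "irreducible [:0, 1 :: rat:]" by (rule irreducible_linear_field_poly) simp
    then have "is_unit c" using c r(1) by (metis irreducibleD prime_elem_def)
    then obtain c' where "c * c' = 1" by (metis dvdE)
    then have "r = [:0, 1:] * c'" by (simp only: c mult.assoc mult_1_right)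
    with r(2) show False by (metis dvd_triv_left)
  qed
  moreover have "odd (degree fam)" using odd_f by (simp add: fam_degree)
  ultimately show ?thesis using norms prime_dvd_norm[OF r(1)] by blast
qed

text \<open>A curve \<open>h = 0\<close> on which some element of \<open>\<rat>(T)\<close> vanishes is part of \<open>f = 0\<close>, one of the lines
  \<open>y = 1\<close>, \<open>y = - 1\<close>, or a full fibre.\<close>

lemma vertical_curve:
  assumes h: "prime_elem h" shows "discrete_valuation kap (ordv h) \<or> to_fract h \<in> U"
proof (rule disjCI)
  assume not_U: "to_fract h \<notin> U"
  have hf: "\<not> h dvd [:f:]" using prime_dvd_f_U[OF h] not_U by blast
  have pow: "to_fract ([:f:] ^ k) = px f ^ k" for k by (simp only: to_fract_power px_def)
  have f0: "px f \<noteq> 0" using f_nonzero by simp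
  have ord_f: "ordv h (px f ^ n) = 0" for n
  proof -
    have "\<not> h dvd [:f:] ^ n" using hf h prime_elem_dvd_power by blast
    moreover have "[:f:] ^ n \<noteq> 0" using f_nonzero by simp
    ultimately show ?thesis
      unfolding pow[symmetric] by (subst ordv_to_fract[OF h]) (auto simp: not_dvd_imp_multiplicity_0)
  qed
  have ord_unit: "ordv h (to_fract g) = 0" if "\<not> h dvd g" for g
  proof -
    have "g \<noteq> 0" using that by auto
    with that show ?thesis by (subst ordv_to_fract[OF h]) (auto simp: not_dvd_imp_multiplicity_0)
  qed
  have k0_unit: "ordv h (k0 a) = 0" if "a \<noteq> 0" for a
    using that
  proof (induct a rule: prime_divisors_induct)
    case (unit a)
    then obtain c where c: "a = [:c:]" "c \<noteq> 0" by (blast elim: unit_const)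
    have "k0 a = to_fract [:[:c:]:]" by (simp add: c k0_def cM_def px_def)
    moreover have "\<not> h dvd [:[:c:]:]"
    proof
      assume "h dvd [:[:c:]:]"
      moreover have "is_unit [:[:c:]:]" using c by (simp add: is_unit_const_poly_iff dvd_field_iff)
      ultimately show False using h by (meson dvd_trans prime_elem_def)
    qed
    ultimately show ?case using ord_unit by simp
  next
    case (factor r a)
    have r: "prime_elem r" using factor by (simp add: prime_imp_prime_elem)
    have r0: "r \<noteq> 0" "a \<noteq> 0" using r factor by auto
    have "ordv h (k0 r) = 0"
    proof (cases "[:0, 1:] dvd r")
      case True
      then obtain c where c: "r = [:0, 1:] * c" by auto
      have "\<not> is_unit [:0, 1 :: rat:]" by (simp add: is_unit_iff_degree)
      then have "is_unit c"
        using prime_elem_imp_irreducible[OF r] c by (metis irreducibleD)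
      then obtain c' where c': "c = [:c':]" "c' \<noteq> 0" by (rule unit_const)
      have "k0 r * px f = cM c' * (tt * px f)"
        by (simp add: c c' k0_def)
      also have "\<dots> = cM c' * (yM * yM - 1)" by (simp only: tt_px)
      also have "\<dots> = to_fract ([:[:c':]:] * ([:-1, 1:] * [:1, 1:]))"
      proof -
        have "yM * yM - 1 = to_fract ([:0, 1:] * [:0, 1:] - 1)"
          by (simp only: yM_def to_fract_mult to_fract_diff to_fract_1)
        also have "[:0, 1:] * [:0, 1:] - 1 = [:-1, 1:] * ([:1, 1:] :: rat poly poly)"
          by (simp add: one_pCons)
        finally show ?thesis by (simp only: to_fract_mult cM_def px_def)
      qed
      finally have eq: "k0 r * px f = to_fract ([:[:c':]:] * ([:-1, 1:] * [:1, 1:]))" .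
      have "\<not> h dvd [:[:c':]:] * ([:-1, 1:] * [:1, 1:])"
      proof
        assume "h dvd [:[:c':]:] * ([:-1, 1:] * [:1, 1:])"
        then consider "h dvd [:[:c':]:]" | "h dvd [:-1, 1:]" | "h dvd [:1, 1:]"
          using h by (metis prime_elem_dvd_mult_iff)
        then show False
        proof cases
          case 1
          moreover have "is_unit [:[:c':]:]" using c' by (simp add: is_unit_const_poly_iff dvd_field_iff)
          ultimately show False using h by (meson dvd_trans prime_elem_def)
        next
          case 2
          have "irreducible [:-1, 1 :: rat poly:]" by (rule irreducible_linear_poly) simp_all
          moreover have "to_fract [:-1, 1:] = yM - cM 1"
          proof -
            have "to_fract ([:0, 1:] - 1) = yM - cM 1"
              by (simp only: to_fract_diff to_fract_1 yM_def cM.h_1)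
            then show ?thesis by (simp add: one_pCons)
          qed
          ultimately show False using U_associate[OF h 2] U_y not_U by simp
        next
          case 3
          have "irreducible [:1, 1 :: rat poly:]" by (rule irreducible_linear_poly) simp_all
          moreover have "to_fract [:1, 1:] = yM + cM 1"
          proof -
            have "to_fract ([:0, 1:] + 1) = yM + cM 1"
              by (simp only: to_fract_add to_fract_1 yM_def cM.h_1)
            then show ?thesis by (simp add: one_pCons)
          qed
          ultimately show False using U_associate[OF h 3] U_y not_U by simp
        qed
      qed
      then have "ordv h (k0 r * px f) = 0" unfolding eq by (rule ord_unit)
      then show ?thesis using ordv_mult[OF h, of "k0 r" "px f"] r0 f0 ord_f[of 1] by simp
    next
      case False
      have "inner_const r \<noteq> 0" using r0 by simp
      then obtain n g where g: "px f ^ n * k0 r = to_fract g"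
        using evXT_clear unfolding k0_eq by blast
      have "\<not> h dvd g"
      proof
        assume "h dvd g"
        then obtain g' where g': "g = h * g'" by auto
        obtain u w where u: "to_fract h = evTX u + evTX w * yM" using to_fract_repr_TX by blast
        obtain u' w' where u': "to_fract g' = evTX u' + evTX w' * yM" using to_fract_repr_TX by blast
        have px_f_TX: "px f = evTX (swap [:f:])" by (simp add: evXT_eq[symmetric])
        have "evTX (u * u' + w * w' * fam) + evTX (u * w' + w * u') * yM = to_fract h * to_fract g'"
          unfolding u u' evTX.h_simps evTX_fam by (simp add: algebra_simps)
        also have "\<dots> = px f ^ n * k0 r" by (simp add: g g')
        also have "\<dots> = evTX ([:r:] * swap [:f:] ^ n) + evTX 0 * yM"
          unfolding evTX.h_mult evTX.h_power evTX_const evTX.h_0 px_f_TX by simp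
        finally have "u * u' + w * w' * fam = [:r:] * swap [:f:] ^ n" "u * w' + w * u' = 0"
          using evTX_independent by blast+
        then have "[:r:] dvd u * u' + w * w' * fam" "[:r:] dvd u * w' + w * u'"
          by (simp_all only: dvd_triv_left dvd_0_right)
        then consider "[:r:] dvd u" "[:r:] dvd w" | "[:r:] dvd u'" "[:r:] dvd w'"
          using fibre_irreducible[OF r False] by blast
        then show False
        proof cases
          case 1
          then obtain u1 w1 where uw: "u = [:r:] * u1" "w = [:r:] * w1" by (auto elim!: dvdE)
          obtain m a where a: "px f ^ m * (evTX u1 + evTX w1 * yM) = to_fract a" using evTX_clear by blast
          have ha: "px f ^ m * to_fract h = k0 r * to_fract a"
            unfolding a[symmetric] u uw evTX.h_mult evTX_const by (simp add: algebra_simps)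
          have "to_fract h * px f ^ (m + n) = to_fract h * (to_fract g' * to_fract a)"
          proof -
            have "to_fract h * px f ^ (m + n) = px f ^ n * (px f ^ m * to_fract h)"
              by (simp add: power_add algebra_simps)
            also have "\<dots> = (px f ^ n * k0 r) * to_fract a" by (simp add: ha)
            finally show ?thesis by (simp add: g g')
          qed
          then have "px f ^ (m + n) = to_fract g' * to_fract a" using h by auto
          then have "to_fract ([:f:] ^ (m + n)) = to_fract (g' * a)" by (simp add: pow)
          then have "[:f:] ^ (m + n) = g' * a" by (simp only: to_fract_eq_iff)
          then have "g' dvd [:f:] ^ (m + n)" by simp
          then have g'U: "to_fract g' \<in> U" by (rule dvd_f_power_U)
          have "k0 r \<in> U" using U_kap[of "to_fract r"] r0 by simp
          then have "px f ^ n * k0 r / to_fract g' \<in> U" using g'U U_px_f by (intro U_divide U_mult U_power)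
          moreover have "px f ^ n * k0 r / to_fract g' = to_fract h"
            using U_nonzero[OF g'U] by (simp add: g g')
          ultimately show False using not_U by simp
        next
          case 2
          then obtain u1 w1 where uw: "u' = [:r:] * u1" "w' = [:r:] * w1" by (auto elim!: dvdE)
          obtain m a where a: "px f ^ m * (evTX u1 + evTX w1 * yM) = to_fract a" using evTX_clear by blast
          have ha: "px f ^ m * to_fract g' = k0 r * to_fract a"
            unfolding a[symmetric] u' uw evTX.h_mult evTX_const by (simp add: algebra_simps)
          have "to_fract g \<noteq> 0" using g r0 f0 by (metis k0.h_eq_0_iff mult_eq_0_iff power_not_zero)
          then have g'0: "to_fract g' \<noteq> 0" by (auto simp: g')
          have "to_fract g' * px f ^ (m + n) = to_fract g' * (to_fract h * to_fract a)"
          proof -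
            have "to_fract g' * px f ^ (m + n) = px f ^ n * (px f ^ m * to_fract g')"
              by (simp add: power_add algebra_simps)
            also have "\<dots> = (px f ^ n * k0 r) * to_fract a" by (simp add: ha)
            finally show ?thesis by (simp add: g g')
          qed
          then have "px f ^ (m + n) = to_fract h * to_fract a" using g'0 by simp
          then have "to_fract ([:f:] ^ (m + n)) = to_fract (h * a)" by (simp add: pow)
          then have "[:f:] ^ (m + n) = h * a" by (simp only: to_fract_eq_iff)
          then have "h dvd [:f:] ^ (m + n)" by simp
          with hf h show False using prime_elem_dvd_power by blast
        qed
      qed
      then have "ordv h (px f ^ n * k0 r) = 0" unfolding g by (rule ord_unit)
      then show ?thesis using ordv_mult[OF h, of "px f ^ n" "k0 r"] r0 f0 ord_f by simp
    qed
    then show ?case using ordv_mult[OF h, of "k0 r" "k0 a"] factor r0 by (simp add: k0.h_mult)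
  qed simp
  show "discrete_valuation kap (ordv h)"
  proof (rule discrete_valuation_ordv[OF h])
    fix k :: ratfun assume k: "k \<noteq> 0"
    obtain a b where ab: "k = to_fract a / to_fract b" "b \<noteq> 0" by (metis Fract_cases Fract_conv_to_fract)
    then have a0: "a \<noteq> 0" using k by auto
    have "to_fract b * k = to_fract a" using ab by simp
    then have "kap (to_fract b * k) = kap (to_fract a)" by simp
    then have "k0 b * kap k = k0 a" by (simp add: kap.h_mult)
    then show "ordv h (kap k) = 0" using ordv_mult[OF h, of "k0 b" "kap k"] k0_unit ab(2) a0 k by simp
  qed
qed

lemma horizontal_finite:
  assumes "prime_elem h" "discrete_valuation kap (ordv h)" shows "fpl (ordv h)"
proof -
  have "0 \<le> ordv h xM" unfolding xM_def px_def by (simp add: ordv_to_fract[OF assms(1)])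
  then have "xM \<in> vge (ordv h) 0" by (simp add: vge_def)
  then show ?thesis
    using assms hyperelliptic_axioms by (simp add: finite_place_def finite_place_axioms_def)
qed

text \<open>
  The order along a prime factor of the numerator or denominator is not zero, so each prime factor
  is a vertical curve.
\<close>

lemma U_criterion:
  assumes z: "z \<noteq> 0"
    and no_horizontal: "\<And>h. prime_elem h \<Longrightarrow> discrete_valuation kap (ordv h) \<Longrightarrow> ordv h z = 0"
  shows "z \<in> U"
proof -
  have poly: "to_fract r \<in> U" if "r \<noteq> 0" "\<And>h. prime_elem h \<Longrightarrow> h dvd r \<Longrightarrow> to_fract h \<in> U" for r
    using that
  proof (induct r rule: prime_divisors_induct)
    case (factor p r)
    have "to_fract p \<in> U" using factor by (intro factor.prems) (auto simp: prime_imp_prime_elem)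
    moreover have "to_fract r \<in> U" using factor by auto
    ultimately show ?case by (simp add: U_mult)
  qed (auto intro: U_unit)
  define a b where "a = fst (quot_of_fract z)" and "b = snd (quot_of_fract z)"
  have ab: "z = to_fract a / to_fract b" "b \<noteq> 0" "coprime a b"
    unfolding a_def b_def by (simp_all add: Fract_conv_to_fract[symmetric] coprime_quot_of_fract)
  then have a0: "a \<noteq> 0" using z by auto
  have h_U: "to_fract h \<in> U" if h: "prime_elem h" "h dvd a \<or> h dvd b" for h
  proof (rule ccontr)
    assume "to_fract h \<notin> U"
    then have "ordv h z = 0" using vertical_curve no_horizontal h(1) by blast
    then have eq: "multiplicity h a = multiplicity h b"
      using ordv_fraction[OF h(1) a0 ab(2)] ab(1) by simp
    have nu: "\<not> is_unit h" using h(1) by (simp add: prime_elem_def)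
    have pos: "0 < multiplicity h r \<longleftrightarrow> h dvd r" if "r \<noteq> 0" for r
      using multiplicity_gt_zero_iff[OF that nu] .
    have "h dvd a" "h dvd b" using h(2) eq pos[OF a0] pos[OF ab(2)] by auto
    with ab(3) nu show False using coprime_common_divisor by blast
  qed
  have "to_fract a \<in> U" "to_fract b \<in> U" using poly a0 ab(2) h_U by blast+
  then show ?thesis unfolding ab(1) by (rule U_divide)
qed

lemma U_valuation:
  assumes v: "discrete_valuation kap v" and k: "k \<noteq> 0"
  shows "v (kap k * (\<Prod>p\<in>Pi. px p powi a p) * (yM - cM 1) powi i * (yM + cM 1) powi j) =
    (\<Sum>p\<in>Pi. a p * v (px p)) + i * v (yM - cM 1) + j * v (yM + cM 1)"
proof -
  interpret v: discrete_valuation kap v by fact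
  have p0: "px p powi a p \<noteq> 0" if "p \<in> Pi" for p using px_Pi_nonzero[OF that] by simp
  then have P: "(\<Prod>p\<in>Pi. px p powi a p) \<noteq> 0" using finite_Pi by auto
  have "v (\<Prod>p\<in>Pi. px p powi a p) = (\<Sum>p\<in>Pi. v (px p powi a p))"
    using p0 by (rule v.v_prod)
  then show ?thesis
    using P k y_not_const[of 1] kap_valuation[OF v k]
    by (simp add: v.v_mult v.v_power_int)
qed

lemma Pt_values:
  assumes p: "p \<in> Pi"
  shows "p' \<in> Pi \<Longrightarrow> Pt p 1 (px p') = of_bool (p' = p)"
    "p' \<in> Pi \<Longrightarrow> Pt p (-1) (px p') = of_bool (p' = p)"
    "Pt p 1 (yM - cM 1) = 1" "Pt p 1 (yM + cM 1) = 0"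
    "Pt p (-1) (yM - cM 1) = 0" "Pt p (-1) (yM + cM 1) = 1"
  using pt_values[OF pt_Pt[OF p, of 1]] pt_values[OF pt_Pt[OF p, of "-1"]]
  by (auto simp: cM.h_uminus)

lemma sum_of_bool_Pi: "p \<in> Pi \<Longrightarrow> (\<Sum>p'\<in>Pi. a p' * (of_bool (p' = p) :: int)) = a p"
proof -
  assume p: "p \<in> Pi"
  have "(\<Sum>p'\<in>Pi. a p' * (of_bool (p' = p) :: int)) = (\<Sum>p'\<in>Pi. if p' = p then a p' else 0)"
    by (rule sum.cong) auto
  then show ?thesis using finite_Pi p by simp
qed

text \<open>At the points above a zero of \<open>p\<close>, the orders are the exponent of \<open>p\<close> plus that of \<open>y - 1\<close>
  and plus that of \<open>y + 1\<close>, respectively.\<close>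

lemma U_at_points:
  assumes p: "p \<in> Pi" and k: "k \<noteq> 0"
    and z: "z = kap k * (\<Prod>p\<in>Pi. px p powi a p) * (yM - cM 1) powi i * (yM + cM 1) powi j"
  shows "Pt p 1 z = a p + i" "Pt p (-1) z = a p + j"
proof -
  have v: "discrete_valuation kap (Pt p 1)" "discrete_valuation kap (Pt p (-1))"
    using fpl_Pt[OF p] by (simp_all add: finite_place_def)
  have s: "(\<Sum>p'\<in>Pi. a p' * Pt p 1 (px p')) = a p" "(\<Sum>p'\<in>Pi. a p' * Pt p (-1) (px p')) = a p"
    by (subst sum.cong[OF refl, of _ _ "\<lambda>p'. a p' * of_bool (p' = p)"],
        simp add: Pt_values(1,2)[OF p], rule sum_of_bool_Pi[OF p])+
  show "Pt p 1 z = a p + i" "Pt p (-1) z = a p + j"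
    unfolding z U_valuation[OF v(1) k] U_valuation[OF v(2) k] s using Pt_values(3-6)[OF p] by simp_all
qed

text \<open>
  A function without finite zeros and poles belongs to \<open>U\<close>. Its orders at the two points above each
  \<open>p\<close> show that \<open>y - 1\<close> and \<open>y + 1\<close> have the same exponent in it and each \<open>p\<close> the opposite one. So it
  is a power of \<open>(y\<^sup>2 - 1) / f = T\<close> times a constant.
\<close>

sublocale hyperelliptic_constants kap xM yM "family f"
proof
  fix g :: ratfun2
  assume g: "g \<noteq> 0" and zero: "\<And>v. fpl v \<Longrightarrow> v g = 0"
  have "g \<in> U" using zero horizontal_finite by (intro U_criterion[OF g]) blast
  then obtain k a i j where k: "k \<noteq> 0" and
    z: "g = kap k * (\<Prod>p\<in>Pi. px p powi a p) * (yM - cM 1) powi i * (yM + cM 1) powi j"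
    unfolding U_def by blast
  have ai: "a p = - i" "j = i" if p: "p \<in> Pi" for p
    using U_at_points[OF p k z] zero[OF fpl_Pt[OF p, of 1]] zero[OF fpl_Pt[OF p, of "-1"]] by simp_all
  interpret inf: discrete_valuation kap v_inf by (rule discrete_valuation_v_inf)
  have "Pi \<noteq> {}" using degree_f f_prod by auto
  then have j: "j = i" using ai(2) by blast
  have "v_inf (yM - cM 1) + v_inf (yM + cM 1) = (\<Sum>p\<in>Pi. v_inf (px p))"
  proof -
    have "v_inf ((yM - cM 1) * (yM + cM 1)) = v_inf tt + v_inf (px f)"
      unfolding norm_factor[OF mult_1] using tt_nonzero f_nonzero by (simp add: inf.v_mult)
    then show ?thesis
      using tt_valuation[OF inf.discrete_valuation_axioms] y_not_const[of 1]
      by (simp add: inf.v_mult v_px_f[OF inf.discrete_valuation_axioms])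
  qed
  moreover have "(\<Sum>p\<in>Pi. a p * v_inf (px p)) = - i * (\<Sum>p\<in>Pi. v_inf (px p))"
    unfolding sum_distrib_left by (rule sum.cong) (simp_all add: ai)
  moreover have "v_inf g = (\<Sum>p\<in>Pi. a p * v_inf (px p)) + i * (v_inf (yM - cM 1) + v_inf (yM + cM 1))"
    unfolding z U_valuation[OF inf.discrete_valuation_axioms k] j by (simp add: algebra_simps)
  ultimately show "v_inf g = 0" by simp
qed

section \<open>The explicit basis\<close>

text \<open>
  Such a function belongs to \<open>U\<close>. The points with \<open>y = - 1\<close> show that the exponents of all \<open>p\<close> agree,
  and the point above \<open>p0\<close> with \<open>y = 1\<close> that they cancel the exponent of \<open>y - 1\<close>.
\<close>

lemma independent_points:
  assumes p0: "p0 \<in> Pi" and h: "h \<noteq> 0"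
    and div: "\<And>u. fpl u \<Longrightarrow> u h = (\<Sum>p\<in>Pi - {p0}. k p * of_bool (Pt p 1 = u))"
    and p: "p \<in> Pi - {p0}"
  shows "k p = (0::int)"
proof -
  have "h \<in> U"
  proof (rule U_criterion[OF h])
    fix h' assume h': "prime_elem h'" "discrete_valuation kap (ordv h')"
    have "Pt p 1 \<noteq> ordv h'" if "p \<in> Pi" for p
      using pt_Pt[OF that, of 1] pt_not_ordv[OF h'(1)] by auto
    then show "ordv h' h = 0" using div[OF horizontal_finite[OF h']] by simp
  qed
  then obtain k' a i j where k': "k' \<noteq> 0" and
    z: "h = kap k' * (\<Prod>p\<in>Pi. px p powi a p) * (yM - cM 1) powi i * (yM + cM 1) powi j"
    unfolding U_def by blast
  have minus: "a p' + j = 0" if p': "p' \<in> Pi" for p'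
  proof -
    have "Pt p' (-1) h = 0"
      unfolding div[OF fpl_Pt[OF p', of "-1", simplified]] using p' by (simp add: Pt_eq_iff)
    then show ?thesis using U_at_points(2)[OF p' k' z] by simp
  qed
  have plus: "a p' + i = (\<Sum>p\<in>Pi - {p0}. k p * of_bool (p = p'))" if p': "p' \<in> Pi" for p'
  proof -
    have "Pt p' 1 h = (\<Sum>p\<in>Pi - {p0}. k p * of_bool (p = p'))"
      unfolding div[OF fpl_Pt[OF p', of 1, simplified]] using p'
      by (intro sum.cong) (auto simp: Pt_eq_iff)
    then show ?thesis using U_at_points(1)[OF p' k' z] by simp
  qed
  have "a p0 + i = 0" unfolding plus[OF p0] by (intro sum.neutral) auto
  then have "a p + i = 0" using minus[OF p0] minus[of p] p by simp
  moreover have "a p + i = k p"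
  proof -
    have "(\<Sum>p'\<in>Pi - {p0}. k p' * of_bool (p' = p)) = (\<Sum>p'\<in>Pi - {p0}. if p' = p then k p' else 0)"
      by (rule sum.cong) auto
    then show ?thesis using plus[of p] p finite_Pi by simp
  qed
  ultimately show ?thesis by simp
qed

text \<open>Multiplication by powers of the \<open>p\<close> clears the zeros at the points with \<open>y = - 1\<close>, as \<open>p\<close>
  vanishes at both points above its zeros; a power of \<open>y - 1\<close> then clears the point above \<open>p0\<close>.\<close>

lemma generating_points:
  assumes p0: "p0 \<in> Pi" and v: "fpl v"
  shows "\<exists>h k. h \<noteq> 0 \<and>
      (\<forall>u. fpl u \<longrightarrow> u h = of_bool (v = u) - (\<Sum>p\<in>Pi - {p0}. k p * of_bool (Pt p 1 = u)))"
proof -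
  have "\<exists>g. g \<noteq> 0 \<and> (\<forall>u. fpl u \<and> px f \<notin> vge u 1 \<longrightarrow> u g = of_bool (v = u))"
  proof (cases "px f \<in> vge v 1")
    case True
    have "u 1 = of_bool (v = u)" if "fpl u" "px f \<notin> vge u 1" for u
      using that True discrete_valuation.v_1[of kap u] by (auto simp: finite_place_def)
    then show ?thesis by (intro exI[of _ 1]) auto
  next
    case False
    obtain h where h: "prime_elem h" "\<And>g. to_fract g \<in> vge v 1 \<longleftrightarrow> h dvd g"
      using centre_is_curve[OF v False] by blast
    have v_eq: "v = ordv h"
      using v by (intro place_eq_ordv[OF _ finite_place_to_fract_integral[OF v] h]) (simp add: finite_place_def)
    have "u (to_fract h) = of_bool (v = u)" if u: "fpl u" "px f \<notin> vge u 1" for u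
    proof -
      obtain h' where h': "prime_elem h'" "\<And>g. to_fract g \<in> vge u 1 \<longleftrightarrow> h' dvd g"
        using centre_is_curve[OF u] by blast
      have u_eq: "u = ordv h'"
        using u by (intro place_eq_ordv[OF _ finite_place_to_fract_integral[OF u(1)] h']) (simp add: finite_place_def)
      show ?thesis
      proof (cases "v = u")
        case True
        have "v (to_fract h) = 1" unfolding v_eq using h(1) by (subst ordv_to_fract) (auto simp: prime_elem_def)
        with True show ?thesis by simp
      next
        case False
        have "\<not> h' dvd h"
        proof
          assume "h' dvd h"
          then have "h dvd h'"
            using prime_elem_imp_irreducible[OF h(1)] h'(1) by (metis irreducibleD' prime_elem_def)
          then have "h dvd g \<longleftrightarrow> h' dvd g" for g using \<open>h' dvd h\<close> dvd_trans by blast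
          then have "to_fract g \<in> vge u 1 \<longleftrightarrow> h dvd g" for g using h'(2) by simp
          then have "u = ordv h"
            using u by (intro place_eq_ordv[OF _ finite_place_to_fract_integral[OF u(1)] h(1)])
              (simp_all add: finite_place_def)
          with False v_eq show False by simp
        qed
        then have "to_fract h \<notin> vge u 1" using h'(2) by simp
        moreover have "to_fract h \<in> vge u 0" by (rule finite_place_to_fract_integral[OF u(1)])
        ultimately show ?thesis using False by (auto simp: vge_def)
      qed
    qed
    moreover have "to_fract h \<noteq> 0" using h(1) by auto
    ultimately show ?thesis by blast
  qed
  then obtain g where g: "g \<noteq> 0" "\<And>u. fpl u \<Longrightarrow> px f \<notin> vge u 1 \<Longrightarrow> u g = of_bool (v = u)" by blast
  \<comment> \<open>The wanted divisor plus \<open>d\<close> is that of \<open>g\<close> at the points above the zeros of \<open>f\<close>.\<close>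
  define d where "d p s = Pt p s g - of_bool (v = Pt p s)" for p s
  define n where "n = d p0 1 - d p0 (-1)"
  define z where "z = kap 1 * (\<Prod>p\<in>Pi. px p powi (- d p (-1))) * (yM - cM 1) powi (- n) * (yM + cM 1) powi 0"
  define k where "k p = n - (d p 1 - d p (-1))" for p
  have z0: "z \<noteq> 0" unfolding z_def by (rule U_nonzero, rule U_I) simp
  have zU: "Pt p 1 z = - d p (-1) - n" "Pt p (-1) z = - d p (-1)" if "p \<in> Pi" for p
    using U_at_points[OF that _ z_def] by simp_all
  have "u (g * z) = of_bool (v = u) - (\<Sum>p\<in>Pi - {p0}. k p * of_bool (Pt p 1 = u))" if u: "fpl u" for u
  proof -
    have uv: "discrete_valuation kap u" using u by (simp add: finite_place_def)
    have prod: "u (g * z) = u g + u z" using g(1) z0 by (rule discrete_valuation.v_mult[OF uv])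
    show ?thesis
    proof (cases "px f \<in> vge u 1")
      case False
      interpret u: finite_place kap xM yM "family f" u by fact
      have int: "px g \<in> vge u 0" for g
        unfolding px_def by (rule finite_place_to_fract_integral[OF u])
      have px0: "u (px p) = 0" if p: "p \<in> Pi" for p
      proof -
        have "px f = px p * px (cofactor p)" by (metis f_cofactor[OF p] px.h_mult)
        then have "px p \<notin> vge u 1" using False u.vge_mult_right[OF _ int] by auto
        then show ?thesis using u.v_unit_iff[OF int] by blast
      qed
      have nPt: "Pt p 1 \<noteq> u" if p: "p \<in> Pi" for p
        using px0[OF p] pt_values(1)[OF pt_Pt[OF p, of 1]] by auto
      have "u (px f) = 0" unfolding v_px_f[OF uv] using px0 by simp
      then have "u ((yM - cM 1) * (yM + cM 1)) = 0"
        unfolding norm_factor[OF mult_1] using tt_nonzero f_nonzero tt_valuation[OF uv] by (simp add: u.v_mult)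
      then have "u (yM - cM 1) + u (yM + cM 1) = 0" using y_not_const[of 1] by (simp add: u.v_mult)
      moreover have c1: "cM 1 \<in> vge u 0" unfolding cM_def by (rule int)
      have "0 \<le> u (yM - cM 1)" "0 \<le> u (yM + cM 1)"
        using u.vge_diff[OF u.Y_integral c1] u.vge_add[OF u.Y_integral c1] y_not_const[of 1]
        by (simp_all add: vge_def)
      ultimately have "u (yM - cM 1) = 0" by simp
      then have "u z = 0"
        unfolding z_def by (subst U_valuation[OF uv]) (simp_all add: px0)
      then show ?thesis using prod g(2)[OF u False] nPt by simp
    next
      case True
      then obtain p where p: "p \<in> Pi" and "u = Pt p 1 \<or> u = Pt p (-1)" using point_above_f[OF u] by blast
      then consider "u = Pt p 1" | "u = Pt p (-1)" by blast
      then show ?thesis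
      proof cases
        case 2
        have "(\<Sum>p'\<in>Pi - {p0}. k p' * of_bool (Pt p' 1 = u)) = 0"
          unfolding 2 using p by (intro sum.neutral) (auto simp: Pt_eq_iff)
        then show ?thesis using prod zU(2)[OF p] by (simp add: 2 d_def)
      next
        case 1
        have "(\<Sum>p'\<in>Pi - {p0}. k p' * of_bool (Pt p' 1 = u)) = (\<Sum>p'\<in>Pi - {p0}. if p' = p then k p' else 0)"
          unfolding 1 using p by (intro sum.cong) (auto simp: Pt_eq_iff)
        also have "\<dots> = (if p = p0 then 0 else k p)" using finite_Pi p by simp
        also have "\<dots> = k p" by (simp add: k_def n_def)
        finally show ?thesis using prod zU(1)[OF p] by (simp add: 1 d_def k_def)
      qed
    qed
  qed
  moreover have "g * z \<noteq> 0" using g(1) z0 by simp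
  ultimately show ?thesis by blast
qed

lemma place_at_eq:
  assumes p: "p \<in> Pi" shows "place_at (family f) (map_poly rat_const p) 1 = Pt p 1 \<circ> iota"
proof -
  have one: "eK [:1:] = cM 1" by simp
  have pos: "0 < v g \<longleftrightarrow> g \<in> vge v 1" if "g \<noteq> 0" for v and g :: ratfun2
    using that by (auto simp: vge_def)
  have conv: "0 < (v \<circ> iota) (of_x (map_poly rat_const p)) \<and> 0 < (v \<circ> iota) (y_minus 1) \<longleftrightarrow>
      px p \<in> vge v 1 \<and> yM - cM 1 \<in> vge v 1" for v
    unfolding o_def iota_of_x iota_y_minus one eK_rat_const
    using pos[OF px_Pi_nonzero[OF p]] pos[OF y_not_const(1)[of 1]] by blast
  show ?thesis
    unfolding place_at_def
  proof (rule the_equality)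
    have "pt (Pt p 1) p 1" using pt_Pt[OF p] by simp
    then show "Pt p 1 \<circ> iota \<in> places (family f) \<and> 0 < (Pt p 1 \<circ> iota) (of_x (map_poly rat_const p)) \<and>
        0 < (Pt p 1 \<circ> iota) (y_minus 1)"
      unfolding conv place_iff pt_def by (simp add: finite_place_def)
    fix w assume w: "w \<in> places (family f) \<and> 0 < w (of_x (map_poly rat_const p)) \<and> 0 < w (y_minus 1)"
    then obtain v where v: "discrete_valuation kap v" "w = v \<circ> iota" unfolding places_eq by blast
    then have in1: "px p \<in> vge v 1" "yM - cM 1 \<in> vge v 1" using w conv by blast+
    have "v \<noteq> v_inf"
    proof
      assume "v = v_inf"
      then have "v (px p) \<le> 0"
        using v_inf_e[of "map_poly rat_const p"] Pi_nonzero[OF p] by (simp add: eK_rat_const)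
      with in1(1) px_Pi_nonzero[OF p] show False by (auto simp: vge_def)
    qed
    then have "pt v p 1" using v in1 p by (simp add: pt_def finite_or_inf)
    then show "w = Pt p 1 \<circ> iota" using pt_eq v(2) by blast
  qed
qed

text \<open>The one relation between the points with \<open>y = 1\<close>, the divisor of \<open>y - 1\<close>, allows to omit \<open>p0\<close>.\<close>

theorem jacobian_basis_of_factors:
  assumes "p0 \<in> Pi"
  shows "basis_family J (Pi - {p0}) (\<lambda>p. place_class (family f) (place_at (family f) (map_poly rat_const p) 1))"
proof -
  have "basis_family J (Pi - {p0}) (\<lambda>p. place_class (family f) (Pt p 1 \<circ> iota))"
  proof (rule jacobian_basis)
    show "finite (Pi - {p0})" using finite_Pi by simp
    show "fpl (Pt p 1)" if "p \<in> Pi - {p0}" for p using that fpl_Pt by simp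
  qed (rule generating_points[OF assms], assumption, rule independent_points[OF assms])
  then show ?thesis
    by (rule basis_family.basis_family_cong) (simp add: place_at_eq)
qed

end

section \<open>The factors of f\<close>

definition factors :: "nat \<Rightarrow> nat \<Rightarrow> (nat \<Rightarrow> rat) \<Rightarrow> (nat \<Rightarrow> rat) \<Rightarrow> rat poly set" where
  "factors m n a b = (\<lambda>k. [:- a k, 1:]) ` {1..m} \<union> (\<lambda>k. [:a k, 1:]) ` {1..m} \<union>
     (\<lambda>l. [:(b l)\<^sup>2, 0, 1:]) ` {1..n}"

lemma admissible_seq_pos:
  assumes "admissible_seq m a" "k \<in> {1..m}" shows "0 < a k"
  using assms strict_mono_onD[of "{0..m}" a 0 k] by (auto simp: admissible_seq_def)

lemma admissible_seq_inj:
  assumes "admissible_seq m a" shows "inj_on a {1..m}"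
proof -
  have "inj_on a {0..m}"
    using assms by (auto simp: admissible_seq_def intro: strict_mono_on_imp_inj_on)
  then show ?thesis by (rule inj_on_subset) auto
qed

lemma irreducible_linear: "irreducible [:c, 1 :: rat:]"
  by (rule irreducible_linear_field_poly) simp

lemma irreducible_sum_of_squares:
  fixes c :: rat
  assumes c: "c \<noteq> 0" shows "irreducible [:c\<^sup>2, 0, 1:]"
proof (rule irreducibleI)
  let ?q = "[:c\<^sup>2, 0, 1:]"
  show "?q \<noteq> 0" by simp
  show "\<not> is_unit ?q" by (simp add: is_unit_iff_degree)
  fix x y assume xy: "?q = x * y"
  have nz: "x \<noteq> 0" "y \<noteq> 0"
  proof -
    have "x * y \<noteq> 0" unfolding xy[symmetric] by simp
    then show "x \<noteq> 0" "y \<noteq> 0" by auto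
  qed
  have "degree ?q = degree x + degree y" unfolding xy using nz by (rule degree_mult_eq)
  then have "degree x + degree y = 2" by simp
  moreover have "degree x \<noteq> 1"
  proof
    assume "degree x = 1"
    then obtain r s where x: "x = [:r, s:]" "s \<noteq> 0" by (rule degree1_coeffs)
    have "poly x (- r / s) = 0" using x by simp
    then have "poly ?q (- r / s) = 0" unfolding xy by simp
    then have "c\<^sup>2 + (- r / s)\<^sup>2 = 0" by (simp add: power2_eq_square)
    then show False using c by (simp add: sum_power2_eq_zero_iff)
  qed
  ultimately have "degree x = 0 \<or> degree y = 0" by arith
  then show "is_unit x \<or> is_unit y" using nz by (auto simp: is_unit_iff_degree)
qed

lemma factors_disjoint:
  assumes a: "admissible_seq m a"
  shows "(\<lambda>k. [:- a k, 1:]) ` {1..m} \<inter> (\<lambda>k. [:a k, 1:]) ` {1..m} = {}"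
    "((\<lambda>k. [:- a k, 1:]) ` {1..m} \<union> (\<lambda>k. [:a k, 1:]) ` {1..m}) \<inter> (\<lambda>l. [:(b l)\<^sup>2, 0, 1:]) ` {1..n} = {}"
proof -
  have "- a k \<noteq> a k'" if "k \<in> {1..m}" "k' \<in> {1..m}" for k k'
    using admissible_seq_pos[OF a that(1)] admissible_seq_pos[OF a that(2)] by linarith
  then show "(\<lambda>k. [:- a k, 1:]) ` {1..m} \<inter> (\<lambda>k. [:a k, 1:]) ` {1..m} = {}" by fastforce
qed auto

lemma factors_inj:
  assumes a: "admissible_seq m a" and b: "admissible_seq n b"
  shows "inj_on (\<lambda>k. [:- a k, 1:]) {1..m}" "inj_on (\<lambda>k. [:a k, 1:]) {1..m}"
    "inj_on (\<lambda>l. [:(b l)\<^sup>2, 0, 1:]) {1..n}"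
proof -
  show "inj_on (\<lambda>k. [:- a k, 1:]) {1..m}" "inj_on (\<lambda>k. [:a k, 1:]) {1..m}"
    by (rule inj_onI, rule inj_onD[OF admissible_seq_inj[OF a]], simp, assumption, assumption)+
  show "inj_on (\<lambda>l. [:(b l)\<^sup>2, 0, 1:]) {1..n}"
  proof (rule inj_onI)
    fix k l assume kl: "k \<in> {1..n}" "l \<in> {1..n}" "[:(b k)\<^sup>2, 0, 1:] = [:(b l)\<^sup>2, 0, 1:]"
    then have "(b k)\<^sup>2 = (b l)\<^sup>2" by simp
    moreover have "0 \<le> b k" "0 \<le> b l"
      using admissible_seq_pos[OF b kl(1)] admissible_seq_pos[OF b kl(2)] by linarith+
    ultimately have "b k = b l" by (rule power2_eq_imp_eq)
    from inj_onD[OF admissible_seq_inj[OF b] this kl(1,2)] show "k = l" .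
  qed
qed

lemma card_factors:
  assumes a: "admissible_seq m a" and b: "admissible_seq n b"
  shows "card (factors m n a b) = 2 * m + n"
proof -
  let ?A = "(\<lambda>k. [:- a k, 1:]) ` {1..m}" and ?B = "(\<lambda>k. [:a k, 1:]) ` {1..m}"
    and ?C = "(\<lambda>l. [:(b l)\<^sup>2, 0, 1:]) ` {1..n}"
  have card: "card ?A = m" "card ?B = m" "card ?C = n"
    using factors_inj[OF a b] by (simp_all add: card_image)
  have "card ((?A \<union> ?B) \<union> ?C) = card (?A \<union> ?B) + card ?C"
    by (intro card_Un_disjoint factors_disjoint(2)[OF a]) simp_all
  also have "card (?A \<union> ?B) = card ?A + card ?B"
    by (intro card_Un_disjoint factors_disjoint(1)[OF a]) simp_all
  finally show ?thesis unfolding factors_def card by simp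
qed

lemma x_not_factor:
  assumes a: "admissible_seq m a" shows "[:0, 1:] \<notin> factors m n a b"
  using admissible_seq_pos[OF a] by (auto simp: factors_def) fastforce+

lemma f_poly_eq_prod:
  assumes a: "admissible_seq m a" and b: "admissible_seq n b"
  shows "f_poly m n a b = \<Prod>(insert [:0, 1:] (factors m n a b))"
proof -
  let ?A = "(\<lambda>k. [:- a k, 1:]) ` {1..m}" and ?B = "(\<lambda>k. [:a k, 1:]) ` {1..m}"
    and ?C = "(\<lambda>l. [:(b l)\<^sup>2, 0, 1:]) ` {1..n}"
  have "\<Prod>((?A \<union> ?B) \<union> ?C) = \<Prod>(?A \<union> ?B) * \<Prod>?C"
    by (intro prod.union_disjoint factors_disjoint(2)[OF a]) simp_all
  also have "\<Prod>(?A \<union> ?B) = \<Prod>?A * \<Prod>?B"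
    by (intro prod.union_disjoint factors_disjoint(1)[OF a]) simp_all
  finally have "\<Prod>(factors m n a b) =
      ((\<Prod>k\<in>{1..m}. [:- a k, 1:]) * (\<Prod>k\<in>{1..m}. [:a k, 1:])) * (\<Prod>l\<in>{1..n}. [:(b l)\<^sup>2, 0, 1:])"
    unfolding factors_def using factors_inj[OF a b] by (simp only: prod.reindex o_def)
  also have "(\<Prod>k\<in>{1..m}. [:- a k, 1:]) * (\<Prod>k\<in>{1..m}. [:a k, 1:]) = (\<Prod>k\<in>{1..m}. [:- ((a k)\<^sup>2), 0, 1:])"
    unfolding prod.distrib[symmetric] by (rule prod.cong) (simp_all add: power2_eq_square)
  finally have "\<Prod>(factors m n a b) = (\<Prod>k\<in>{1..m}. [:- ((a k)\<^sup>2), 0, 1:]) * (\<Prod>l\<in>{1..n}. [:(b l)\<^sup>2, 0, 1:])" .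
  moreover have "finite (factors m n a b)" by (simp add: factors_def)
  ultimately show ?thesis
    using x_not_factor[OF a] by (simp add: f_poly_def mult.assoc del: mult_pCons_left)
qed

lemma odd_degree_f_poly: "odd (degree (f_poly m n a b))"
proof -
  have deg: "degree (\<Prod>k\<in>A. [:c k, 0, 1:]) = 2 * card A" for c :: "nat \<Rightarrow> rat" and A :: "nat set"
    by (subst degree_prod_eq_sum_degree) auto
  have nz: "(\<Prod>k\<in>A. [:c k, 0, 1:]) \<noteq> 0" for c :: "nat \<Rightarrow> rat" and A :: "nat set"
    by (cases "finite A") auto
  have "degree (f_poly m n a b) = 1 + 2 * m + 2 * n"
    unfolding f_poly_def using nz by (simp add: degree_mult_eq deg del: mult_pCons_left)
  then show ?thesis by simp
qed

theorem theorem1p7: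
  fixes g r m n :: nat and a b :: "nat \<Rightarrow> rat"
  assumes "1 \<le> g" and "g \<le> r" and "r < 2 * g + 1"
    and "m + n = g" and "2 * m + n = r"
    and "admissible_seq m a" and "admissible_seq n b"
  shows "free_rank (jacobian_points (family (f_poly m n a b))) = r \<and>
    card (explicit_basis m n a b) = r \<and>
    free_part_basis (jacobian_points (family (f_poly m n a b))) (explicit_basis m n a b)"
proof -
  note a = assms(6) and b = assms(7)
  let ?x = "[:0, 1:] :: rat poly" and ?S = "factors m n a b"
  let ?F = "family (f_poly m n a b)"
  interpret split_family "f_poly m n a b" "insert ?x ?S"
  proof
    show "finite (insert ?x ?S)" by (simp add: factors_def)
    show "odd (degree (f_poly m n a b))" by (rule odd_degree_f_poly)
    show "f_poly m n a b = \<Prod>(insert ?x ?S)" by (rule f_poly_eq_prod[OF a b])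
    fix p assume "p \<in> insert ?x ?S"
    moreover have "irreducible [:(b l)\<^sup>2, 0, 1:]" if "l \<in> {1..n}" for l
      using admissible_seq_pos[OF b that] by (intro irreducible_sum_of_squares) simp
    ultimately show "irreducible p" "lead_coeff p = 1"
      unfolding factors_def using irreducible_linear by auto
  qed
  let ?cls = "\<lambda>p. place_class ?F (place_at ?F (map_poly rat_const p) 1)"
  have "insert ?x ?S - {?x} = ?S" using x_not_factor[OF a] by simp
  then interpret basis: basis_family "jacobian_points ?F" ?S ?cls
    using jacobian_basis_of_factors[of ?x] by simp
  have "explicit_basis m n a b = ?cls ` ?S"
    by (simp add: explicit_basis_def Let_def factors_def image_Un image_image)
  then show ?thesis
    using basis.free_part_basis_image basis.free_rank_eq card_image[OF basis.inj_on_f]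
      card_factors[OF a b] assms(5) by simp
qed

end
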